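(* Let $\boldsymbol\lambda = (\lambda_{i})_{i\in\mathbb N}$ and $\boldsymbol d = (d_{i})_{i\in\mathbb N}$ be real sequences converging to $0$. If there is a self-adjoint operator $E$ with diagonal $\boldsymbol\lambda$, \[\delta(\alpha,\boldsymbol\lambda, \boldsymbol d)\geq 0\quad\text{for all }\alpha\in\mathbb R\setminus\{0\},\] and \[\liminf_{\alpha\searrow 0}\delta(\alpha,\boldsymbol\lambda, \boldsymbol d) = \liminf_{\alpha\nearrow 0}\delta(\alpha,\boldsymbol\lambda, \boldsymbol d)\in (0,\infty),\] then $\boldsymbol d$ is also a diagonal of $E$.
   Context: For real sequences $\boldsymbol\lambda$ and $\boldsymbol d$ converging to $0$ and $\alpha\in\mathbb R\setminus\{0\}$, \[\delta(\alpha,\boldsymbol\lambda,\boldsymbol{d}) = \begin{cases} \displaystyle\sum_{i:\lambda_{i}\geq\alpha}(\lambda_{i}-\alpha)-\sum_{i:d_{i}\geq\alpha}(d_{i}-\alpha) & \alpha>0,\\ \displaystyle\sum_{i:\lambda_{i}\leq\alpha}(\alpha-\lambda_{i})-\sum_{i:d_{i}\leq\alpha}(\alpha-d_{i}) & \alpha<0. \end{cases}\] Operators are bounded linear operators on a separable Hilbert space $\mathcal H$. A real family $(c_i)_{i\in I}$ is a diagonal of a self-adjoint operator $E$ on $\mathcal H$ if there is an orthonormal basis $(e_i)_{i\in I}$ of $\mathcal H$ with $\langle Ee_i,e_i\rangle=c_i$ for all $i\in I$. *)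

theory Defs
  imports "HOL-Analysis.Analysis"
begin

text \<open>The real inner product inherited from \<open>real_inner\<close> is the real part of \<open>cinner\<close>, so that
  the norm, the topology and completeness of a complex inner product space are the library's.
  The complex inner product is linear in its first argument.\<close>

class complex_inner = real_inner +
  fixes scaleC :: "complex \<Rightarrow> 'a \<Rightarrow> 'a"  (infixr \<open>*\<^sub>C\<close> 75)
    and cinner :: "'a \<Rightarrow> 'a \<Rightarrow> complex"
  assumes scaleC_add_right: "a *\<^sub>C (x + y) = a *\<^sub>C x + a *\<^sub>C y"
    and scaleC_add_left: "(a + b) *\<^sub>C x = a *\<^sub>C x + b *\<^sub>C x"
    and scaleC_scaleC: "a *\<^sub>C (b *\<^sub>C x) = (a * b) *\<^sub>C x"
    and scaleC_of_real: "complex_of_real r *\<^sub>C x = r *\<^sub>R x"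
    and cinner_commute: "cinner x y = cnj (cinner y x)"
    and cinner_add_left: "cinner (x + y) z = cinner x z + cinner y z"
    and cinner_scaleC_left: "cinner (a *\<^sub>C x) y = a * cinner x y"
    and Re_cinner: "Re (cinner x y) = inner x y"

lemma scaleC_one: "1 *\<^sub>C (x::'a::complex_inner) = x"
  using scaleC_of_real[of 1 x] by simp

interpretation complex_vector:
  vector_space "scaleC :: complex \<Rightarrow> 'a \<Rightarrow> 'a::complex_inner"
  by unfold_locales
    (simp_all add: scaleC_add_right scaleC_add_left scaleC_scaleC scaleC_one)

definition bounded_operator :: "('a::complex_inner \<Rightarrow> 'a) \<Rightarrow> bool" where
  "bounded_operator E \<longleftrightarrow> bounded_linear E \<and> (\<forall>a x. E (a *\<^sub>C x) = a *\<^sub>C E x)"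

definition self_adjoint :: "('a::complex_inner \<Rightarrow> 'a) \<Rightarrow> bool" where
  "self_adjoint E \<longleftrightarrow> bounded_operator E \<and> (\<forall>x y. cinner (E x) y = cinner x (E y))"

definition orthonormal_basis :: "('i \<Rightarrow> 'a::complex_inner) \<Rightarrow> bool" where
  "orthonormal_basis e \<longleftrightarrow>
     (\<forall>i j. cinner (e i) (e j) = (if i = j then 1 else 0)) \<and>
     closure (complex_vector.span (range e)) = UNIV"

definition is_diagonal :: "('a::complex_inner \<Rightarrow> 'a) \<Rightarrow> ('i \<Rightarrow> real) \<Rightarrow> bool" where
  "is_diagonal E c \<longleftrightarrow>
     (\<exists>e. orthonormal_basis e \<and> (\<forall>i. cinner (E (e i)) (e i) = complex_of_real (c i)))"

text \<open>For sequences tending to \<open>0\<close> and \<open>\<alpha> \<noteq> 0\<close> all index sets below are finite, so the sums are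
  genuine finite sums. The value at \<open>\<alpha> = 0\<close> is meaningless.\<close>

definition delta :: "real \<Rightarrow> (nat \<Rightarrow> real) \<Rightarrow> (nat \<Rightarrow> real) \<Rightarrow> real" where
  "delta \<alpha> lam d =
     (if \<alpha> > 0
      then (\<Sum>i\<in>{i. lam i \<ge> \<alpha>}. lam i - \<alpha>) - (\<Sum>i\<in>{i. d i \<ge> \<alpha>}. d i - \<alpha>)
      else (\<Sum>i\<in>{i. lam i \<le> \<alpha>}. \<alpha> - lam i) - (\<Sum>i\<in>{i. d i \<le> \<alpha>}. \<alpha> - d i))"

end

theory Submission imports Defs begin

text \<open>Rotating two orthonormal vectors, with a phase that cancels the cross terms of the quadratic
  form of \<open>E\<close>, replaces two diagonal entries by convex combinations of them. Hence a diagonal may be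
  replaced by a majorized one on each of infinitely many disjoint finite blocks, and an infinite
  chain of rotations is harmless as long as consecutive leftover vectors have inner product
  bounded away from 1. Since both excesses are positive near \<open>0\<close>, such moves allow us to assume
  that \<open>lam\<close> and \<open>d\<close> have no zeros and infinitely many entries of each sign. List the positive and
  the negative entries of each sequence by decreasing modulus. The partial sums of the differences
  are then nonnegative and have the same limit inferior \<open>\<sigma>\<close> on both sides. Moving a little mass
  within the positive and within the negative part of \<open>lam\<close> lowers these partial sums to common
  values \<open>X n\<close> at suitable cuts, so that between consecutive cuts \<open>lam\<close> majorizes \<open>d\<close>, the surplus
  \<open>X (Suc n) - X n\<close> of the positive part paying for the one of the negative part.\<close>

section \<open>Moving diagonal entries\<close>

text \<open>The off-diagonal entries of \<open>E\<close> are unknown, and a rotation yields convex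
  combinations of two entries, so zeros of \<open>lam\<close> cannot be pulled apart by rotating
  them with each other. Mass has to come from a nonzero entry and reach infinitely many indices. If
  \<open>lam\<close> has finitely many positive entries, disjoint finite blocks cannot achieve this;
  hence the chains. For \<open>d\<close> the direction is reversed: it is the target, so it may be
  pulled apart as long as the excess inequalities survive, and the positive limit inferior pays for
  that near \<open>0\<close>.

  A finite block has to preserve its trace, whereas the partial sums may oscillate and need not
  return exactly to any value. So the cuts are chosen, independently on the two sides, where the
  sums are close to their limit inferior, and there both are lowered to the same number. This is
  where the two limits inferior have to be equal and finite.\<close>

lemma cinner_add_right: "cinner x (y + z) = cinner x y + cinner (x::'a::complex_inner) z"
  by (metis cinner_commute cinner_add_left complex_cnj_add)

lemma cinner_scaleC_right: "cinner x (a *\<^sub>C y) = cnj a * cinner (x::'a::complex_inner) y"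
  by (metis cinner_commute cinner_scaleC_left complex_cnj_mult)

lemma cinner_zero_left: "cinner 0 (x::'a::complex_inner) = 0"
  by (metis add_cancel_left_left cinner_add_left)

lemma cinner_minus_left: "cinner (- x) y = - cinner x (y::'a::complex_inner)"
proof -
  have "cinner (- x) y + cinner x y = 0"
    by (simp add: cinner_zero_left flip: cinner_add_left)
  then show ?thesis by (simp add: add_eq_0_iff2)
qed

lemma norm_eq_1_if_cinner:
  assumes "cinner x x = (1::complex)" shows "norm (x::'a::complex_inner) = 1"
proof -
  have "inner x x = 1"
    using assms Re_cinner[of x x] by simp
  then show ?thesis by (simp add: norm_eq_1)
qed

lemma norm_scaleC: "norm (a *\<^sub>C x) = cmod a * norm (x::'a::complex_inner)"
proof -
  have "(norm (a *\<^sub>C x))\<^sup>2 = Re (cinner (a *\<^sub>C x) (a *\<^sub>C x))"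
    by (simp only: Re_cinner power2_norm_eq_inner)
  also have "\<dots> = Re ((a * cnj a) * cinner x x)"
    by (simp only: cinner_scaleC_left cinner_scaleC_right ac_simps)
  also have "\<dots> = (cmod a)\<^sup>2 * Re (cinner x x)"
    by (simp flip: complex_norm_square of_real_power)
  also have "\<dots> = (cmod a * norm x)\<^sup>2"
    by (simp add: Re_cinner power2_norm_eq_inner power_mult_distrib)
  finally show ?thesis
    by (simp add: power2_eq_iff_nonneg)
qed

definition orthonormal :: "('i \<Rightarrow> 'a::complex_inner) \<Rightarrow> bool" where
  "orthonormal e \<longleftrightarrow> (\<forall>i j. cinner (e i) (e j) = (if i = j then 1 else 0))"

lemma orthonormalD:
  assumes "orthonormal e"
  shows "cinner (e i) (e i) = 1" "i \<noteq> j \<Longrightarrow> cinner (e i) (e j) = 0"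
  using assms by (auto simp: orthonormal_def)

lemma cinner_span_left:
  assumes "x \<in> complex_vector.span A" and "\<And>a. a \<in> A \<Longrightarrow> cinner a y = 0"
  shows "cinner x (y::'a::complex_inner) = 0"
  using assms(1)
proof (induction rule: complex_vector.span_induct_alt)
  case base then show ?case by (simp add: cinner_zero_left)
next
  case (step c x y) then show ?case by (simp add: cinner_add_left cinner_scaleC_left assms(2))
qed

lemma cinner_span_span:
  assumes "x \<in> complex_vector.span A" "y \<in> complex_vector.span B"
    and "\<And>a b. a \<in> A \<Longrightarrow> b \<in> B \<Longrightarrow> cinner a b = 0"
  shows "cinner x (y::'a::complex_inner) = 0"
proof (rule cinner_span_left[OF assms(1)])
  fix a assume "a \<in> A"
  then have "cinner y a = 0"
    by (intro cinner_span_left[OF assms(2)]) (metis assms(3) cinner_commute complex_cnj_zero)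
  then show "cinner a y = 0" by (metis cinner_commute complex_cnj_zero)
qed

section \<open>Rotations of an orthonormal pair\<close>

text \<open>For \<open>z \<noteq> 0\<close> the product \<open>cnj (phase z) * z\<close> is
  \<open>- \<i> * of_real (cmod z)\<close>; twice its real part is the cross term of the quadratic
  form, so that term vanishes. At \<open>z = 0\<close> there is no cross term, and the value
  \<open>1\<close> keeps the modulus \<open>1\<close>.\<close>

definition phase :: "complex \<Rightarrow> complex" where
  "phase z = (if z = 0 then 1 else \<i> * z / of_real (cmod z))"

lemma phase_mult_cnj: "phase z * cnj (phase z) = 1" "cnj (phase z) * phase z = 1"
proof -
  have "cmod (phase z) = 1" by (simp add: phase_def norm_divide norm_mult)
  then show "phase z * cnj (phase z) = 1" by (metis complex_norm_square of_real_1 power_one)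
  then show "cnj (phase z) * phase z = 1" by (simp add: mult.commute)
qed

lemma phase_cancel: "cnj (phase z) * z + phase z * cnj z = 0"
  by (auto simp: phase_def field_simps)

text \<open>The phase makes the cross terms of the quadratic form of \<open>E\<close> cancel, so that the
  diagonal entries of the rotated pair are convex combinations of the old ones.\<close>

definition rot1 :: "('a::complex_inner \<Rightarrow> 'a) \<Rightarrow> real \<Rightarrow> 'a \<Rightarrow> 'a \<Rightarrow> 'a" where
  "rot1 E t x y = of_real (sqrt t) *\<^sub>C x + (of_real (sqrt (1 - t)) * phase (cinner (E x) y)) *\<^sub>C y"

definition rot2 :: "('a::complex_inner \<Rightarrow> 'a) \<Rightarrow> real \<Rightarrow> 'a \<Rightarrow> 'a \<Rightarrow> 'a" where
  "rot2 E t x y = of_real (sqrt (1 - t)) *\<^sub>C x + (- of_real (sqrt t) * phase (cinner (E x) y)) *\<^sub>C y"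

lemma self_adjoint_add: "self_adjoint E \<Longrightarrow> E (x + y) = E x + E y"
  by (simp add: self_adjoint_def bounded_operator_def linear_add bounded_linear.linear)

lemma self_adjoint_scaleC: "self_adjoint E \<Longrightarrow> E (a *\<^sub>C x) = a *\<^sub>C E x"
  by (simp add: self_adjoint_def bounded_operator_def)

lemma self_adjoint_cinner: "self_adjoint E \<Longrightarrow> cinner (E x) y = cinner x (E y)"
  by (simp add: self_adjoint_def)

lemma cinner_lincomb:
  assumes "cinner x x = 1" "cinner y y = 1" "cinner x y = 0"
  shows "cinner (a *\<^sub>C x + b *\<^sub>C y) (c *\<^sub>C x + d *\<^sub>C y) = a * cnj c + b * cnj (d::complex)"
proof -
  have "cinner y x = 0" using assms(3) by (metis cinner_commute complex_cnj_zero)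
  then show ?thesis
    by (simp add: cinner_add_left cinner_add_right cinner_scaleC_left cinner_scaleC_right assms)
qed

lemma cinner_form_lincomb:
  assumes "self_adjoint E"
  shows "cinner (E (a *\<^sub>C x + b *\<^sub>C y)) (a *\<^sub>C x + b *\<^sub>C y) =
    a * cnj a * cinner (E x) x + b * cnj b * cinner (E y) y +
    (a * cnj b * cinner (E x) y + b * cnj a * cnj (cinner (E x) y))"
proof -
  have "cinner (E y) x = cnj (cinner (E x) y)"
    using self_adjoint_cinner[OF assms, of x y] cinner_commute[of "E y" x] by simp
  then show ?thesis
    by (simp add: self_adjoint_add[OF assms] self_adjoint_scaleC[OF assms] cinner_add_left
        cinner_add_right cinner_scaleC_left cinner_scaleC_right algebra_simps)
qed

lemma of_real_sqrt_mult: "0 \<le> t \<Longrightarrow> complex_of_real (sqrt t) * of_real (sqrt t) = of_real t"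
  by (metis of_real_mult real_sqrt_mult_self abs_of_nonneg)

lemma rot:
  assumes E: "self_adjoint E"
    and x: "cinner x x = 1" and y: "cinner y y = 1" and xy: "cinner x y = 0"
    and t: "0 \<le> t" "t \<le> 1"
    and A: "cinner (E x) x = complex_of_real A" and B: "cinner (E y) y = complex_of_real B"
  defines "u \<equiv> rot1 E t x y" and "v \<equiv> rot2 E t x y"
  shows "cinner u u = 1" "cinner v v = 1" "cinner u v = 0"
    and "cinner (E u) u = of_real (t * A + (1 - t) * B)"
    and "cinner (E v) v = of_real ((1 - t) * A + t * B)"
    and "x = of_real (sqrt t) *\<^sub>C u + of_real (sqrt (1 - t)) *\<^sub>C v"
    and "y = (of_real (sqrt (1 - t)) * cnj (phase (cinner (E x) y))) *\<^sub>C u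
            + (- of_real (sqrt t) * cnj (phase (cinner (E x) y))) *\<^sub>C v"
proof -
  define w where "w = phase (cinner (E x) y)"
  define p q where "p = complex_of_real (sqrt t)" and "q = complex_of_real (sqrt (1 - t))"
  have u: "u = p *\<^sub>C x + (q * w) *\<^sub>C y" and v: "v = q *\<^sub>C x + (- p * w) *\<^sub>C y"
    by (simp_all add: u_def v_def rot1_def rot2_def w_def p_def q_def)
  have w1: "w * cnj w = 1" "cnj w * w = 1" by (simp_all add: w_def phase_mult_cnj)
  have pq: "p * p = of_real t" "q * q = of_real (1 - t)" "cnj p = p" "cnj q = q"
    using t by (simp_all add: p_def q_def of_real_sqrt_mult)
  have pq1: "p * p + q * q = 1" by (simp add: pq)
  have w2: "cnj w * cinner (E x) y + w * cnj (cinner (E x) y) = 0"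
    by (simp add: w_def phase_cancel)
  have ww: "(q * w) * cnj (q * w) = q * q" "(p * w) * cnj (p * w) = p * p"
    "(- p * w) * cnj (- p * w) = p * p"
    using w1 by (simp_all add: pq algebra_simps)
  show "cinner u u = 1" "cinner v v = 1" "cinner u v = 0"
    using w1(1) pq1
    unfolding u v cinner_lincomb[OF x y xy] complex_cnj_mult complex_cnj_minus pq(3,4)
    by algebra+
  have "cinner (E u) u = p * p * A + q * q * B +
      p * q * (cnj w * cinner (E x) y + w * cnj (cinner (E x) y))"
    unfolding u cinner_form_lincomb[OF E] A B ww by (simp add: pq(3,4) algebra_simps)
  then show "cinner (E u) u = of_real (t * A + (1 - t) * B)"
    by (simp add: w2 pq)
  have "cinner (E v) v = q * q * A + p * p * B -
      p * q * (cnj w * cinner (E x) y + w * cnj (cinner (E x) y))"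
    unfolding v cinner_form_lincomb[OF E] A B ww by (simp add: pq(3,4) algebra_simps)
  then show "cinner (E v) v = of_real ((1 - t) * A + t * B)"
    by (simp add: w2 pq)
  have "p *\<^sub>C u + q *\<^sub>C v = (p * p + q * q) *\<^sub>C x + (p * (q * w) + q * (- p * w)) *\<^sub>C y"
    unfolding u v scaleC_add_right scaleC_scaleC scaleC_add_left by (simp only: ac_simps)
  also have "\<dots> = x"
    using pq1 by (simp add: scaleC_one algebra_simps)
  finally show "x = p *\<^sub>C u + q *\<^sub>C v" ..
  have "(q * cnj w) *\<^sub>C u + (- p * cnj w) *\<^sub>C v
      = ((q * cnj w) * p + (- p * cnj w) * q) *\<^sub>C x
      + ((q * cnj w) * (q * w) + (- p * cnj w) * (- p * w)) *\<^sub>C y"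
    unfolding u v scaleC_add_right scaleC_scaleC scaleC_add_left by (simp only: ac_simps)
  also have "(q * cnj w) * (q * w) + (- p * cnj w) * (- p * w) = (p * p + q * q) * (w * cnj w)"
    by (simp add: algebra_simps)
  also have "\<dots> = 1" by (simp add: pq1 w1)
  also have "(q * cnj w) * p + (- p * cnj w) * q = 0" by simp
  finally show "y = (q * cnj (phase (cinner (E x) y))) *\<^sub>C u
      + (- p * cnj (phase (cinner (E x) y))) *\<^sub>C v"
    by (simp add: scaleC_one flip: w_def)
qed

section \<open>Local changes of an orthonormal family, and gluing them\<close>

text \<open>Quantifying over all orthonormal families with diagonal \<open>lam\<close> on
  \<open>S\<close> makes moves composable, since the off-diagonal entries after a move are unknown.
  Equality of the spans is what lets infinitely many blocks change at once without losing
  orthogonality or totality.\<close>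

definition movable :: "('a::complex_inner \<Rightarrow> 'a) \<Rightarrow> 'i set \<Rightarrow> ('i \<Rightarrow> real) \<Rightarrow> ('i \<Rightarrow> real) \<Rightarrow> bool" where
  "movable E S lam mu \<longleftrightarrow>
    (\<forall>e. orthonormal e \<and> (\<forall>i\<in>S. cinner (E (e i)) (e i) = complex_of_real (lam i)) \<longrightarrow>
      (\<exists>e'. orthonormal e' \<and> (\<forall>i. i \<notin> S \<longrightarrow> e' i = e i) \<and>
        complex_vector.span (e' ` S) = complex_vector.span (e ` S) \<and>
        (\<forall>i\<in>S. cinner (E (e' i)) (e' i) = complex_of_real (mu i))))"

lemma movableE:
  assumes "movable E S lam mu" "orthonormal e"
    "\<And>i. i \<in> S \<Longrightarrow> cinner (E (e i)) (e i) = complex_of_real (lam i)"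
  obtains e' where "orthonormal e'" "\<And>i. i \<notin> S \<Longrightarrow> e' i = e i"
    "complex_vector.span (e' ` S) = complex_vector.span (e ` S)"
    "\<And>i. i \<in> S \<Longrightarrow> cinner (E (e' i)) (e' i) = complex_of_real (mu i)"
proof -
  have "\<exists>e'. orthonormal e' \<and> (\<forall>i. i \<notin> S \<longrightarrow> e' i = e i) \<and>
      complex_vector.span (e' ` S) = complex_vector.span (e ` S) \<and>
      (\<forall>i\<in>S. cinner (E (e' i)) (e' i) = complex_of_real (mu i))"
    using assms(1)[unfolded movable_def, rule_format, of e] assms(2,3) by simp
  then show ?thesis using that by blast
qed

lemma movable_refl: "(\<And>i. i \<in> S \<Longrightarrow> lam i = mu i) \<Longrightarrow> movable E S lam mu"
  unfolding movable_def by (intro allI impI, rule_tac x = e in exI) auto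

lemma movable_trans:
  assumes "movable E S lam mu" "movable E S mu nu" shows "movable E S lam nu"
  unfolding movable_def
proof (intro allI impI, elim conjE)
  fix e :: "'b \<Rightarrow> 'a"
  assume e: "orthonormal e" "\<forall>i\<in>S. cinner (E (e i)) (e i) = complex_of_real (lam i)"
  obtain e' where e': "orthonormal e'" "\<And>i. i \<notin> S \<Longrightarrow> e' i = e i"
    "complex_vector.span (e' ` S) = complex_vector.span (e ` S)"
    "\<And>i. i \<in> S \<Longrightarrow> cinner (E (e' i)) (e' i) = complex_of_real (mu i)"
    using movableE[OF assms(1), of e] e by blast
  obtain e'' where "orthonormal e''" "\<And>i. i \<notin> S \<Longrightarrow> e'' i = e' i"
    "complex_vector.span (e'' ` S) = complex_vector.span (e' ` S)"
    "\<And>i. i \<in> S \<Longrightarrow> cinner (E (e'' i)) (e'' i) = complex_of_real (nu i)"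
    using movableE[OF assms(2), of e'] e' by blast
  then show "\<exists>e'. orthonormal e' \<and> (\<forall>i. i \<notin> S \<longrightarrow> e' i = e i) \<and>
      complex_vector.span (e' ` S) = complex_vector.span (e ` S) \<and>
      (\<forall>i\<in>S. cinner (E (e' i)) (e' i) = complex_of_real (nu i))"
    using e' by (intro exI[of _ e'']) auto
qed

lemma movable_superset:
  assumes "movable E S lam mu" "S \<subseteq> T" "\<And>i. i \<in> T - S \<Longrightarrow> lam i = mu i"
  shows "movable E T lam mu"
  unfolding movable_def
proof (intro allI impI, elim conjE)
  fix e :: "'b \<Rightarrow> 'a"
  assume e: "orthonormal e" "\<forall>i\<in>T. cinner (E (e i)) (e i) = complex_of_real (lam i)"
  obtain e' where e': "orthonormal e'" "\<And>i. i \<notin> S \<Longrightarrow> e' i = e i"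
    "complex_vector.span (e' ` S) = complex_vector.span (e ` S)"
    "\<And>i. i \<in> S \<Longrightarrow> cinner (E (e' i)) (e' i) = complex_of_real (mu i)"
    using movableE[OF assms(1), of e] e assms(2) by blast
  have im: "f ` T = f ` S \<union> f ` (T - S)" for f :: "'b \<Rightarrow> 'a" using assms(2) by auto
  have "e' ` (T - S) = e ` (T - S)" using e'(2) by auto
  then have "complex_vector.span (e' ` T) = complex_vector.span (e ` T)"
    by (simp add: im complex_vector.span_Un e'(3))
  note spT = this
  show "\<exists>e'. orthonormal e' \<and> (\<forall>i. i \<notin> T \<longrightarrow> e' i = e i) \<and>
      complex_vector.span (e' ` T) = complex_vector.span (e ` T) \<and>
      (\<forall>i\<in>T. cinner (E (e' i)) (e' i) = complex_of_real (mu i))"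
  proof (intro exI[of _ e'] conjI ballI)
    fix i assume "i \<in> T"
    then show "cinner (E (e' i)) (e' i) = complex_of_real (mu i)"
      using e' e(2) assms(3)[of i] by (cases "i \<in> S") auto
  next
    show "\<forall>i. i \<notin> T \<longrightarrow> e' i = e i" using e'(2) assms(2) by blast
  qed (use e' spT in auto)
qed

lemma movable_rot:
  assumes E: "self_adjoint E" and ij: "i \<noteq> j" and t: "0 \<le> t" "t \<le> 1"
  shows "movable E {i, j} lam (lam(i := t * lam i + (1 - t) * lam j, j := (1 - t) * lam i + t * lam j))"
  unfolding movable_def
proof (intro allI impI, elim conjE)
  fix e :: "'b \<Rightarrow> 'a"
  assume e: "orthonormal e" "\<forall>k\<in>{i, j}. cinner (E (e k)) (e k) = complex_of_real (lam k)"
  define u v where "u = rot1 E t (e i) (e j)" and "v = rot2 E t (e i) (e j)"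
  define e' where "e' = e(i := u, j := v)"
  have "cinner (e i) (e i) = 1" "cinner (e j) (e j) = 1" "cinner (e i) (e j) = 0"
    "cinner (E (e i)) (e i) = complex_of_real (lam i)"
    "cinner (E (e j)) (e j) = complex_of_real (lam j)"
    using e ij by (auto simp: orthonormal_def)
  note r = rot[OF E this(1-3) t this(4,5), folded u_def v_def]
  have sp: "u \<in> complex_vector.span (e ` {i, j})" "v \<in> complex_vector.span (e ` {i, j})"
    unfolding u_def v_def rot1_def rot2_def
    by (intro complex_vector.span_add complex_vector.span_scale complex_vector.span_base; simp)+
  have "e i \<in> complex_vector.span {u, v}" "e j \<in> complex_vector.span {u, v}"
    by (subst r(6) r(7);
      intro complex_vector.span_add complex_vector.span_scale complex_vector.span_base; simp)+
  then have "complex_vector.span (e' ` {i, j}) = complex_vector.span (e ` {i, j})"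
    using sp ij unfolding e'_def by (subst complex_vector.span_eq) auto
  moreover have "orthonormal e'"
  proof -
    have uk: "cinner u (e k) = 0" "cinner v (e k) = 0" if "k \<notin> {i, j}" for k
      using that e(1) by (auto intro!: cinner_span_left[OF sp(1)] cinner_span_left[OF sp(2)]
          simp: orthonormal_def)
    then have ku: "cinner (e k) u = 0" "cinner (e k) v = 0" if "k \<notin> {i, j}" for k
      by (metis cinner_commute complex_cnj_zero that)+
    have "cinner v u = 0" using r(3) by (metis cinner_commute complex_cnj_zero)
    then show ?thesis
      unfolding orthonormal_def e'_def using ij r(1-3) uk ku e(1)
      by (auto simp: orthonormal_def)
  qed
  ultimately show "\<exists>e'. orthonormal e' \<and> (\<forall>k. k \<notin> {i, j} \<longrightarrow> e' k = e k) \<and>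
      complex_vector.span (e' ` {i, j}) = complex_vector.span (e ` {i, j}) \<and>
      (\<forall>k\<in>{i, j}. cinner (E (e' k)) (e' k) = complex_of_real
        ((lam(i := t * lam i + (1 - t) * lam j, j := (1 - t) * lam i + t * lam j)) k))"
    using ij r(4,5) by (intro exI[of _ e']) (auto simp: e'_def)
qed

lemma movable_pair:
  assumes E: "self_adjoint E" and ij: "i \<noteq> j" and sum: "mu i + mu j = lam i + lam j"
    and le: "lam j \<le> mu i" "mu i \<le> lam i"
  shows "movable E {i, j} lam mu"
proof -
  obtain t where t: "0 \<le> t" "t \<le> 1" "mu i = t * lam i + (1 - t) * lam j"
  proof (cases "lam i = lam j")
    case True then show ?thesis using le that[of 1] by simp
  next
    case False
    then have "lam i - lam j > 0" using le by simp
    define t where "t = (mu i - lam j) / (lam i - lam j)"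
    have "t * (lam i - lam j) = mu i - lam j" using \<open>lam i - lam j > 0\<close> by (simp add: t_def)
    then have "mu i = t * lam i + (1 - t) * lam j" by (simp add: algebra_simps)
    moreover have "0 \<le> t" "t \<le> 1" using le \<open>lam i - lam j > 0\<close> by (simp_all add: t_def)
    ultimately show ?thesis using that by blast
  qed
  have "mu j = (1 - t) * lam i + t * lam j" using t(3) sum by (simp add: algebra_simps)
  then show ?thesis
    using movable_trans[OF movable_rot[OF E ij t(1,2)] movable_refl] t(3) ij by fastforce
qed

text \<open>With \<open>t = 0\<close> the rotation exchanges the two vectors up to a phase.\<close>

lemma movable_swap:
  assumes E: "self_adjoint E"
  shows "movable E {i, j} lam (lam(i := lam j, j := lam i))"
proof (cases "i = j")
  case False
  then show ?thesis using movable_rot[OF E False, of 0 lam] by simp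
qed (auto intro: movable_refl)

text \<open>Each block changes inside its own span, and the spans of disjoint blocks are orthogonal,
  so all changes can be made simultaneously. Every old vector lies in the algebraic span of the new
  ones, so no limit is involved.\<close>

lemma diagonal_blocks:
  assumes "is_diagonal E lam" and mov: "\<And>n::'n. movable E (S n) lam mu"
    and disj: "\<And>m n. m \<noteq> n \<Longrightarrow> S m \<inter> S n = {}"
    and out: "\<And>i. i \<notin> (\<Union>n. S n) \<Longrightarrow> mu i = lam i"
  shows "is_diagonal E mu"
proof -
  obtain e where on: "orthonormal e" and cl: "closure (complex_vector.span (range e)) = UNIV"
    and d: "\<And>i. cinner (E (e i)) (e i) = complex_of_real (lam i)"
    using assms(1) unfolding is_diagonal_def orthonormal_basis_def orthonormal_def by blast
  have "\<forall>n. \<exists>e'. orthonormal e' \<and> (\<forall>i. i \<notin> S n \<longrightarrow> e' i = e i) \<and>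
      complex_vector.span (e' ` S n) = complex_vector.span (e ` S n) \<and>
      (\<forall>i\<in>S n. cinner (E (e' i)) (e' i) = complex_of_real (mu i))"
    using mov on d unfolding movable_def by simp
  then obtain F where F: "\<And>n. orthonormal (F n)"
    "\<And>n. complex_vector.span (F n ` S n) = complex_vector.span (e ` S n)"
    "\<And>n i. i \<in> S n \<Longrightarrow> cinner (E (F n i)) (F n i) = complex_of_real (mu i)"
    by metis
  \<comment> \<open>Every \<open>F n\<close> changes one block of the original \<open>e\<close>; on
    each block \<open>g\<close> takes the family that belongs to it.\<close>
  define g where "g i = (if \<exists>n. i \<in> S n then F (THE n. i \<in> S n) i else e i)" for i
  have gS: "g i = F n i" if "i \<in> S n" for i n
  proof -
    have "(THE n. i \<in> S n) = n" using that disj by blast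
    then show ?thesis using that by (auto simp: g_def)
  qed
  have gO: "g i = e i" if "i \<notin> (\<Union>n. S n)" for i
    using that by (simp add: g_def)
  \<comment> \<open>The block of \<open>i\<close>, or a singleton outside all blocks. Two cells are
    equal or disjoint, so orthogonality of \<open>g\<close> is either that of a single
    \<open>F n\<close> or that of two orthogonal spans.\<close>
  define cell where "cell i = (if \<exists>n. i \<in> S n then S (THE n. i \<in> S n) else {i})" for i
  have cS: "cell i = S n" if "i \<in> S n" for i n
  proof -
    have "(THE n. i \<in> S n) = n" using that disj by blast
    then show ?thesis using that by (auto simp: cell_def)
  qed
  have cO: "cell i = {i}" if "i \<notin> (\<Union>n. S n)" for i
    using that by (simp add: cell_def)
  have g_cell: "g i \<in> complex_vector.span (e ` cell i)" for i
  proof (cases "\<exists>n. i \<in> S n")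
    case True
    then obtain n where n: "i \<in> S n" by blast
    have "F n i \<in> complex_vector.span (F n ` S n)"
      using n by (intro complex_vector.span_base) auto
    then show ?thesis using F(2)[of n] gS[OF n] cS[OF n] by simp
  next
    case False
    then show ?thesis using gO[of i] cO[of i] by (auto intro: complex_vector.span_base)
  qed
  have "orthonormal g"
    unfolding orthonormal_def
  proof (intro allI)
    fix i j
    show "cinner (g i) (g j) = (if i = j then 1 else 0)"
    proof (cases "cell i = cell j")
      case True
      show ?thesis
      proof (cases "\<exists>n. i \<in> S n")
        case t: True
        then obtain n where n: "i \<in> S n" by blast
        then have "cell j = S n" using cS[OF n] True by simp
        then have "j \<in> S n" using cO[of j] cS[of j] by fastforce
        then show ?thesis using gS[OF n] gS[of j n] F(1)[of n] by (simp add: orthonormal_def)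
      next
        case False
        then have "i \<notin> (\<Union>n. S n)" by blast
        then have *: "g i = e i" "cell i = {i}" using gO cO by blast+
        have "j \<in> cell j" using cO[of j] cS[of j] by blast
        then have "j = i" unfolding True[symmetric] *(2) by simp
        then show ?thesis using * on by (simp add: orthonormal_def)
      qed
    next
      case False
      have "cell i \<inter> cell j = {}"
      proof (cases "(\<exists>n. i \<in> S n) \<and> (\<exists>n. j \<in> S n)")
        case True
        then obtain m n where "i \<in> S m" "j \<in> S n" by blast
        then show ?thesis using False cS disj by metis
      next
        case f: False
        then consider "i \<notin> (\<Union>n. S n)" | "j \<notin> (\<Union>n. S n)" by blast
        then show ?thesis
          using False cO[of i] cO[of j] cS[of i] cS[of j] by cases (cases "\<exists>n. i \<in> S n"; cases "\<exists>n. j \<in> S n"; fastforce)+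
      qed
      moreover have "i \<noteq> j" using False by auto
      ultimately show ?thesis
        using on cinner_span_span[OF g_cell[of i] g_cell[of j]] by (fastforce simp: orthonormal_def)
    qed
  qed
  moreover have "closure (complex_vector.span (range g)) = UNIV"
  proof -
    have "e i \<in> complex_vector.span (range g)" for i
    proof (cases "\<exists>n. i \<in> S n")
      case True
      then obtain n where n: "i \<in> S n" by blast
      have "e i \<in> complex_vector.span (F n ` S n)"
        unfolding F(2) using n by (intro complex_vector.span_base) auto
      also have "F n ` S n = g ` S n" using gS by force
      finally show ?thesis using complex_vector.span_mono[of "g ` S n" "range g"] by blast
    next
      case False
      then show ?thesis using gO[of i] by (metis UN_iff complex_vector.span_base rangeI)
    qed
    then have "complex_vector.span (range e) \<subseteq> complex_vector.span (range g)"
      by (intro complex_vector.span_minimal complex_vector.subspace_span) auto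
    then show ?thesis using cl closure_mono by blast
  qed
  moreover have "cinner (E (g i)) (g i) = complex_of_real (mu i)" for i
  proof (cases "\<exists>n. i \<in> S n")
    case True
    then show ?thesis using gS F(3) by metis
  next
    case False
    then show ?thesis using gO[of i] out[of i] d[of i] by auto
  qed
  ultimately show ?thesis
    unfolding is_diagonal_def orthonormal_basis_def orthonormal_def by blast
qed

lemma is_diagonal_reindex:
  assumes "bij f" "is_diagonal E lam" shows "is_diagonal E (lam \<circ> f)"
proof -
  obtain e where e: "orthonormal_basis e" "\<And>i. cinner (E (e i)) (e i) = complex_of_real (lam i)"
    using assms(2) unfolding is_diagonal_def by blast
  have "range (e \<circ> f) = range e" using assms(1) by (metis bij_is_surj image_comp)
  moreover have "f i = f j \<longleftrightarrow> i = j" for i j using assms(1) by (meson bij_def injD)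
  ultimately have "orthonormal_basis (e \<circ> f)" using e(1) unfolding orthonormal_basis_def by simp
  then show ?thesis using e(2) unfolding is_diagonal_def by (intro exI[of _ "e \<circ> f"]) simp
qed

section \<open>Majorization on a finite block\<close>

text \<open>Horn's theorem on a block, with majorization expressed through positive parts as in
  Hardy, Littlewood and Polya. In the induction, a rotation of the two entries of \<open>lam\<close>
  next to the largest target \<open>d j\<close> produces the value \<open>d j\<close>, which is
  brought to \<open>j\<close> and then left alone.\<close>

lemma movable_majorized:
  assumes E: "self_adjoint E" and "finite S" and "sum d S = sum lam S"
    and "\<And>\<alpha>. (\<Sum>i\<in>S. max 0 (d i - \<alpha>)) \<le> (\<Sum>i\<in>S. max 0 (lam i - \<alpha>))"
  shows "movable E S lam d"
  using assms(2-)
proof (induction "card S" arbitrary: S lam)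
  case 0
  then show ?case by (auto intro: movable_refl)
next
  case (Suc n)
  note fin = \<open>finite S\<close> and maj = Suc.prems(3)
  have ne: "S \<noteq> {}" using Suc.hyps(2) by auto
  obtain j where j: "j \<in> S" "\<And>i. i \<in> S \<Longrightarrow> d i \<le> d j"
    using obtains_MAX[OF fin ne, of d] by (metis Max_ge finite_imageI fin imageI)
  \<comment> \<open>It suffices to produce the value \<open>d j\<close> at some index while keeping
    the majorization: a swap brings it to \<open>j\<close>, where equal terms cancel from both sides
    of every inequality.\<close>
  have finish: ?case
    if lam': "movable E S lam lam'" "sum lam' S = sum lam S" "lam' a = d j" "a \<in> S"
      "\<And>\<alpha>. (\<Sum>i\<in>S. max 0 (d i - \<alpha>)) \<le> (\<Sum>i\<in>S. max 0 (lam' i - \<alpha>))" for lam' a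
  proof -
    define lam2 where "lam2 = lam'(a := lam' j, j := lam' a)"
    have m2: "movable E S lam' lam2"
      using movable_superset[OF movable_swap[OF E, of a j lam']] j(1) lam'(4)
      by (auto simp: lam2_def)
    have j2: "lam2 j = d j" using lam'(3) by (simp add: lam2_def)
    have perm: "(\<Sum>i\<in>S. f (lam2 i)) = (\<Sum>i\<in>S. f (lam' i))" for f :: "real \<Rightarrow> real"
    proof (rule sum.reindex_bij_witness[of _ "Transposition.transpose a j" "Transposition.transpose a j"])
    qed (use j(1) lam'(4) in \<open>auto simp: lam2_def Transposition.transpose_def\<close>)
    have "movable E (S - {j}) lam2 d"
    proof (rule Suc.hyps(1))
      show "n = card (S - {j})" using Suc.hyps(2) j(1) fin by simp
      show "finite (S - {j})" using fin by simp
      show "sum d (S - {j}) = sum lam2 (S - {j})"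
        using perm[of "\<lambda>x. x"] lam'(2) Suc.prems(2) j2 by (simp add: sum_diff1 fin)
      show "(\<Sum>i\<in>S - {j}. max 0 (d i - \<alpha>)) \<le> (\<Sum>i\<in>S - {j}. max 0 (lam2 i - \<alpha>))" for \<alpha>
        using lam'(5)[of \<alpha>] perm[of "\<lambda>x. max 0 (x - \<alpha>)"] j2 by (simp add: sum_diff1 fin)
    qed
    then have "movable E S lam2 d"
      by (rule movable_superset) (use j2 in auto)
    then show ?case using movable_trans[OF lam'(1) movable_trans[OF m2]] by blast
  qed
  show ?case
  proof (cases "\<exists>a\<in>S. lam a = d j")
    case True
    then show ?thesis using finish[of lam] maj by (auto intro: movable_refl)
  next
    case no: False
    have "\<exists>a\<in>S. lam a > d j"
    proof (rule ccontr)
      assume "\<not> ?thesis"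
      then have le: "\<forall>i\<in>S. lam i < d j" using no by (meson linorder_neqE_linordered_idom)
      \<comment> \<open>At the level of the largest entry of \<open>lam\<close> the right side of
        the majorization vanishes, while \<open>d j\<close> contributes to the left.\<close>
      define m where "m = Max (lam ` S)"
      have m: "m < d j" "\<And>i. i \<in> S \<Longrightarrow> lam i \<le> m"
        using le fin ne by (auto simp: m_def)
      have "(\<Sum>i\<in>S. max 0 (lam i - m)) = 0" using m(2) by (intro sum.neutral) auto
      moreover have "max 0 (d j - m) \<le> (\<Sum>i\<in>S. max 0 (d i - m))"
        using j(1) fin by (intro member_le_sum) auto
      ultimately show False using maj[of m] m(1) by auto
    qed
    then have "{x \<in> lam ` S. x > d j} \<noteq> {}" by auto
    then have "Min {x \<in> lam ` S. x > d j} \<in> {x \<in> lam ` S. x > d j}"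
      using fin by (intro Min_in) auto
    then obtain a where a: "a \<in> S" "lam a > d j" "lam a = Min {x \<in> lam ` S. x > d j}" by auto
    have a_min: "lam i \<ge> lam a" if "i \<in> S" "lam i > d j" for i
      unfolding a(3) using that fin by (intro Min_le) auto
    have "\<exists>b\<in>S. lam b < d j"
    proof (rule ccontr)
      assume "\<not> ?thesis"
      then have "\<forall>i\<in>S. d i < lam i" using no j(2) by (smt (verit))
      then have "sum d S < sum lam S" using fin ne by (intro sum_strict_mono) auto
      then show False using Suc.prems(2) by simp
    qed
    then have "{x \<in> lam ` S. x < d j} \<noteq> {}" by auto
    then have "Max {x \<in> lam ` S. x < d j} \<in> {x \<in> lam ` S. x < d j}"
      using fin by (intro Max_in) auto
    then obtain b where b: "b \<in> S" "lam b < d j" "lam b = Max {x \<in> lam ` S. x < d j}" by auto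
    have b_max: "lam i \<le> lam b" if "i \<in> S" "lam i < d j" for i
      unfolding b(3) using that fin by (intro Max_ge) auto
    have ab: "a \<noteq> b" using a b by auto
    \<comment> \<open>\<open>d j\<close> and \<open>c\<close> have the same sum as
      \<open>lam a\<close> and \<open>lam b\<close> and lie between them; no entry of
      \<open>lam\<close> lies strictly between \<open>lam b\<close> and
      \<open>lam a\<close>.\<close>
    define c where "c = lam a + lam b - d j"
    define lam' where "lam' = lam(a := d j, b := c)"
    have S_eq: "S = insert a (insert b (S - {a, b}))" using a b by auto
    have sumS: "(\<Sum>i\<in>S. f (lam' i)) = f (d j) + f c + (\<Sum>i\<in>S - {a, b}. f (lam i))"
      "(\<Sum>i\<in>S. f (lam i)) = f (lam a) + f (lam b) + (\<Sum>i\<in>S - {a, b}. f (lam i))"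
      for f :: "real \<Rightarrow> real"
      by (subst S_eq, use ab fin in \<open>simp add: lam'_def\<close>)+
    show ?thesis
    proof (rule finish[of lam' a])
      show "movable E S lam lam'"
        by (rule movable_superset[OF movable_pair[OF E ab, of lam' lam]])
          (use a b ab in \<open>auto simp: lam'_def c_def\<close>)
      show "sum lam' S = sum lam S" using sumS[of "\<lambda>x. x"] by (simp add: c_def)
      show "lam' a = d j" using ab by (simp add: lam'_def)
      show "a \<in> S" by fact
      fix \<alpha>
      \<comment> \<open>From \<open>d j\<close> upwards no target contributes. Up to
        \<open>lam b\<close> none of the four values is cut off, so only their unchanged sum counts.
        In between the proof counts entries.\<close>
      consider "d j \<le> \<alpha>" | "\<alpha> \<le> lam b" | "lam b < \<alpha>" "\<alpha> < d j" by linarith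
      then show "(\<Sum>i\<in>S. max 0 (d i - \<alpha>)) \<le> (\<Sum>i\<in>S. max 0 (lam' i - \<alpha>))"
      proof cases
        case 1
        then have "(\<Sum>i\<in>S. max 0 (d i - \<alpha>)) = 0" using j(2) by (intro sum.neutral) fastforce
        then show ?thesis by (simp add: sum_nonneg)
      next
        case 2
        then have "max 0 (d j - \<alpha>) + max 0 (c - \<alpha>) = max 0 (lam a - \<alpha>) + max 0 (lam b - \<alpha>)"
          using a(2) b(2) by (simp add: c_def)
        then show ?thesis using maj[of \<alpha>] sumS[of "\<lambda>x. max 0 (x - \<alpha>)"] by simp
      next
        case 3
        define U where "U = {i \<in> S. lam i \<ge> lam a}"
        define V where "V = {i \<in> S. d i > \<alpha>}"
        have fU: "finite U" "a \<in> U" "b \<notin> U" and fV: "finite V" "V \<subseteq> S"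
          using fin a b by (auto simp: U_def V_def)
        have V_sum: "(\<Sum>i\<in>S. max 0 (d i - \<alpha>)) = (\<Sum>i\<in>V. d i - \<alpha>)"
          by (rule sum.mono_neutral_cong_right) (auto simp: V_def fin)
        have U_sum: "(\<Sum>i\<in>U - {a}. lam i - \<alpha>) \<le> (\<Sum>i\<in>S - {a, b}. max 0 (lam i - \<alpha>))"
        proof -
          have "(\<Sum>i\<in>U - {a}. lam i - \<alpha>) \<le> (\<Sum>i\<in>U - {a}. max 0 (lam i - \<alpha>))"
            by (intro sum_mono) auto
          also have "\<dots> \<le> (\<Sum>i\<in>S - {a, b}. max 0 (lam i - \<alpha>))"
            using fin fU by (intro sum_mono2) (auto simp: U_def)
          finally show ?thesis .
        qed
        \<comment> \<open>Few targets above \<alpha>: each is at most \<open>d j\<close>, and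
          \<open>card U\<close> of the new entries are at least \<open>d j\<close>. Many targets:
          start from the inequality at \<open>lam b\<close>; raising the level to \<alpha> lowers
          the left side by \<open>card V \<ge> card U + 1\<close> times
          \<open>\<alpha> - lam b\<close>, but the right side by only \<open>card U\<close> times
          that.\<close>
        show ?thesis
        proof (cases "card V \<le> card U")
          case True
          have "(\<Sum>i\<in>V. d i - \<alpha>) \<le> (\<Sum>i\<in>V. d j - \<alpha>)"
            using j(2) fV by (intro sum_mono) auto
          also have "\<dots> \<le> card U * (d j - \<alpha>)"
            using True 3 by (simp add: mult_right_mono)
          also have "\<dots> = (d j - \<alpha>) + (\<Sum>i\<in>U - {a}. d j - \<alpha>)"
            using fU by (simp add: sum_diff1 flip: sum_constant)
          also have "\<dots> \<le> (d j - \<alpha>) + (\<Sum>i\<in>U - {a}. lam i - \<alpha>)"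
            using a(2) by (intro add_left_mono sum_mono) (auto simp: U_def)
          also have "\<dots> \<le> (\<Sum>i\<in>S. max 0 (lam' i - \<alpha>))"
            using U_sum sumS(1)[of "\<lambda>x. max 0 (x - \<alpha>)"] by auto
          finally show ?thesis using V_sum by simp
        next
          case False
          have U_eq: "(\<Sum>i\<in>S. max 0 (lam i - lam b)) = (\<Sum>i\<in>U. lam i - lam b)"
          proof (rule sum.mono_neutral_cong_right)
            show "\<forall>i\<in>S - U. max 0 (lam i - lam b) = 0"
            proof
              fix i assume i: "i \<in> S - U"
              then have "lam i < lam a" by (auto simp: U_def)
              then have "lam i < d j" using a_min[of i] no i by fastforce
              then show "max 0 (lam i - lam b) = 0" using b_max[of i] i by auto
            qed
            show "max 0 (lam i - lam b) = lam i - lam b" if "i \<in> U" for i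
              using that a(2) b(2) by (auto simp: U_def)
          qed (auto simp: U_def fin)
          have "(\<Sum>i\<in>V. d i - lam b) = (\<Sum>i\<in>V. max 0 (d i - lam b))"
            using 3 by (intro sum.cong) (auto simp: V_def)
          also have "\<dots> \<le> (\<Sum>i\<in>S. max 0 (d i - lam b))"
            using fin fV by (intro sum_mono2) auto
          also have "\<dots> \<le> (\<Sum>i\<in>U. lam i - lam b)" using maj[of "lam b"] U_eq by simp
          finally have "(\<Sum>i\<in>V. d i - lam b) \<le> (\<Sum>i\<in>U. lam i - lam b)" .
          moreover have "(\<Sum>i\<in>V. d i - \<alpha>) = (\<Sum>i\<in>V. d i - lam b) - card V * (\<alpha> - lam b)"
            by (simp add: sum_subtractf algebra_simps)
          moreover have "(\<Sum>i\<in>U. lam i - \<alpha>) = (\<Sum>i\<in>U. lam i - lam b) - card U * (\<alpha> - lam b)"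
            by (simp add: sum_subtractf algebra_simps)
          moreover have "(real (card U) + 1) * (\<alpha> - lam b) \<le> card V * (\<alpha> - lam b)"
            using False 3 by (intro mult_right_mono) auto
          ultimately have "(\<Sum>i\<in>V. d i - \<alpha>) \<le> (\<Sum>i\<in>U. lam i - \<alpha>) + (lam b - \<alpha>)"
            by (simp add: algebra_simps)
          also have "\<dots> = (\<Sum>i\<in>U - {a}. lam i - \<alpha>) + (d j - \<alpha>) + (c - \<alpha>)"
            using fU by (simp add: sum_diff1 c_def)
          also have "\<dots> \<le> (\<Sum>i\<in>S. max 0 (lam' i - \<alpha>))"
            using U_sum sumS(1)[of "\<lambda>x. max 0 (x - \<alpha>)"] by auto
          finally show ?thesis using V_sum by simp
        qed
      qed
    qed
  qed
qed

section \<open>Infinite chains of rotations\<close>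

lemma closure_span_subspace:
  "complex_vector.subspace (closure (complex_vector.span (A::'a::complex_inner set)))"
proof (rule complex_vector.subspaceI)
  show "0 \<in> closure (complex_vector.span A)"
    using closure_subset complex_vector.span_zero by blast
next
  fix x y assume xy: "x \<in> closure (complex_vector.span A)" "y \<in> closure (complex_vector.span A)"
  show "x + y \<in> closure (complex_vector.span A)"
    unfolding closure_sequential
  proof -
    obtain f g where "\<forall>n. f n \<in> complex_vector.span A" "f \<longlonglongrightarrow> x"
      "\<forall>n. g n \<in> complex_vector.span A" "g \<longlonglongrightarrow> y"
      using xy unfolding closure_sequential by blast
    then show "\<exists>f. (\<forall>n. f n \<in> complex_vector.span A) \<and> f \<longlonglongrightarrow> x + y"
      by (intro exI[of _ "\<lambda>n. f n + g n"]) (auto intro: tendsto_add complex_vector.span_add)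
  qed
next
  fix c x assume x: "x \<in> closure (complex_vector.span A)"
  obtain f where f: "\<And>n. f n \<in> complex_vector.span A" "f \<longlonglongrightarrow> x"
    using x unfolding closure_sequential by blast
  have "(\<lambda>n. cmod c * norm (f n - x)) \<longlonglongrightarrow> cmod c * 0"
    using f(2) by (intro tendsto_mult tendsto_const) (simp add: LIM_zero tendsto_norm_zero)
  moreover have "norm (c *\<^sub>C f n - c *\<^sub>C x) = cmod c * norm (f n - x)" for n
    by (metis complex_vector.scale_right_diff_distrib norm_scaleC)
  ultimately have "(\<lambda>n. norm (c *\<^sub>C f n - c *\<^sub>C x)) \<longlonglongrightarrow> 0" by simp
  then have "(\<lambda>n. c *\<^sub>C f n) \<longlonglongrightarrow> c *\<^sub>C x" using Lim_null tendsto_norm_zero_iff by blast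
  then show "c *\<^sub>C x \<in> closure (complex_vector.span A)"
    unfolding closure_sequential
    using f(1) by (intro exI[of _ "\<lambda>n. c *\<^sub>C f n"]) (auto intro: complex_vector.span_scale)
qed

text \<open>Rotate \<open>e (i 0)\<close> with \<open>e (i 1)\<close>, the second vector of the result with \<open>e (i 2)\<close>, and
  so on. The factor \<open>1 / 2\<close> in \<open>y_le\<close> makes each leftover vector have inner product at most
  \<open>sqrt (1 / 2)\<close> with the next one, so nothing is lost in the limit.\<close>

lemma diagonal_chain:
  fixes lam mu :: "'i \<Rightarrow> real" and i :: "nat \<Rightarrow> 'i" and y :: "nat \<Rightarrow> real"
  assumes E: "self_adjoint E" and diag: "is_diagonal E lam" and inj: "inj i"
    and y0: "y 0 = 0" and y_nonneg: "\<And>n. 0 \<le> y n"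
    and y_le: "\<And>n. y (Suc n) \<le> (lam (i n) + y n - lam (i (Suc n))) / 2"
    and mu_i: "\<And>n. mu (i n) = lam (i n) + y n - y (Suc n)"
    and out: "\<And>k. k \<notin> range i \<Longrightarrow> mu k = lam k"
  shows "is_diagonal E mu"
proof -
  obtain e where on: "orthonormal e" and cl: "closure (complex_vector.span (range e)) = UNIV"
    and d: "\<And>k. cinner (E (e k)) (e k) = complex_of_real (lam k)"
    using diag unfolding is_diagonal_def orthonormal_basis_def orthonormal_def by blast
  \<comment> \<open>\<open>rho n\<close> is the diagonal entry of the leftover vector
    \<open>r n\<close>, and \<open>y n\<close> is the mass it brings along. The weight
    \<open>t n\<close> gives the rotated pair the entries \<open>mu (i n)\<close> and
    \<open>rho (Suc n)\<close>. If the two old entries agree, \<open>y_le\<close> forces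
    \<open>y (Suc n) = 0\<close> and the weight \<open>1\<close> serves.\<close>
  define rho where "rho n = lam (i n) + y n" for n
  define t where "t n = (if rho n = lam (i (Suc n)) then 1
    else 1 - y (Suc n) / (rho n - lam (i (Suc n))))" for n
  have yl: "y (Suc n) \<le> (rho n - lam (i (Suc n))) / 2" for n using y_le by (simp add: rho_def)
  have rl: "rho n \<ge> lam (i (Suc n))" for n using order_trans[OF y_nonneg yl, of n] by simp
  have t: "1 / 2 \<le> t n" "t n \<le> 1" "(1 - t n) * (rho n - lam (i (Suc n))) = y (Suc n)" for n
  proof -
    have "1 / 2 \<le> t n \<and> t n \<le> 1 \<and> (1 - t n) * (rho n - lam (i (Suc n))) = y (Suc n)"
    proof (cases "rho n = lam (i (Suc n))")
      case True
      then show ?thesis using yl[of n] y_nonneg[of "Suc n"] by (simp add: t_def)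
    next
      case False
      then have "rho n - lam (i (Suc n)) > 0" using rl[of n] by simp
      then have "y (Suc n) / (rho n - lam (i (Suc n))) \<le> 1 / 2"
        using yl[of n] by (simp add: divide_le_eq)
      then show ?thesis using False rl[of n] y_nonneg[of "Suc n"] by (simp add: t_def)
    qed
    then show "1 / 2 \<le> t n" "t n \<le> 1" "(1 - t n) * (rho n - lam (i (Suc n))) = y (Suc n)" by auto
  qed
  define r where "r = rec_nat (e (i 0)) (\<lambda>n x. rot2 E (t n) x (e (i (Suc n))))"
  have r0: "r 0 = e (i 0)" and rS: "r (Suc n) = rot2 E (t n) (r n) (e (i (Suc n)))" for n
    by (simp_all add: r_def)
  define g where "g n = rot1 E (t n) (r n) (e (i (Suc n)))" for n
  have r_span: "r n \<in> complex_vector.span (e ` i ` {..n})" for n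
  proof (induction n)
    case 0 then show ?case by (auto simp: r0 intro: complex_vector.span_base)
  next
    case (Suc n)
    have "r n \<in> complex_vector.span (e ` i ` {..Suc n})"
      using Suc complex_vector.span_mono[of "e ` i ` {..n}" "e ` i ` {..Suc n}"] by fastforce
    then show ?case unfolding rS rot2_def
      by (intro complex_vector.span_add complex_vector.span_scale) (auto intro: complex_vector.span_base)
  qed
  have g_span: "g n \<in> complex_vector.span (e ` i ` {..Suc n})" for n
  proof -
    have "r n \<in> complex_vector.span (e ` i ` {..Suc n})"
      using r_span[of n] complex_vector.span_mono[of "e ` i ` {..n}" "e ` i ` {..Suc n}"] by fastforce
    then show ?thesis unfolding g_def rot1_def
      by (intro complex_vector.span_add complex_vector.span_scale) (auto intro: complex_vector.span_base)
  qed
  have r_orth: "cinner (r n) (e k) = 0" if "k \<notin> i ` {..n}" for n k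
    using that on by (intro cinner_span_left[OF r_span[of n]]) (auto simp: orthonormal_def)
  have g_orth: "cinner (g n) (e k) = 0" if "k \<notin> i ` {..Suc n}" for n k
    using that on by (intro cinner_span_left[OF g_span[of n]]) (auto simp: orthonormal_def)
  have i_notin: "i (Suc n) \<notin> i ` {..n}" for n
    using inj by (auto simp: inj_eq)
  have r: "cinner (r n) (r n) = 1 \<and> cinner (E (r n)) (r n) = complex_of_real (rho n)" for n
  proof (induction n)
    case 0 then show ?case using d on by (simp add: r0 rho_def y0 orthonormal_def)
  next
    case (Suc n)
    note R = rot[OF E conjunct1[OF Suc] orthonormalD(1)[OF on] r_orth[OF i_notin] _ _ conjunct2[OF Suc] d,
        where t = "t n", folded rS]
    have "0 \<le> t n" using t(1)[of n] by linarith
    moreover have "(1 - t n) * rho n + t n * lam (i (Suc n)) = rho (Suc n)"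
      using t(3)[of n] by (simp add: algebra_simps rho_def[of "Suc n"])
    ultimately show ?case using R(2,5) t(2)[of n] by auto
  qed
  have t0: "0 \<le> t n" for n using t(1)[of n] by linarith
  have R: "cinner (g n) (g n) = 1" "cinner (g n) (r (Suc n)) = 0"
    "cinner (E (g n)) (g n) = of_real (t n * rho n + (1 - t n) * lam (i (Suc n)))"
    "r n = of_real (sqrt (t n)) *\<^sub>C g n + of_real (sqrt (1 - t n)) *\<^sub>C r (Suc n)"
    "e (i (Suc n)) = (of_real (sqrt (1 - t n)) * cnj (phase (cinner (E (r n)) (e (i (Suc n)))))) *\<^sub>C g n
      + (- of_real (sqrt (t n)) * cnj (phase (cinner (E (r n)) (e (i (Suc n)))))) *\<^sub>C r (Suc n)" for n
    unfolding rS g_def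
    by (rule rot(1,3,4,6,7)[OF E conjunct1[OF r] orthonormalD(1)[OF on] r_orth[OF i_notin] t0 t(2)
          conjunct2[OF r] d])+
  have gd: "cinner (E (g n)) (g n) = complex_of_real (mu (i n))" for n
  proof -
    have "t n * rho n + (1 - t n) * lam (i (Suc n)) = mu (i n)"
      using t(3)[of n] mu_i[of n] by (simp add: rho_def algebra_simps)
    then show ?thesis using R(3)[of n] by simp
  qed
  \<comment> \<open>The rotation makes \<open>g n\<close> orthogonal to the next leftover, and every
    later leftover adds only a vector \<open>e (i (Suc m))\<close> that is orthogonal to
    \<open>g n\<close>.\<close>
  have g_later: "cinner (g n) (r m) = 0" if "m \<ge> Suc n" for m n
    using that
  proof (induction m rule: dec_induct)
    case base then show ?case by (rule R(2))
  next
    case (step m)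
    have "i (Suc m) \<notin> i ` {..Suc n}" using step.hyps inj by (auto simp: inj_eq)
    then have "cinner (g n) (e (i (Suc m))) = 0" by (rule g_orth)
    then show ?case using step.IH
      by (simp only: rS rot2_def cinner_add_right cinner_scaleC_right) simp
  qed
  have gg: "cinner (g n) (g m) = 0" if "n < m" for m n
  proof -
    have "i (Suc m) \<notin> i ` {..Suc n}" using that inj by (auto simp: inj_eq)
    then have "cinner (g n) (e (i (Suc m))) = 0" by (rule g_orth)
    then show ?thesis using g_later[of n m] that
      by (simp only: g_def[of m] rot1_def cinner_add_right cinner_scaleC_right) simp
  qed
  define f where "f k = (if k \<in> range i then g (inv i k) else e k)" for k
  have f_i: "f (i n) = g n" for n using inj by (simp add: f_def)
  have f_out: "f k = e k" if "k \<notin> range i" for k using that by (simp add: f_def)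
  have comm0: "cinner x y = 0 \<Longrightarrow> cinner y x = 0" for x y :: 'a
    by (metis cinner_commute complex_cnj_zero)
  have "orthonormal f"
    unfolding orthonormal_def
  proof (intro allI)
    fix k l
    have ge: "cinner (g n) (e l) = 0" if "l \<notin> range i" for n l
      using that by (intro g_orth) auto
    consider (a) m n where "k = i m" "l = i n" | (b) m where "k = i m" "l \<notin> range i"
      | (c) n where "k \<notin> range i" "l = i n" | (d) "k \<notin> range i" "l \<notin> range i" by blast
    then show "cinner (f k) (f l) = (if k = l then 1 else 0)"
    proof cases
      case a
      then show ?thesis using R(1)[of m] gg[of m n] comm0[OF gg[of n m]] inj
        by (cases m n rule: linorder_cases) (auto simp: f_i inj_eq)
    next
      case b
      then show ?thesis using ge by (auto simp: f_i f_out)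
    next
      case c
      then show ?thesis using comm0[OF ge] by (auto simp: f_i f_out)
    next
      case d
      then show ?thesis using on by (simp add: f_out orthonormal_def)
    qed
  qed
  moreover have "closure (complex_vector.span (range f)) = UNIV"
  proof -
    let ?V = "closure (complex_vector.span (range f))"
    have f_in: "f k \<in> complex_vector.span (range f)" for k
      by (auto intro: complex_vector.span_base)
    \<comment> \<open>By \<open>R(4)\<close>, an approximation of \<open>r (Suc n)\<close> yields
      one of \<open>r n\<close> with the error multiplied by \<open>sqrt (1 - t n)\<close>, which is
      at most \<open>sqrt (1 / 2)\<close>.\<close>
    have near: "\<exists>w \<in> complex_vector.span (range f). norm (r n - w) \<le> sqrt (1 / 2) ^ N" for n N
    proof (induction N arbitrary: n)
      case 0
      have "norm (r n) = 1" using r by (simp add: norm_eq_1_if_cinner)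
      then show ?case by (intro bexI[of _ 0]) (auto intro: complex_vector.span_zero)
    next
      case (Suc N)
      obtain w where w: "w \<in> complex_vector.span (range f)" "norm (r (Suc n) - w) \<le> sqrt (1 / 2) ^ N"
        using Suc by blast
      define w' where "w' = of_real (sqrt (t n)) *\<^sub>C g n + of_real (sqrt (1 - t n)) *\<^sub>C w"
      have "w' \<in> complex_vector.span (range f)"
        unfolding w'_def using w(1) f_in[of "i n"]
        by (intro complex_vector.span_add complex_vector.span_scale) (auto simp: f_i)
      moreover have "r n - w' = of_real (sqrt (1 - t n)) *\<^sub>C (r (Suc n) - w)"
        by (subst R(4)) (simp add: w'_def complex_vector.scale_right_diff_distrib)
      then have "norm (r n - w') = sqrt (1 - t n) * norm (r (Suc n) - w)"
        using t(2)[of n] by (simp add: norm_scaleC)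
      then have "norm (r n - w') \<le> sqrt (1 / 2) * sqrt (1 / 2) ^ N"
        using w(2) t(1,2)[of n] by (auto intro!: mult_mono)
      ultimately show ?case by auto
    qed
    have rV: "r n \<in> ?V" for n
      unfolding closure_approachable
    proof (intro allI impI)
      fix \<epsilon> :: real assume "\<epsilon> > 0"
      then obtain N where "sqrt (1 / 2) ^ N < \<epsilon>"
        using real_arch_pow_inv[of \<epsilon> "sqrt (1 / 2)"] by auto
      then show "\<exists>y\<in>complex_vector.span (range f). dist y (r n) < \<epsilon>"
        using near[of n N] by (metis dist_norm norm_minus_commute order.strict_trans1)
    qed
    have gV: "g n \<in> ?V" for n using f_in[of "i n"] closure_subset f_i by fastforce
    \<comment> \<open>Undoing the rotation expresses an old vector by some \<open>g m\<close> and a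
      leftover, both in the closed span; \<open>e (i 0)\<close> is itself the first
      leftover.\<close>
    have "e k \<in> ?V" for k
    proof (cases "k \<in> range i")
      case True
      then obtain n where n: "k = i n" by blast
      show ?thesis
      proof (cases n)
        case 0 then show ?thesis using rV[of 0] n r0 by simp
      next
        case (Suc m)
        show ?thesis unfolding n Suc
          by (subst R(5)) (intro complex_vector.subspace_add[OF closure_span_subspace]
              complex_vector.subspace_scale[OF closure_span_subspace] gV rV)
      qed
    next
      case False
      then show ?thesis using f_in[of k] f_out closure_subset by fastforce
    qed
    then have "complex_vector.span (range e) \<subseteq> ?V"
      by (intro complex_vector.span_minimal closure_span_subspace) auto
    then show ?thesis using cl by (metis closed_closure closure_minimal top.extremum_uniqueI)
  qed
  moreover have "cinner (E (f k)) (f k) = complex_of_real (mu k)" for k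
    using gd d out by (cases "k \<in> range i") (auto simp: f_i f_out)
  ultimately show ?thesis
    unfolding is_diagonal_def orthonormal_basis_def orthonormal_def by blast
qed

text \<open>Passing to \<open>- E\<close> exchanges positive and negative entries, so constructions
  for positive entries serve both signs.\<close>

lemma is_diagonal_uminus: "is_diagonal E lam \<Longrightarrow> is_diagonal (\<lambda>x. - E x) (\<lambda>i. - lam i)"
  unfolding is_diagonal_def by (auto simp: cinner_minus_left)

lemma self_adjoint_uminus:
  assumes "self_adjoint E" shows "self_adjoint (\<lambda>x. - E (x::'a::complex_inner))"
proof -
  have "cinner x (- y) = - cinner x y" for x y :: 'a
    by (metis cinner_commute cinner_minus_left complex_cnj_minus)
  then show ?thesis using assms unfolding self_adjoint_def bounded_operator_def
    by (auto intro: bounded_linear_minus simp: complex_vector.scale_minus_right cinner_minus_left)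
qed

section \<open>Excess functions of null sequences\<close>

text \<open>For \<open>\<alpha> > 0\<close>, \<open>delta\<close> is a difference of two excesses;
  at \<open>- \<alpha>\<close> it is the same difference for the negated sequences. For a null
  sequence the excess is convex and piecewise linear on the positive axis, with slope minus the
  number of entries above the level.\<close>

definition excess :: "(nat \<Rightarrow> real) \<Rightarrow> real \<Rightarrow> real" where
  "excess x \<alpha> = (\<Sum>i\<in>{i. x i \<ge> \<alpha>}. x i - \<alpha>)"

lemma finite_ge_null_sequence:
  fixes x :: "nat \<Rightarrow> real"
  assumes "x \<longlonglongrightarrow> 0" "\<alpha> > 0" shows "finite {i. x i \<ge> \<alpha>}"
proof -
  have "eventually (\<lambda>i. x i < \<alpha>) sequentially" using assms by (rule order_tendstoD(2))
  then obtain N where "\<And>i. i \<ge> N \<Longrightarrow> x i < \<alpha>" by (auto simp: eventually_sequentially)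
  then have "{i. x i \<ge> \<alpha>} \<subseteq> {..<N}" by (metis lessThan_iff linorder_not_le mem_Collect_eq subsetI)
  then show ?thesis by (rule finite_subset) simp
qed

lemma excess_finite:
  assumes "x \<longlonglongrightarrow> 0" "\<alpha> > 0" "finite A" "{i. x i > \<alpha>} \<subseteq> A"
  shows "excess x \<alpha> = (\<Sum>i\<in>A. max 0 (x i - \<alpha>))"
proof -
  have "excess x \<alpha> = (\<Sum>i\<in>{i. x i > \<alpha>}. max 0 (x i - \<alpha>))"
    unfolding excess_def using finite_ge_null_sequence[OF assms(1,2)]
    by (intro sum.mono_neutral_cong_right) auto
  also have "\<dots> = (\<Sum>i\<in>A. max 0 (x i - \<alpha>))"
    using assms by (intro sum.mono_neutral_left) auto
  finally show ?thesis .
qed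

lemma excess_ge_sum:
  assumes "x \<longlonglongrightarrow> 0" "\<alpha> > 0" "finite A"
  shows "(\<Sum>i\<in>A. x i - \<alpha>) \<le> excess x \<alpha>"
proof -
  let ?B = "A \<union> {i. x i \<ge> \<alpha>}"
  have fin: "finite ?B" using assms finite_ge_null_sequence[OF assms(1,2)] by simp
  have "(\<Sum>i\<in>A. x i - \<alpha>) \<le> (\<Sum>i\<in>A. max 0 (x i - \<alpha>))" by (intro sum_mono) auto
  also have "\<dots> \<le> (\<Sum>i\<in>?B. max 0 (x i - \<alpha>))" using fin by (intro sum_mono2) auto
  also have "\<dots> = excess x \<alpha>" using assms fin by (intro excess_finite[symmetric]) auto
  finally show ?thesis .
qed

lemma excess_nonneg: "0 \<le> excess x \<alpha>"
  unfolding excess_def by (rule sum_nonneg) auto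

text \<open>For fixed \<alpha> only finitely many terms are nonzero. The series along
  \<open>i\<close> has the same index set for all \<alpha>, so that \<alpha> can tend to
  \<open>0\<close> termwise.\<close>

lemma excess_diff_sums:
  assumes "x \<longlonglongrightarrow> 0" "x' \<longlonglongrightarrow> 0" "\<alpha> > 0" "inj i" and out: "\<And>k. k \<notin> range i \<Longrightarrow> x k = x' k"
  shows "(\<lambda>n. max 0 (x (i n) - \<alpha>) - max 0 (x' (i n) - \<alpha>)) sums (excess x \<alpha> - excess x' \<alpha>)"
proof -
  define A where "A = {k. x k \<ge> \<alpha>} \<union> {k. x' k \<ge> \<alpha>}"
  have fin: "finite A" using finite_ge_null_sequence assms(1-3) by (simp add: A_def)
  let ?f = "\<lambda>k. max 0 (x k - \<alpha>) - max 0 (x' k - \<alpha>)"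
  have "excess x \<alpha> - excess x' \<alpha> = (\<Sum>k\<in>A. max 0 (x k - \<alpha>)) - (\<Sum>k\<in>A. max 0 (x' k - \<alpha>))"
    using excess_finite[OF assms(1,3) fin] excess_finite[OF assms(2,3) fin] by (force simp: A_def)
  also have "\<dots> = sum ?f A" by (simp add: sum_subtractf)
  finally have "(?f has_sum (excess x \<alpha> - excess x' \<alpha>)) UNIV"
    using fin by (intro has_sum_finite_neutralI[of A]) (auto simp: A_def)
  also have "?this \<longleftrightarrow> (?f has_sum (excess x \<alpha> - excess x' \<alpha>)) (range i)"
    using out by (intro has_sum_cong_neutral) auto
  also have "\<dots> \<longleftrightarrow> ((?f \<circ> i) has_sum (excess x \<alpha> - excess x' \<alpha>)) UNIV"
    by (rule has_sum_reindex) fact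
  finally show ?thesis using has_sum_imp_sums by (fastforce simp: o_def)
qed

text \<open>Tannery's theorem: taking positive parts is 1-Lipschitz, so
  \<open>\<bar>x (i n) - x' (i n)\<bar>\<close> dominates the terms uniformly in \<alpha>.\<close>

lemma excess_diff_tendsto:
  assumes "x \<longlonglongrightarrow> 0" "x' \<longlonglongrightarrow> 0" "inj i" and out: "\<And>k. k \<notin> range i \<Longrightarrow> x k = x' k"
    and summ: "summable (\<lambda>n. \<bar>x (i n) - x' (i n)\<bar>)"
  shows "((\<lambda>\<alpha>. excess x \<alpha> - excess x' \<alpha>) \<longlongrightarrow> (\<Sum>n. max 0 (x (i n)) - max 0 (x' (i n)))) (at_right 0)"
proof -
  have "((\<lambda>\<alpha>. \<Sum>n. max 0 (x (i n) - \<alpha>) - max 0 (x' (i n) - \<alpha>)) \<longlongrightarrow>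
      (\<Sum>n. max 0 (x (i n)) - max 0 (x' (i n)))) (at_right 0)"
  proof (intro tannerys_theorem[THEN conjunct2, THEN conjunct2, OF _ _ summ])
    show "((\<lambda>\<alpha>. max 0 (x (i n) - \<alpha>) - max 0 (x' (i n) - \<alpha>)) \<longlongrightarrow> max 0 (x (i n)) - max 0 (x' (i n)))
        (at_right 0)" for n
      by (rule tendsto_eq_intros refl tendsto_ident_at | simp)+
    show "\<forall>\<^sub>F (n, \<alpha>) in sequentially \<times>\<^sub>F at_right 0.
        norm (max 0 (x (i n) - \<alpha>) - max 0 (x' (i n) - \<alpha>)) \<le> \<bar>x (i n) - x' (i n)\<bar>"
      by (rule always_eventually) auto
  qed simp
  moreover have "\<forall>\<^sub>F \<alpha> in at_right 0. (\<Sum>n. max 0 (x (i n) - \<alpha>) - max 0 (x' (i n) - \<alpha>)) =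
      excess x \<alpha> - excess x' \<alpha>"
    using eventually_at_right_less
    by eventually_elim (use excess_diff_sums[OF assms(1,2) _ assms(3) out] in \<open>blast intro: sums_unique[symmetric]\<close>)
  ultimately show ?thesis by (rule Lim_transform_eventually)
qed

section \<open>Limits inferior and domination of excesses\<close>

text \<open>The limit inferior along \<open>F\<close> is the real number \<open>s\<close>: the
  eventual bound is the lower half, the frequent one the upper half.\<close>

definition liminf_eq :: "('a \<Rightarrow> real) \<Rightarrow> real \<Rightarrow> 'a filter \<Rightarrow> bool" where
  "liminf_eq f s F \<longleftrightarrow> (\<forall>\<epsilon>>0. (\<forall>\<^sub>F a in F. f a > s - \<epsilon>) \<and> (\<exists>\<^sub>F a in F. f a < s + \<epsilon>))"

lemma liminf_eq_diff:
  assumes "liminf_eq f s F" "(g \<longlongrightarrow> t) F"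
  shows "liminf_eq (\<lambda>a. f a - g a) (s - t) F"
  unfolding liminf_eq_def
proof (intro allI impI conjI)
  fix \<epsilon> :: real assume "\<epsilon> > 0"
  then have e: "\<epsilon> / 2 > 0" by simp
  have g: "\<forall>\<^sub>F a in F. dist (g a) t < \<epsilon> / 2" using assms(2) e unfolding tendsto_iff by blast
  have f: "\<forall>\<^sub>F a in F. f a > s - \<epsilon> / 2" "\<exists>\<^sub>F a in F. f a < s + \<epsilon> / 2"
    using assms(1) e unfolding liminf_eq_def by blast+
  have *: "\<bar>g a - t\<bar> < \<epsilon> / 2 \<Longrightarrow> g a < t + \<epsilon> / 2 \<and> g a > t - \<epsilon> / 2" for a
    unfolding abs_less_iff by auto
  show "\<forall>\<^sub>F a in F. f a - g a > s - t - \<epsilon>"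
    using f(1) g by eventually_elim (drule *[folded dist_real_def], simp add: field_simps)
  show "\<exists>\<^sub>F a in F. f a - g a < s - t + \<epsilon>"
    using frequently_eventually_conj[OF f(2) g]
    by (rule frequently_elim1) (elim conjE, drule *[folded dist_real_def], simp add: field_simps)
qed

lemma liminf_eq_ereal:
  assumes "F \<noteq> bot" "0 < Liminf F (\<lambda>a. ereal (f a))" "Liminf F (\<lambda>a. ereal (f a)) < \<infinity>"
  shows "liminf_eq f (real_of_ereal (Liminf F (\<lambda>a. ereal (f a)))) F"
proof -
  define s where "s = real_of_ereal (Liminf F (\<lambda>a. ereal (f a)))"
  have s: "Liminf F (\<lambda>a. ereal (f a)) = ereal s"
    unfolding s_def using assms by (intro ereal_real'[symmetric]) auto
  show ?thesis unfolding s_def[symmetric] liminf_eq_def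
  proof (intro allI impI conjI)
    fix \<epsilon> :: real assume "\<epsilon> > 0"
    have "ereal (s - \<epsilon>) < Liminf F (\<lambda>a. ereal (f a))" using s \<open>\<epsilon> > 0\<close> by simp
    then show "\<forall>\<^sub>F a in F. f a > s - \<epsilon>"
      using less_LiminfD by fastforce
    show "\<exists>\<^sub>F a in F. f a < s + \<epsilon>"
    proof (rule ccontr)
      assume "\<not> ?thesis"
      then have "\<forall>\<^sub>F a in F. ereal (s + \<epsilon>) \<le> ereal (f a)"
        by (simp add: not_frequently not_less)
      then have "ereal (s + \<epsilon>) \<le> Liminf F (\<lambda>a. ereal (f a))" by (rule Liminf_bounded)
      then show False using s \<open>\<epsilon> > 0\<close> by simp
    qed
  qed
qed

text \<open>The hypotheses on one side of \<open>0\<close>; the other side is the same predicate for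
  the negated sequences.\<close>

definition dominates :: "(nat \<Rightarrow> real) \<Rightarrow> (nat \<Rightarrow> real) \<Rightarrow> real \<Rightarrow> bool" where
  "dominates x z s \<longleftrightarrow> (\<forall>\<alpha>>0. excess z \<alpha> \<le> excess x \<alpha>) \<and>
    liminf_eq (\<lambda>\<alpha>. excess x \<alpha> - excess z \<alpha>) s (at_right 0)"

lemma dominates_eventually:
  assumes "dominates x z s" "s > 0"
  obtains a where "a > 0" "\<forall>\<alpha>. 0 < \<alpha> \<and> \<alpha> < a \<longrightarrow> excess x \<alpha> - excess z \<alpha> > s / 2"
proof -
  have "\<forall>\<^sub>F \<alpha> in at_right 0. excess x \<alpha> - excess z \<alpha> > s - s / 2"
    using assms unfolding dominates_def liminf_eq_def by (meson half_gt_zero)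
  then show ?thesis using that unfolding eventually_at_right_field by auto
qed

text \<open>Lowering the level from \<beta> to \<alpha> raises the term of an entry by at most
  \<open>\<beta> - \<alpha>\<close>, and by exactly that if the entry is at least \<beta>.\<close>

lemma excess_antimono_diff:
  fixes \<alpha> \<beta> :: real
  assumes "x \<longlonglongrightarrow> 0" "0 < \<alpha>" "\<alpha> \<le> \<beta>"
  shows "excess x \<alpha> - excess x \<beta> \<le> card {i. x i \<ge> \<alpha>} * (\<beta> - \<alpha>)"
    and "card {i. x i \<ge> \<beta>} * (\<beta> - \<alpha>) \<le> excess x \<alpha> - excess x \<beta>"
proof -
  let ?A = "{i. x i \<ge> \<alpha>}"
  have fin: "finite ?A" "finite {i. x i \<ge> \<beta>}"
    using finite_ge_null_sequence[OF assms(1)] assms(2,3) by auto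
  have "excess x \<alpha> = (\<Sum>i\<in>?A. max 0 (x i - \<alpha>))"
    using assms fin by (intro excess_finite) auto
  moreover have "excess x \<beta> = (\<Sum>i\<in>?A. max 0 (x i - \<beta>))"
    using assms fin by (intro excess_finite) auto
  ultimately have eq: "excess x \<alpha> - excess x \<beta> = (\<Sum>i\<in>?A. max 0 (x i - \<alpha>) - max 0 (x i - \<beta>))"
    by (simp add: sum_subtractf)
  also have "\<dots> \<le> (\<Sum>i\<in>?A. \<beta> - \<alpha>)"
    using assms by (intro sum_mono) auto
  finally show "excess x \<alpha> - excess x \<beta> \<le> card {i. x i \<ge> \<alpha>} * (\<beta> - \<alpha>)" by simp
  have "card {i. x i \<ge> \<beta>} * (\<beta> - \<alpha>) = (\<Sum>i\<in>{i. x i \<ge> \<beta>}. max 0 (x i - \<alpha>) - max 0 (x i - \<beta>))"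
    using assms by simp
  also have "\<dots> \<le> (\<Sum>i\<in>?A. max 0 (x i - \<alpha>) - max 0 (x i - \<beta>))"
    using assms fin by (intro sum_mono2) auto
  finally show "card {i. x i \<ge> \<beta>} * (\<beta> - \<alpha>) \<le> excess x \<alpha> - excess x \<beta>" using eq by simp
qed

text \<open>Provides an entry that can give away mass: lowering \<open>x p\<close> by at most
  \<open>c\<close> costs at level \<alpha> at most \<open>min c (x p - \<alpha>)\<close> of excess,
  which the gap covers.\<close>

lemma dominates_margin:
  assumes x: "x \<longlonglongrightarrow> 0" and z: "z \<longlonglongrightarrow> 0" and dom: "dominates x z s" and s: "s > 0"
  obtains p c where "x p > 0" "c > 0"
    "\<forall>\<alpha>. 0 < \<alpha> \<and> \<alpha> < x p \<longrightarrow> min c (x p - \<alpha>) \<le> excess x \<alpha> - excess z \<alpha>"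
proof -
  obtain a where a: "a > 0" "\<forall>\<alpha>. 0 < \<alpha> \<and> \<alpha> < a \<longrightarrow> excess x \<alpha> - excess z \<alpha> > s / 2"
    by (rule dominates_eventually[OF dom s])
  show ?thesis
  proof (cases "\<exists>p. 0 < x p \<and> x p \<le> a")
    case True
    then obtain p where "0 < x p" "x p \<le> a" by blast
    show ?thesis
    proof (rule that[of p "s / 2"])
      show "\<forall>\<alpha>. 0 < \<alpha> \<and> \<alpha> < x p \<longrightarrow> min (s / 2) (x p - \<alpha>) \<le> excess x \<alpha> - excess z \<alpha>"
        using a(2) \<open>x p \<le> a\<close> by (intro allI impI min.coboundedI1) fastforce
    qed (use \<open>0 < x p\<close> s in auto)
  next
    case False
    then have big: "x i > a" if "x i > 0" for i using that by force
    let ?P = "{i. x i > 0}"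
    have P_eq: "?P = {i. x i \<ge> a}" using big a(1) by fastforce
    then have fin: "finite ?P" using finite_ge_null_sequence[OF x a(1)] by simp
    have "?P \<noteq> {}"
    proof
      assume "?P = {}"
      then have "x i \<le> 0" for i by (metis empty_Collect_eq linorder_not_le)
      then have "{i. x i \<ge> a / 2} = {}" using a(1) by (smt (verit) divide_pos_pos empty_Collect_eq)
      then have "excess x (a / 2) = 0"
        by (simp add: excess_def)
      then show False using a(2)[rule_format, of "a / 2"] a(1) s excess_nonneg[of z "a / 2"] by simp
    qed
    then have "Min (x ` ?P) \<in> x ` ?P" using fin by (intro Min_in) auto
    \<comment> \<open>All positive entries exceed \<open>a\<close>, so they are finite in number and
      a smallest one exists. Up to \<open>x p\<close> the excess of \<open>x\<close> is linear with
      slope \<open>- m\<close>.\<close>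
    then obtain p where p: "p \<in> ?P" "x p = Min (x ` ?P)" by (elim imageE) simp
    have p_min: "x p \<le> x i" if "x i > 0" for i
      using that fin by (simp add: p(2))
    define m where "m = card ?P"
    have cardP: "card {i. x i \<ge> \<alpha>} = m" if "0 < \<alpha>" "\<alpha> \<le> x p" for \<alpha>
      unfolding m_def using that p_min by (intro arg_cong[of _ _ card]) fastforce
    show ?thesis
    proof (rule that[of p "s / 2"])
      show "x p > 0" "s / 2 > 0" using p s by auto
    next
      show "\<forall>\<alpha>. 0 < \<alpha> \<and> \<alpha> < x p \<longrightarrow> min (s / 2) (x p - \<alpha>) \<le> excess x \<alpha> - excess z \<alpha>"
      proof (intro allI impI, elim conjE)
        fix \<alpha> assume \<alpha>: "0 < \<alpha>" "\<alpha> < x p"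
        \<comment> \<open>If \<open>z\<close> has at least \<open>m\<close> entries reaching
          \<alpha>, the gap at \<alpha> is at least the gap at the smaller level \<beta>, which lies
          below \<open>a\<close>. Otherwise the gap grows at rate at least \<open>1\<close> as the
          level falls from \<open>x p\<close> to \<alpha>.\<close>
        show "min (s / 2) (x p - \<alpha>) \<le> excess x \<alpha> - excess z \<alpha>"
        proof (cases "m \<le> card {i. z i \<ge> \<alpha>}")
          case True
          define \<beta> where "\<beta> = min (\<alpha> / 2) (a / 2)"
          have \<beta>: "0 < \<beta>" "\<beta> \<le> \<alpha>" "\<beta> < a" "\<beta> \<le> x p" using \<alpha> a(1) by (auto simp: \<beta>_def)
          have "excess x \<beta> - excess x \<alpha> \<le> m * (\<alpha> - \<beta>)"
            using excess_antimono_diff(1)[OF x \<beta>(1,2)] cardP[OF \<beta>(1,4)] by simp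
          also have "\<dots> \<le> card {i. z i \<ge> \<alpha>} * (\<alpha> - \<beta>)"
            using True \<beta> by (intro mult_right_mono) auto
          also have "\<dots> \<le> excess z \<beta> - excess z \<alpha>"
            using excess_antimono_diff(2)[OF z \<beta>(1,2)] by simp
          finally show ?thesis using a(2)[rule_format, OF conjI[OF \<beta>(1,3)]] by simp
        next
          case False
          have "excess z \<alpha> - excess z (x p) \<le> card {i. z i \<ge> \<alpha>} * (x p - \<alpha>)"
            using excess_antimono_diff(1)[OF z, of \<alpha> "x p"] \<alpha> by simp
          moreover have "m * (x p - \<alpha>) \<le> excess x \<alpha> - excess x (x p)"
            using excess_antimono_diff(2)[OF x, of \<alpha> "x p"] \<alpha> cardP[of "x p"] by simp
          moreover have "(real (card {i. z i \<ge> \<alpha>}) + 1) * (x p - \<alpha>) \<le> m * (x p - \<alpha>)"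
            using False \<alpha> by (intro mult_right_mono) auto
          moreover have "excess z (x p) \<le> excess x (x p)" using dom \<alpha> unfolding dominates_def by simp
          ultimately have "x p - \<alpha> \<le> excess x \<alpha> - excess z \<alpha>" by (simp add: algebra_simps)
          then show ?thesis by simp
        qed
      qed
    qed
  qed
qed

section \<open>Greedy enumerations of null sequences\<close>

text \<open>Serves greedy choices, where a new value has to avoid all earlier ones.\<close>

lemma course_of_values_nat:
  obtains j :: "nat \<Rightarrow> 'a" where "\<And>n. j n = G (j ` {..<n}) n"
proof -
  define j where "j = wfrec less_than (\<lambda>f n. G (f ` {..<n}) n)"
  have "j n = G (j ` {..<n}) n" for n
  proof -
    have "cut j less_than n ` {..<n} = j ` {..<n}" by (intro image_cong) (auto simp: cut_def)
    then show ?thesis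
      unfolding j_def by (subst wfrec[OF wf_less_than]) (simp flip: j_def)
  qed
  then show ?thesis using that by blast
qed

text \<open>Every threshold can be met outside a finite set because \<open>x\<close> tends to
  \<open>0\<close>. Taking the least admissible index catches the zeros: a zero never chosen would
  be admissible at every stage and would bound all chosen indices.\<close>

lemma sparse_enumeration:
  fixes x \<tau> :: "nat \<Rightarrow> real"
  assumes "x \<longlonglongrightarrow> 0" "infinite T" "\<And>n. \<tau> n > 0"
  obtains j where "inj j" "range j \<subseteq> T" "\<forall>n. \<bar>x (j n)\<bar> \<le> \<tau> n" "\<forall>k\<in>T. x k = 0 \<longrightarrow> k \<in> range j"
proof -
  define Q where "Q U n k \<longleftrightarrow> k \<in> T \<and> k \<notin> U \<and> \<bar>x k\<bar> \<le> \<tau> n" for U n k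
  obtain j where j: "\<And>n. j n = (LEAST k. Q (j ` {..<n}) n k)"
    using course_of_values_nat[where G = "\<lambda>U n. LEAST k. Q U n k"] by blast
  have ex: "\<exists>k. Q (j ` {..<n}) n k" for n
  proof -
    have "eventually (\<lambda>k. \<bar>x k\<bar> < \<tau> n) sequentially"
      using assms(1,3) by (intro order_tendstoD(2)[of _ 0]) (auto intro: tendsto_rabs_zero)
    then obtain N where N: "\<And>k. k \<ge> N \<Longrightarrow> \<bar>x k\<bar> < \<tau> n" by (auto simp: eventually_sequentially)
    have "infinite (T - ({..<N} \<union> j ` {..<n}))" using assms(2) by (intro Diff_infinite_finite) auto
    then obtain k where "k \<in> T - ({..<N} \<union> j ` {..<n})" by (metis ex_in_conv finite.emptyI)
    then show ?thesis using N[of k] by (auto simp: Q_def intro!: exI[of _ k])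
  qed
  have Q: "Q (j ` {..<n}) n (j n)" for n unfolding j[of n] using ex LeastI_ex by metis
  have least: "j n \<le> k" if "Q (j ` {..<n}) n k" for n k unfolding j[of n] using that by (rule Least_le)
  have "inj j"
  proof (rule linorder_injI)
    fix m n :: nat assume "m < n"
    then show "j m \<noteq> j n" using Q[of n] unfolding Q_def by (metis image_eqI lessThan_iff)
  qed
  moreover have "k \<in> range j" if "k \<in> T" "x k = 0" for k
  proof (rule ccontr)
    assume k: "k \<notin> range j"
    have "j n \<le> k" for n using k that less_imp_le[OF assms(3)[of n]] by (intro least) (auto simp: Q_def)
    then have "finite (range j)" by (meson finite_atMost finite_subset image_subsetI atMost_iff)
    then show False using \<open>inj j\<close> finite_imageD by blast
  qed
  ultimately show ?thesis using Q that unfolding Q_def by blast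
qed

text \<open>Always choose a largest remaining entry; it exists since finitely many entries reach a
  given positive level. A positive entry never chosen would have infinitely many entries at or above
  its level.\<close>

lemma decreasing_enumeration:
  fixes x :: "nat \<Rightarrow> real"
  assumes "x \<longlonglongrightarrow> 0" "infinite {i. x i > 0}"
  obtains A where "inj A" "range A = {i. x i > 0}" "decseq (x \<circ> A)"
proof -
  define Q where "Q U k \<longleftrightarrow> x k > 0 \<and> k \<notin> U \<and> (\<forall>l. l \<notin> U \<longrightarrow> x l \<le> x k)" for U k
  obtain A :: "nat \<Rightarrow> nat" where A: "\<And>n. A n = (SOME k. Q (A ` {..<n}) k)"
    using course_of_values_nat[where G = "\<lambda>U n. SOME k. Q U k"] by blast
  have ex: "\<exists>k. Q (A ` {..<n}) k" for n
  proof -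
    have "infinite ({i. x i > 0} - A ` {..<n})" using assms(2) by (intro Diff_infinite_finite) auto
    then obtain k where "k \<in> {i. x i > 0} - A ` {..<n}" by (metis ex_in_conv finite.emptyI)
    then have k: "x k > 0" "k \<notin> A ` {..<n}" by auto
    let ?B = "{i. x i \<ge> x k} - A ` {..<n}"
    have B: "finite ?B" "k \<in> ?B" using finite_ge_null_sequence[OF assms(1) k(1)] k by auto
    then have "Max (x ` ?B) \<in> x ` ?B" by (intro Max_in) auto
    then obtain l where "l \<in> ?B" "x l = Max (x ` ?B)" unfolding image_iff by metis
    then have l: "l \<in> ?B" "\<And>i. i \<in> ?B \<Longrightarrow> x i \<le> x l" using B(1) by auto
    then have "x k \<le> x l" using B(2) by blast
    then have "x i \<le> x l" if "i \<notin> A ` {..<n}" for i using l(2)[of i] that by (cases "x i \<ge> x k") auto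
    then show ?thesis using l(1) k(1) by (intro exI[of _ l]) (auto simp: Q_def)
  qed
  have Q: "Q (A ` {..<n}) (A n)" for n unfolding A[of n] using ex someI_ex by metis
  have inj: "inj A"
  proof (rule linorder_injI)
    fix m n :: nat assume "m < n"
    then show "A m \<noteq> A n" using Q[of n] unfolding Q_def by (metis image_eqI lessThan_iff)
  qed
  have le: "x l \<le> x (A n)" if "l \<notin> A ` {..<n}" for l n using Q[of n] that unfolding Q_def by blast
  have "decseq (x \<circ> A)"
    unfolding decseq_Suc_iff o_def
    using inj by (intro allI le) (auto simp: inj_eq)
  moreover have "range A = {i. x i > 0}"
  proof (intro equalityI subsetI)
    fix k assume "k \<in> {i. x i > 0}"
    show "k \<in> range A"
    proof (rule ccontr)
      assume "k \<notin> range A"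
      then have "k \<notin> A ` {..<n}" for n by blast
      then have "range A \<subseteq> {i. x i \<ge> x k}" using le by blast
      moreover have "finite {i. x i \<ge> x k}" using finite_ge_null_sequence[OF assms(1)] \<open>k \<in> _\<close> by simp
      ultimately show False using inj finite_imageD finite_subset by blast
    qed
  qed (use Q in \<open>auto simp: Q_def\<close>)
  ultimately show ?thesis using inj that by blast
qed

section \<open>Removing zeros\<close>

lemma null_sequence_modify:
  fixes x x' :: "nat \<Rightarrow> real"
  assumes "x \<longlonglongrightarrow> 0" "inj i" "\<And>k. k \<notin> range i \<Longrightarrow> x k = x' k" "(\<lambda>n. x (i n) - x' (i n)) \<longlonglongrightarrow> 0"
  shows "x' \<longlonglongrightarrow> 0"
proof -
  have "(\<lambda>k. x k - x' k) \<longlonglongrightarrow> 0"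
  proof (rule LIMSEQ_I)
    fix r :: real assume "r > 0"
    then obtain N where N: "\<And>n. n \<ge> N \<Longrightarrow> \<bar>x (i n) - x' (i n)\<bar> < r"
      using LIMSEQ_D[OF assms(4)] by auto
    have "finite (i ` {..<N})" by simp
    then obtain M where M: "\<And>k. k \<in> i ` {..<N} \<Longrightarrow> k < M"
      using finite_nat_set_iff_bounded[of "i ` {..<N}"] by auto
    show "\<exists>no. \<forall>k\<ge>no. norm (x k - x' k - 0) < r"
    proof (intro exI[of _ M] allI impI)
      fix k assume "k \<ge> M"
      then have "k \<notin> i ` {..<N}" using M by (meson linorder_not_le)
      then show "norm (x k - x' k - 0) < r"
        using N assms(3)[of k] \<open>r > 0\<close> by (cases "k \<in> range i") (auto simp flip: not_less)
    qed
  qed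
  from tendsto_diff[OF assms(1) this] show ?thesis by simp
qed

lemma liminf_eq_excess_left:
  assumes "liminf_eq (\<lambda>\<alpha>. excess x \<alpha> - excess z \<alpha>) s (at_right 0)"
    and "((\<lambda>\<alpha>. excess x \<alpha> - excess x' \<alpha>) \<longlongrightarrow> t) (at_right 0)"
  shows "liminf_eq (\<lambda>\<alpha>. excess x' \<alpha> - excess z \<alpha>) (s - t) (at_right 0)"
  using liminf_eq_diff[OF assms] by simp

lemma liminf_eq_excess_right:
  assumes "liminf_eq (\<lambda>\<alpha>. excess x \<alpha> - excess z \<alpha>) s (at_right 0)"
    and "((\<lambda>\<alpha>. excess z' \<alpha> - excess z \<alpha>) \<longlongrightarrow> t) (at_right 0)"
  shows "liminf_eq (\<lambda>\<alpha>. excess x \<alpha> - excess z' \<alpha>) (s - t) (at_right 0)"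
  using liminf_eq_diff[OF assms] by simp

text \<open>In the chains below only the starting entry goes down, so only the first term of the
  excess difference can be positive.\<close>

lemma sums_le_first:
  fixes f :: "nat \<Rightarrow> real"
  assumes "f sums S" "\<And>n. f (Suc n) \<le> 0" shows "S \<le> f 0"
proof (rule sums_le[OF _ assms(1) sums_single[of 0 f]])
  show "f n \<le> (if n = 0 then f n else 0)" for n using assms(2) by (cases n) auto
qed

text \<open>A chain starting at a positive entry \<open>lam p\<close> turns sparse small entries positive at a small
  expense of \<open>lam p\<close>; this uses up zeros of \<open>lam\<close>.\<close>

lemma spread_positive:
  fixes lam d :: "nat \<Rightarrow> real"
  assumes E: "self_adjoint E" and diag: "is_diagonal E lam"
    and lam: "lam \<longlonglongrightarrow> 0" and d: "d \<longlonglongrightarrow> 0"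
    and pos: "dominates lam d s" and neg: "dominates (\<lambda>k. - lam k) (\<lambda>k. - d k) s" and s: "s > 0"
    and T: "infinite T"
  obtains lam' s' where "is_diagonal E lam'" "lam' \<longlonglongrightarrow> 0"
    "dominates lam' d s'" "dominates (\<lambda>k. - lam' k) (\<lambda>k. - d k) s'" "s' > 0"
    "infinite {k \<in> T. lam' k > 0}"
    "\<forall>k. lam' k > 0 \<or> lam' k = lam k \<and> (k \<in> T \<longrightarrow> lam k \<noteq> 0)"
    "\<forall>k. k \<notin> T \<longrightarrow> lam k \<le> 0 \<longrightarrow> lam' k = lam k"
proof -
  have nlam: "(\<lambda>k. - lam k) \<longlonglongrightarrow> 0" using lam tendsto_minus by fastforce
  obtain p c where p: "lam p > 0" "c > 0"
    "\<forall>\<alpha>. 0 < \<alpha> \<and> \<alpha> < lam p \<longrightarrow> min c (lam p - \<alpha>) \<le> excess lam \<alpha> - excess d \<alpha>"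
    by (rule dominates_margin[OF lam d pos s])
  obtain a where a: "a > 0"
    "\<forall>\<alpha>. 0 < \<alpha> \<and> \<alpha> < a \<longrightarrow> excess (\<lambda>k. - lam k) \<alpha> - excess (\<lambda>k. - d k) \<alpha> > s / 2"
    by (rule dominates_eventually[OF neg s])
  \<comment> \<open>The bounds by \<open>c\<close> and \<open>lam p\<close> allow
    \<open>lam p\<close> to give away \<open>\<eta> / 3\<close>; those by \<open>a\<close> and
    \<open>s\<close> let the gap \<open>s / 2\<close> below level \<open>a\<close> cover the loss of
    the negative excess.\<close>
  define \<eta> where "\<eta> = min (min c (lam p)) (min a s)"
  have \<eta>: "\<eta> > 0" "\<eta> \<le> c" "\<eta> \<le> lam p" "\<eta> \<le> a" "\<eta> \<le> s" using p a s by (auto simp: \<eta>_def)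
  \<comment> \<open>The chain starts from the unchanged vector at \<open>p\<close>, hence
    \<open>y 0 = 0\<close>. Afterwards one third of the carried mass is handed on and two thirds
    stay.\<close>
  define y where "y n = (if n = 0 then 0 else \<eta> * (1 / 3) ^ n)" for n
  have y0: "y 0 = 0" and y1: "y (Suc 0) = \<eta> / 3" and ySS: "y (Suc (Suc n)) = y (Suc n) / 3"
    and y_nonneg: "0 \<le> y n" and yS: "y (Suc n) > 0" and y_le: "y n \<le> \<eta> * (1 / 3) ^ n" for n
    using \<eta>(1) by (auto simp: y_def)
  \<comment> \<open>The \<open>9\<close> makes \<open>lam (j n)\<close> small against the two thirds
    of \<open>y (Suc n)\<close> that stay there, so the new entry is positive; it also leaves room
    for the factor \<open>1 / 2\<close> in \<open>diagonal_chain\<close>.\<close>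
  obtain j where j: "inj j" "range j \<subseteq> T - {p}" "\<forall>n. \<bar>lam (j n)\<bar> \<le> y (Suc n) / 9"
    "\<forall>k\<in>T - {p}. lam k = 0 \<longrightarrow> k \<in> range j"
  proof (rule sparse_enumeration[OF lam, of "T - {p}" "\<lambda>n. y (Suc n) / 9"])
  qed (use T yS in auto)
  define i where "i n = (case n of 0 \<Rightarrow> p | Suc n \<Rightarrow> j n)" for n
  have i0: "i 0 = p" and iS: "i (Suc n) = j n" for n by (simp_all add: i_def)
  have j_ne: "j n \<noteq> p" and jT: "j n \<in> T" for n using j(2) by blast+
  have inj_i: "inj i"
  proof (rule injI)
    show "m = n" if "i m = i n" for m n
      using that j_ne[of "n - 1"] j_ne[of "m - 1"] j(1) by (cases m; cases n) (auto simp: i0 iS inj_eq)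
  qed
  have range_i: "range i = insert p (range j)"
    by (auto simp: i_def image_iff split: nat.splits)
  define lam' where "lam' k = (if k \<in> range i then lam k + y (inv i k) - y (Suc (inv i k)) else lam k)" for k
  have lam'_i: "lam' (i n) = lam (i n) + y n - y (Suc n)" for n
    using inj_i by (simp add: lam'_def)
  have out: "lam k = lam' k" if "k \<notin> range i" for k using that by (simp add: lam'_def)
  have jb: "lam (j n) \<le> y (Suc n) / 9" "- lam (j n) \<le> y (Suc n) / 9" for n
    using j(3)[rule_format, of n] by (auto simp: abs_le_iff)
  have step: "y (Suc n) \<le> (lam (i n) + y n - lam (i (Suc n))) / 2" for n
  proof (cases n)
    case 0
    then show ?thesis using jb(1)[of 0] \<eta>(1,3) by (simp add: i0 iS y0 y1)
  next
    case (Suc m)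
    then show ?thesis using jb(2)[of m] jb(1)[of "Suc m"] yS[of m] by (simp add: iS ySS)
  qed
  have diag': "is_diagonal E lam'"
    by (rule diagonal_chain[OF E diag inj_i y0 y_nonneg step lam'_i]) (use out in auto)
  have geo: "(\<lambda>n. \<eta> * (1 / 3) ^ n) sums (\<eta> * (3 / 2))"
    using sums_mult[OF geometric_sums[of "1 / 3 :: real"], of \<eta>] by simp
  have y_lim: "y \<longlonglongrightarrow> 0"
  proof (rule tendsto_sandwich[OF _ _ tendsto_const])
    show "(\<lambda>n. \<eta> * (1 / 3) ^ n) \<longlonglongrightarrow> 0" using geo sums_summable summable_LIMSEQ_zero by blast
  qed (use y_nonneg y_le in auto)
  have diff_i: "lam (i n) - lam' (i n) = y (Suc n) - y n" for n by (simp add: lam'_i)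
  have diff_lim: "(\<lambda>n. lam (i n) - lam' (i n)) \<longlonglongrightarrow> 0"
    unfolding diff_i using tendsto_diff[OF LIMSEQ_Suc[OF y_lim] y_lim] by simp
  have lam': "lam' \<longlonglongrightarrow> 0"
    using null_sequence_modify[OF lam inj_i out diff_lim] .
  then have nlam': "(\<lambda>k. - lam' k) \<longlonglongrightarrow> 0" using tendsto_minus by fastforce
  have summ: "summable (\<lambda>n. \<bar>lam (i n) - lam' (i n)\<bar>)"
  proof (rule summable_comparison_test)
    show "\<exists>N. \<forall>n\<ge>N. norm \<bar>lam (i n) - lam' (i n)\<bar> \<le> 2 * (\<eta> * (1 / 3) ^ n)"
    proof (intro exI allI impI)
      fix n
      have "y (Suc n) \<le> \<eta> * (1 / 3) ^ n" using y_le[of "Suc n"] y_nonneg[of "Suc n"] by simp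
      then show "norm \<bar>lam (i n) - lam' (i n)\<bar> \<le> 2 * (\<eta> * (1 / 3) ^ n)"
        using y_le[of n] y_nonneg[of n] y_nonneg[of "Suc n"] unfolding diff_i by (simp add: abs_le_iff)
    qed
    show "summable (\<lambda>n. 2 * (\<eta> * (1 / 3) ^ n))" using geo sums_summable summable_mult by blast
  qed
  have junk_up: "lam (i (Suc n)) \<le> lam' (i (Suc n))" for n
    using yS[of n] by (simp add: lam'_i ySS)
  have junk_pos: "lam' (j n) > 0" for n
    using jb(2)[of n] yS[of n] lam'_i[of "Suc n"] by (simp add: iS ySS)
  have p_val: "lam' p = lam p - \<eta> / 3" using lam'_i[of 0] by (simp add: i0 y0 y1)
  have p_pos: "lam' p > 0" unfolding p_val using \<eta> by simp

  have pos': "excess d \<alpha> \<le> excess lam' \<alpha>" if \<alpha>: "\<alpha> > 0" for \<alpha>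
  proof -
    have le: "excess lam \<alpha> - excess lam' \<alpha> \<le> max 0 (lam p - \<alpha>) - max 0 (lam p - \<eta> / 3 - \<alpha>)"
      using sums_le_first[OF excess_diff_sums[OF lam lam' \<alpha> inj_i out]] junk_up
      by (simp add: i0 p_val max.coboundedI2)
    show ?thesis
    proof (cases "\<alpha> < lam p")
      case True
      \<comment> \<open>The entry at \<open>p\<close> loses at most \<open>\<eta> / 3\<close>, and
        at most the excess \<open>lam p - \<alpha>\<close> that it has.\<close>
      have "max 0 (lam p - \<alpha>) - max 0 (lam p - \<eta> / 3 - \<alpha>) \<le> min c (lam p - \<alpha>)"
        using True \<eta> by (auto simp: min_def max_def)
      then show ?thesis using le p(3)[rule_format, of \<alpha>] \<alpha> True by simp
    next
      case False
      then have "max 0 (lam p - \<alpha>) = 0" by (simp add: max_def)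
      then have "excess lam \<alpha> \<le> excess lam' \<alpha>" using le by linarith
      then show ?thesis using pos \<alpha> unfolding dominates_def by fastforce
    qed
  qed
  \<comment> \<open>Negative excess is lost only where some \<open>lam (j m)\<close> is negative,
    and then at most its modulus. These bounds add up to \<open>\<eta> / 6\<close>.\<close>
  have neg_term: "max 0 (- lam (i n) - \<alpha>) - max 0 (- lam' (i n) - \<alpha>) \<le> \<eta> / 9 * (1 / 3) ^ n"
    if "\<alpha> \<ge> 0" for \<alpha> n
  proof (cases n)
    case 0
    have "max 0 (- lam (i n) - \<alpha>) = 0" using p(1) that 0 by (simp add: i0)
    moreover have "0 \<le> \<eta> / 9 * (1 / 3) ^ n" "0 \<le> max 0 (- lam' (i n) - \<alpha>)" using \<eta>(1) by auto
    ultimately show ?thesis by linarith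
  next
    case (Suc m)
    have "- lam (i n) \<le> \<eta> / 9 * (1 / 3) ^ n"
      using jb(2)[of m] Suc by (simp add: iS y_def)
    moreover have "0 \<le> \<eta> / 9 * (1 / 3) ^ n" using \<eta>(1) by simp
    ultimately have "max 0 (- lam (i n) - \<alpha>) \<le> \<eta> / 9 * (1 / 3) ^ n"
      using that by (intro max.boundedI) linarith+
    moreover have "0 \<le> max 0 (- lam' (i n) - \<alpha>)" by simp
    ultimately show ?thesis by linarith
  qed
  have geo9: "(\<lambda>n. \<eta> / 9 * (1 / 3) ^ n) sums (\<eta> / 6)"
    using sums_mult[OF geo, of "1 / 9"] by simp
  have neg': "excess (\<lambda>k. - d k) \<alpha> \<le> excess (\<lambda>k. - lam' k) \<alpha>" if \<alpha>: "\<alpha> > 0" for \<alpha>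
  proof -
    have S: "(\<lambda>n. max 0 (- lam (i n) - \<alpha>) - max 0 (- lam' (i n) - \<alpha>)) sums
        (excess (\<lambda>k. - lam k) \<alpha> - excess (\<lambda>k. - lam' k) \<alpha>)"
      by (rule excess_diff_sums[OF nlam nlam' \<alpha> inj_i]) (use out in auto)
    show ?thesis
    proof (cases "\<alpha> < a")
      case True
      have "excess (\<lambda>k. - lam k) \<alpha> - excess (\<lambda>k. - lam' k) \<alpha> \<le> \<eta> / 6"
        using sums_le[OF neg_term S geo9] \<alpha> by simp
      then show ?thesis using a(2)[rule_format, of \<alpha>] \<alpha> True \<eta>(5) s by simp
    next
      case False
      \<comment> \<open>At levels from \<open>a\<close> on, the entries of the chain are too small
        to have contributed to the negative excess.\<close>
      have "- lam (i n) \<le> \<alpha>" for n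
      proof (cases n)
        case 0 then show ?thesis using p(1) \<alpha> by (simp add: i0)
      next
        case (Suc m)
        have "\<eta> * (1 / 3) ^ Suc m \<le> \<eta> * 1"
          using \<eta>(1) by (intro mult_left_mono power_le_one) auto
        then have "y (Suc m) \<le> \<eta>" using y_le[of "Suc m"] by linarith
        then have "- lam (j m) \<le> \<alpha>" using jb(2)[of m] \<eta>(1,4) False by linarith
        then show ?thesis using Suc by (simp add: iS)
      qed
      then have "max 0 (- lam (i n) - \<alpha>) = 0" for n by simp
      then have "excess (\<lambda>k. - lam k) \<alpha> - excess (\<lambda>k. - lam' k) \<alpha> \<le> 0"
        by (intro sums_le[OF _ S sums_zero]) simp
      moreover have "excess (\<lambda>k. - d k) \<alpha> \<le> excess (\<lambda>k. - lam k) \<alpha>"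
        using neg \<alpha> by (simp add: dominates_def)
      ultimately show ?thesis by linarith
    qed
  qed

  \<comment> \<open>\<open>P\<close> and \<open>N\<close> are the limits of the losses of the two
    excesses. Positive part minus negative part is the identity, so \<open>P - N\<close> is the
    change of the trace, which telescopes to \<open>0\<close>; hence both limits inferior drop by
    the same amount.\<close>
  define P N where "P = (\<Sum>n. max 0 (lam (i n)) - max 0 (lam' (i n)))"
    and "N = (\<Sum>n. max 0 (- lam (i n)) - max 0 (- lam' (i n)))"
  have tP: "((\<lambda>\<alpha>. excess lam \<alpha> - excess lam' \<alpha>) \<longlongrightarrow> P) (at_right 0)"
    unfolding P_def by (rule excess_diff_tendsto[OF lam lam' inj_i out summ])
  have tN: "((\<lambda>\<alpha>. excess (\<lambda>k. - lam k) \<alpha> - excess (\<lambda>k. - lam' k) \<alpha>) \<longlongrightarrow> N) (at_right 0)"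
    unfolding N_def
    by (rule excess_diff_tendsto[OF nlam nlam' inj_i]) (use out summ in \<open>auto simp: abs_minus_commute\<close>)
  have sP: "(\<lambda>n. max 0 (lam (i n)) - max 0 (lam' (i n))) sums P"
    unfolding P_def by (rule summable_sums, rule summable_comparison_test[OF _ summ]) auto
  have sN: "(\<lambda>n. max 0 (- lam (i n)) - max 0 (- lam' (i n))) sums N"
    unfolding N_def by (rule summable_sums, rule summable_comparison_test[OF _ summ]) auto
  have "P = N"
  proof -
    have "(\<lambda>n. (max 0 (lam (i n)) - max 0 (lam' (i n))) - (max 0 (- lam (i n)) - max 0 (- lam' (i n)))) sums (P - N)"
      by (rule sums_diff[OF sP sN])
    also have "(\<lambda>n. (max 0 (lam (i n)) - max 0 (lam' (i n))) - (max 0 (- lam (i n)) - max 0 (- lam' (i n))))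
        = (\<lambda>n. y (Suc n) - y n)"
      unfolding diff_i[symmetric] by (auto simp: max_def)
    finally have "(\<lambda>n. y (Suc n) - y n) sums (P - N)" .
    moreover have "(\<lambda>n. y (Suc n) - y n) sums (0 - y 0)" by (rule telescope_sums[OF y_lim])
    ultimately show ?thesis using y0 sums_unique2 by fastforce
  qed
  have "N \<le> \<eta> / 6" by (rule sums_le[OF _ sN geo9]) (use neg_term[of 0] in simp)
  show ?thesis
  proof (rule that[OF diag' lam', of "s - P"])
    show "dominates lam' d (s - P)"
      unfolding dominates_def using pos' liminf_eq_excess_left[OF _ tP] pos
      by (simp add: dominates_def)
    show "dominates (\<lambda>k. - lam' k) (\<lambda>k. - d k) (s - P)"
      unfolding dominates_def using neg' liminf_eq_excess_left[OF _ tN] neg \<open>P = N\<close>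
      by (simp add: dominates_def)
    show "s - P > 0" using \<open>P = N\<close> \<open>N \<le> \<eta> / 6\<close> \<eta>(1,5) by simp
    have "range j \<subseteq> {k \<in> T. lam' k > 0}" using jT junk_pos by auto
    moreover have "infinite (range j)" using j(1) finite_imageD by blast
    ultimately show "infinite {k \<in> T. lam' k > 0}" using finite_subset by blast
    show "\<forall>k. lam' k > 0 \<or> lam' k = lam k \<and> (k \<in> T \<longrightarrow> lam k \<noteq> 0)"
    proof
      fix k
      show "lam' k > 0 \<or> lam' k = lam k \<and> (k \<in> T \<longrightarrow> lam k \<noteq> 0)"
      proof (cases "k \<in> range i")
        case True
        then show ?thesis using junk_pos p_pos unfolding range_i by auto
      next
        case False
        then show ?thesis using out[of k] j(4)[rule_format, of k] p(1) unfolding range_i by auto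
      qed
    qed
    show "\<forall>k. k \<notin> T \<longrightarrow> lam k \<le> 0 \<longrightarrow> lam' k = lam k"
    proof (intro allI impI)
      fix k assume "k \<notin> T" "lam k \<le> 0"
      then have "k \<notin> range i" using p(1) jT unfolding range_i by auto
      then show "lam' k = lam k" using out by simp
    qed
  qed
qed

section \<open>Pulling the target sequence apart\<close>

text \<open>The shifts have the total \<open>\<eta> * (3 / 2)\<close>, rounded up to
  \<open>2 * \<eta>\<close>, and shifted entries stay below \<open>2 * \<eta>\<close>, so higher
  levels see no increase. The difference \<open>t - u\<close> is the total shift because positive
  part minus negative part is the identity.\<close>

lemma excess_shift_up:
  fixes z z' :: "nat \<Rightarrow> real"
  assumes z: "z \<longlonglongrightarrow> 0" and j: "inj j" and \<eta>: "\<eta> > 0"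
    and small: "\<And>n. \<bar>z (j n)\<bar> \<le> \<eta> * (1 / 3) ^ n / 3"
    and z'_j: "\<And>n. z' (j n) = z (j n) + \<eta> * (1 / 3) ^ n"
    and out: "\<And>k. k \<notin> range j \<Longrightarrow> z k = z' k"
  obtains t u where "z' \<longlonglongrightarrow> 0"
    "\<forall>\<alpha>>0. excess z' \<alpha> - excess z \<alpha> \<le> 2 * \<eta>"
    "\<forall>\<alpha>\<ge>2 * \<eta>. excess z' \<alpha> \<le> excess z \<alpha>"
    "\<forall>\<alpha>>0. excess (\<lambda>k. - z' k) \<alpha> \<le> excess (\<lambda>k. - z k) \<alpha>"
    "((\<lambda>\<alpha>. excess z' \<alpha> - excess z \<alpha>) \<longlongrightarrow> t) (at_right 0)"
    "((\<lambda>\<alpha>. excess (\<lambda>k. - z' k) \<alpha> - excess (\<lambda>k. - z k) \<alpha>) \<longlongrightarrow> u) (at_right 0)"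
    "t \<le> 2 * \<eta>" "u \<le> 0" "t - u = \<eta> * (3 / 2)"
proof -
  define w where "w n = \<eta> * (1 / 3) ^ n" for n
  have w: "w n > 0" "w n \<le> \<eta>" for n
  proof -
    show "w n > 0" using \<eta> by (simp add: w_def)
    have "\<eta> * (1 / 3) ^ n \<le> \<eta> * 1" using \<eta> by (intro mult_left_mono power_le_one) auto
    then show "w n \<le> \<eta>" by (simp add: w_def)
  qed
  have w_sums: "w sums (\<eta> * (3 / 2))"
    unfolding w_def using sums_mult[OF geometric_sums[of "1 / 3 :: real"], of \<eta>] by simp
  have zj: "z' (j n) = z (j n) + w n" and zs: "z (j n) \<le> w n / 3" for n
    using z'_j small[of n] by (auto simp: w_def abs_le_iff)
  have "(\<lambda>n. - w n) \<longlonglongrightarrow> - 0"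
    using w_sums by (intro tendsto_minus summable_LIMSEQ_zero) (simp add: sums_iff)
  then have z': "z' \<longlonglongrightarrow> 0"
    by (intro null_sequence_modify[OF z j out]) (simp_all add: zj)
  have nz: "(\<lambda>k. - z k) \<longlonglongrightarrow> 0" "(\<lambda>k. - z' k) \<longlonglongrightarrow> 0"
    using tendsto_minus[OF z] tendsto_minus[OF z'] by simp_all
  have out': "z' k = z k" "- z' k = - z k" if "k \<notin> range j" for k using out[OF that] by simp_all
  have up: "(\<lambda>n. max 0 (z' (j n) - \<alpha>) - max 0 (z (j n) - \<alpha>)) sums (excess z' \<alpha> - excess z \<alpha>)"
    if "\<alpha> > 0" for \<alpha>
    using excess_diff_sums[OF z' z that j out'(1)] .
  have down: "(\<lambda>n. max 0 (- z' (j n) - \<alpha>) - max 0 (- z (j n) - \<alpha>)) sums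
      (excess (\<lambda>k. - z' k) \<alpha> - excess (\<lambda>k. - z k) \<alpha>)" if "\<alpha> > 0" for \<alpha>
    using excess_diff_sums[OF nz(2,1) that j out'(2)] .
  have up_le: "max 0 (z' (j n) - \<alpha>) - max 0 (z (j n) - \<alpha>) \<le> w n" for n \<alpha>
    using w(1)[of n] by (simp add: zj max_def)
  have down_le: "max 0 (- z' (j n) - \<alpha>) - max 0 (- z (j n) - \<alpha>) \<le> 0" for n \<alpha>
    using w(1)[of n] by (simp add: zj max_def)
  have 1: "excess z' \<alpha> - excess z \<alpha> \<le> 2 * \<eta>" if "\<alpha> > 0" for \<alpha>
    using sums_le[OF up_le up[OF that] w_sums] \<eta> by simp
  have 2: "excess z' \<alpha> \<le> excess z \<alpha>" if "\<alpha> \<ge> 2 * \<eta>" for \<alpha>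
  proof -
    have "\<alpha> > 0" using that \<eta> by linarith
    have "max 0 (z' (j n) - \<alpha>) = 0" for n
      using zs[of n] w[of n] that by (simp add: zj)
    then have "excess z' \<alpha> - excess z \<alpha> \<le> 0"
      by (intro sums_le[OF _ up[OF \<open>\<alpha> > 0\<close>] sums_zero]) simp
    then show ?thesis by simp
  qed
  have 3: "excess (\<lambda>k. - z' k) \<alpha> \<le> excess (\<lambda>k. - z k) \<alpha>" if "\<alpha> > 0" for \<alpha>
    using sums_le[OF down_le down[OF that] sums_zero] by simp
  have summ: "summable (\<lambda>n. \<bar>z' (j n) - z (j n)\<bar>)" "summable (\<lambda>n. \<bar>- z' (j n) - (- z (j n))\<bar>)"
    using w_sums w(1) by (simp_all add: zj sums_iff abs_of_pos)
  define t u where "t = (\<Sum>n. max 0 (z' (j n)) - max 0 (z (j n)))"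
    and "u = (\<Sum>n. max 0 (- z' (j n)) - max 0 (- z (j n)))"
  have 4: "((\<lambda>\<alpha>. excess z' \<alpha> - excess z \<alpha>) \<longlongrightarrow> t) (at_right 0)"
    unfolding t_def by (rule excess_diff_tendsto[OF z' z j out'(1) summ(1)])
  have 5: "((\<lambda>\<alpha>. excess (\<lambda>k. - z' k) \<alpha> - excess (\<lambda>k. - z k) \<alpha>) \<longlongrightarrow> u) (at_right 0)"
    unfolding u_def by (rule excess_diff_tendsto[OF nz(2,1) j out'(2) summ(2)])
  have t: "(\<lambda>n. max 0 (z' (j n)) - max 0 (z (j n))) sums t"
    unfolding t_def by (rule summable_sums, rule summable_comparison_test[OF _ summ(1)]) auto
  have u: "(\<lambda>n. max 0 (- z' (j n)) - max 0 (- z (j n))) sums u"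
    unfolding u_def by (rule summable_sums, rule summable_comparison_test[OF _ summ(2)]) auto
  have "t \<le> \<eta> * (3 / 2)" by (rule sums_le[OF _ t w_sums]) (use up_le[of _ 0] in simp)
  then have 6: "t \<le> 2 * \<eta>" using \<eta> by simp
  have 7: "u \<le> 0" by (rule sums_le[OF _ u sums_zero]) (use down_le[of _ 0] in simp)
  have "(\<lambda>n. (max 0 (z' (j n)) - max 0 (z (j n))) - (max 0 (- z' (j n)) - max 0 (- z (j n)))) sums (t - u)"
    by (rule sums_diff[OF t u])
  also have "(\<lambda>n. (max 0 (z' (j n)) - max 0 (z (j n))) - (max 0 (- z' (j n)) - max 0 (- z (j n)))) = w"
    by (intro ext) (simp add: zj max_def)
  finally have "t - u = \<eta> * (3 / 2)" using w_sums sums_unique2 by blast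
  with 1 2 3 show ?thesis by (intro that[OF z' _ _ _ 4 5 6 7]) auto
qed

text \<open>Below \<open>a\<close> the gap pays for the growth of the target's excess; from
  \<open>a\<close> on there is no growth.\<close>

lemma dominates_perturb_target:
  assumes dom: "dominates x z s" and lim: "((\<lambda>\<alpha>. excess z' \<alpha> - excess z \<alpha>) \<longlongrightarrow> t) (at_right 0)"
    and low: "\<And>\<alpha>. 0 < \<alpha> \<Longrightarrow> \<alpha> < a \<Longrightarrow> 2 * \<eta> \<le> excess x \<alpha> - excess z \<alpha>"
    and up: "\<And>\<alpha>. \<alpha> > 0 \<Longrightarrow> excess z' \<alpha> - excess z \<alpha> \<le> 2 * \<eta>"
    and far: "\<And>\<alpha>. \<alpha> > 0 \<Longrightarrow> \<alpha> \<ge> a \<Longrightarrow> excess z' \<alpha> \<le> excess z \<alpha>"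
  shows "dominates x z' (s - t)"
proof -
  have "excess z' \<alpha> \<le> excess x \<alpha>" if "\<alpha> > 0" for \<alpha>
  proof (cases "\<alpha> < a")
    case True
    then show ?thesis using low[OF that] up[OF that] by linarith
  next
    case False
    have "excess z \<alpha> \<le> excess x \<alpha>" using dom that by (simp add: dominates_def)
    then show ?thesis using far[OF that] False by linarith
  qed
  then show ?thesis
    using dom liminf_eq_excess_right[OF _ lim] by (simp add: dominates_def)
qed

lemma infinite_even: "infinite {k::nat. even k}" and infinite_odd: "infinite {k::nat. odd k}"
proof -
  have "\<exists>n>m. even n" "\<exists>n>m. odd n" for m :: nat
    by (rule exI[of _ "2 * m + 2"], simp) (rule exI[of _ "2 * m + 1"], simp)
  then show "infinite {k::nat. even k}" "infinite {k::nat. odd k}"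
    by (auto simp: infinite_nat_iff_unbounded)
qed

text \<open>Spreading a pair of small entries of \<open>d\<close> to opposite signs is undone by a rotation of the
  pair, so \<open>d\<close> may be replaced by a sequence without zeros and with infinitely many entries of
  each sign.\<close>

lemma spread_target:
  fixes lam d :: "nat \<Rightarrow> real"
  assumes lam: "lam \<longlonglongrightarrow> 0" and d: "d \<longlonglongrightarrow> 0"
    and pos: "dominates lam d s" and neg: "dominates (\<lambda>k. - lam k) (\<lambda>k. - d k) s" and s: "s > 0"
  obtains d' s' where "d' \<longlonglongrightarrow> 0" "dominates lam d' s'" "dominates (\<lambda>k. - lam k) (\<lambda>k. - d' k) s'"
    "s' > 0" "infinite {k. d' k > 0}" "infinite {k. d' k < 0}" "\<forall>k. d' k \<noteq> 0"
    "\<forall>E :: 'a::complex_inner \<Rightarrow> 'a. self_adjoint E \<longrightarrow> is_diagonal E d' \<longrightarrow> is_diagonal E d"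
proof -
  have nd: "(\<lambda>k. - d k) \<longlonglongrightarrow> 0" using tendsto_minus[OF d] by simp
  obtain a where a: "a > 0" "\<forall>\<alpha>. 0 < \<alpha> \<and> \<alpha> < a \<longrightarrow> excess lam \<alpha> - excess d \<alpha> > s / 2"
    by (rule dominates_eventually[OF pos s])
  obtain b where b: "b > 0"
    "\<forall>\<alpha>. 0 < \<alpha> \<and> \<alpha> < b \<longrightarrow> excess (\<lambda>k. - lam k) \<alpha> - excess (\<lambda>k. - d k) \<alpha> > s / 2"
    by (rule dominates_eventually[OF neg s])
  \<comment> \<open>At levels below \<open>2 * \<eta>\<close> both gaps exceed \<open>s / 2\<close>,
    hence \<open>2 * \<eta>\<close>, which pays for the shifts.\<close>
  define \<eta> where "\<eta> = min (min a b / 2) (s / 4)"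
  have \<eta>: "\<eta> > 0" "2 * \<eta> \<le> a" "2 * \<eta> \<le> b" "2 * \<eta> \<le> s / 2" using a(1) b(1) s by (auto simp: \<eta>_def)
  define w where "w n = \<eta> * (1 / 3) ^ n" for n :: nat
  have w: "w n > 0" for n using \<eta>(1) by (simp add: w_def)
  \<comment> \<open>Even indices receive the upward shifts and odd ones the downward shifts.
    \<open>j1 n\<close> and \<open>j2 n\<close> are shifted by the same amount, so the pair keeps
    its sum.\<close>
  obtain j1 where j1: "inj j1" "range j1 \<subseteq> {k. even k}" "\<forall>n. \<bar>d (j1 n)\<bar> \<le> w n / 3"
    "\<forall>k\<in>{k. even k}. d k = 0 \<longrightarrow> k \<in> range j1"
    by (rule sparse_enumeration[OF d infinite_even, of "\<lambda>n. w n / 3"]) (use w in auto)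
  obtain j2 where j2: "inj j2" "range j2 \<subseteq> {k. odd k}" "\<forall>n. \<bar>d (j2 n)\<bar> \<le> w n / 3"
    "\<forall>k\<in>{k. odd k}. d k = 0 \<longrightarrow> k \<in> range j2"
    by (rule sparse_enumeration[OF d infinite_odd, of "\<lambda>n. w n / 3"]) (use w in auto)
  have disj: "j1 m \<noteq> j2 n" "j2 n \<noteq> j1 m" for m n using j1(2) j2(2) by (metis mem_Collect_eq range_subsetD)+
  have disj': "j1 m \<notin> range j2" "j2 m \<notin> range j1" for m using disj by auto
  \<comment> \<open>The two shifts are made one after the other, the downward one as an upward shift
    of the negated sequence.\<close>
  define d1 where "d1 k = (if k \<in> range j1 then d k + w (inv j1 k) else d k)" for k
  define d' where "d' k = (if k \<in> range j2 then d k - w (inv j2 k) else d1 k)" for k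
  have d1_j1: "d1 (j1 n) = d (j1 n) + w n" and d1_out: "k \<notin> range j1 \<Longrightarrow> d1 k = d k" for n k
    using j1(1) by (auto simp: d1_def)
  have d'_j1: "d' (j1 n) = d (j1 n) + w n" and d'_j2: "d' (j2 n) = d (j2 n) - w n"
    and d'_out: "k \<notin> range j2 \<Longrightarrow> d' k = d1 k" for n k
    using j2(1) disj' d1_j1 by (auto simp: d'_def)
  have d1_j2: "d1 (j2 n) = d (j2 n)" for n using d1_out disj' by simp
  obtain t u where s1: "d1 \<longlonglongrightarrow> 0"
    "\<forall>\<alpha>>0. excess d1 \<alpha> - excess d \<alpha> \<le> 2 * \<eta>"
    "\<forall>\<alpha>\<ge>2 * \<eta>. excess d1 \<alpha> \<le> excess d \<alpha>"
    "\<forall>\<alpha>>0. excess (\<lambda>k. - d1 k) \<alpha> \<le> excess (\<lambda>k. - d k) \<alpha>"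
    "((\<lambda>\<alpha>. excess d1 \<alpha> - excess d \<alpha>) \<longlongrightarrow> t) (at_right 0)"
    "((\<lambda>\<alpha>. excess (\<lambda>k. - d1 k) \<alpha> - excess (\<lambda>k. - d k) \<alpha>) \<longlongrightarrow> u) (at_right 0)"
    "t \<le> 2 * \<eta>" "u \<le> 0" "t - u = \<eta> * (3 / 2)"
    by (rule excess_shift_up[OF d j1(1) \<eta>(1), of d1]) (use j1(3) d1_j1 d1_out w_def in auto)
  have nd1: "(\<lambda>k. - d1 k) \<longlonglongrightarrow> 0" using tendsto_minus[OF s1(1)] by simp
  obtain t' u' where s2: "(\<lambda>k. - d' k) \<longlonglongrightarrow> 0"
    "\<forall>\<alpha>>0. excess (\<lambda>k. - d' k) \<alpha> - excess (\<lambda>k. - d1 k) \<alpha> \<le> 2 * \<eta>"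
    "\<forall>\<alpha>\<ge>2 * \<eta>. excess (\<lambda>k. - d' k) \<alpha> \<le> excess (\<lambda>k. - d1 k) \<alpha>"
    "\<forall>\<alpha>>0. excess (\<lambda>k. - (- d' k)) \<alpha> \<le> excess (\<lambda>k. - (- d1 k)) \<alpha>"
    "((\<lambda>\<alpha>. excess (\<lambda>k. - d' k) \<alpha> - excess (\<lambda>k. - d1 k) \<alpha>) \<longlongrightarrow> t') (at_right 0)"
    "((\<lambda>\<alpha>. excess (\<lambda>k. - (- d' k)) \<alpha> - excess (\<lambda>k. - (- d1 k)) \<alpha>) \<longlongrightarrow> u') (at_right 0)"
    "t' \<le> 2 * \<eta>" "u' \<le> 0" "t' - u' = \<eta> * (3 / 2)"
    by (rule excess_shift_up[OF nd1 j2(1) \<eta>(1), of "\<lambda>k. - d' k"])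
      (use j2(3) d1_j2 d'_j2 d'_out w_def in auto)
  note s2' = s2(4,6)[unfolded minus_minus]
  have d': "d' \<longlonglongrightarrow> 0" using tendsto_minus[OF s2(1)] by simp
  have lim_pos: "((\<lambda>\<alpha>. excess d' \<alpha> - excess d \<alpha>) \<longlongrightarrow> t + u') (at_right 0)"
    using tendsto_add[OF s1(5) s2'(2)] by simp
  have lim_neg: "((\<lambda>\<alpha>. excess (\<lambda>k. - d' k) \<alpha> - excess (\<lambda>k. - d k) \<alpha>) \<longlongrightarrow> t + u') (at_right 0)"
  proof -
    \<comment> \<open>Both shifts have the same total, so the limits inferior on the two sides stay
      equal.\<close>
    have "u + t' = t + u'" using s1(9) s2(9) by linarith
    then show ?thesis using tendsto_add[OF s1(6) s2(5)] by simp
  qed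
  have "dominates lam d' (s - (t + u'))"
  proof (rule dominates_perturb_target[OF pos lim_pos])
    show "2 * \<eta> \<le> excess lam \<alpha> - excess d \<alpha>" if "0 < \<alpha>" "\<alpha> < 2 * \<eta>" for \<alpha>
      using a(2)[rule_format, of \<alpha>] that \<eta>(2,4) by simp
    show "excess d' \<alpha> - excess d \<alpha> \<le> 2 * \<eta>" if "\<alpha> > 0" for \<alpha>
      using s1(2)[rule_format, OF that] s2'(1)[rule_format, OF that] by linarith
    show "excess d' \<alpha> \<le> excess d \<alpha>" if "\<alpha> > 0" "\<alpha> \<ge> 2 * \<eta>" for \<alpha>
      using s1(3)[rule_format, OF that(2)] s2'(1)[rule_format, OF that(1)] by linarith
  qed
  moreover have "dominates (\<lambda>k. - lam k) (\<lambda>k. - d' k) (s - (t + u'))"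
  proof (rule dominates_perturb_target[OF neg lim_neg])
    show "2 * \<eta> \<le> excess (\<lambda>k. - lam k) \<alpha> - excess (\<lambda>k. - d k) \<alpha>" if "0 < \<alpha>" "\<alpha> < 2 * \<eta>" for \<alpha>
      using b(2)[rule_format, of \<alpha>] that \<eta>(3,4) by simp
    show "excess (\<lambda>k. - d' k) \<alpha> - excess (\<lambda>k. - d k) \<alpha> \<le> 2 * \<eta>" if "\<alpha> > 0" for \<alpha>
      using s1(4)[rule_format, OF that] s2(2)[rule_format, OF that] by linarith
    show "excess (\<lambda>k. - d' k) \<alpha> \<le> excess (\<lambda>k. - d k) \<alpha>" if "\<alpha> > 0" "\<alpha> \<ge> 2 * \<eta>" for \<alpha>
      using s1(4)[rule_format, OF that(1)] s2(3)[rule_format, OF that(2)] by linarith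
  qed
  moreover have "s - (t + u') > 0" using s1(7) s2(8) \<eta>(4) s by linarith
  moreover have pos1: "d' (j1 n) > 0" and neg2: "d' (j2 n) < 0" for n
    using j1(3)[rule_format, of n] j2(3)[rule_format, of n] w[of n] unfolding d'_j1 d'_j2 abs_le_iff
    by linarith+
  have inf: "infinite (range j1)" "infinite (range j2)" using j1(1) j2(1) by (simp_all add: range_inj_infinite)
  have "infinite {k. d' k > 0}" using inf(1) by (rule infinite_super[rotated]) (use pos1 in auto)
  moreover have "infinite {k. d' k < 0}" using inf(2) by (rule infinite_super[rotated]) (use neg2 in auto)
  moreover have "\<forall>k. d' k \<noteq> 0"
  proof
    fix k
    show "d' k \<noteq> 0"
    proof (cases "k \<in> range j1 \<or> k \<in> range j2")
      case True
      then show ?thesis using pos1 neg2 by (auto simp: less_le)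
    next
      case False
      then show ?thesis using d'_out[of k] d1_out[of k] j1(4)[rule_format, of k] j2(4)[rule_format, of k]
        by (cases "even k") auto
    qed
  qed
  moreover have "is_diagonal E d" if E: "self_adjoint E" and diag: "is_diagonal E d'" for E :: "'a \<Rightarrow> 'a"
  proof (rule diagonal_blocks[OF diag, of "\<lambda>n. {j1 n, j2 n}"])
    show "movable E {j1 n, j2 n} d' d" for n
    proof (rule movable_pair[OF E])
      show "d (j1 n) + d (j2 n) = d' (j1 n) + d' (j2 n)" by (simp add: d'_j1 d'_j2)
      show "d (j1 n) \<le> d' (j1 n)" using w[of n] by (simp add: d'_j1)
      show "d' (j2 n) \<le> d (j1 n)"
        using j1(3)[rule_format, of n] j2(3)[rule_format, of n] w[of n] unfolding d'_j2 abs_le_iff by linarith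
    qed (rule disj)
    show "{j1 m, j2 m} \<inter> {j1 n, j2 n} = {}" if "m \<noteq> n" for m n
      using that disj j1(1) j2(1) by (auto simp: inj_eq)
    show "d k = d' k" if "k \<notin> (\<Union>n. {j1 n, j2 n})" for k
    proof -
      have "k \<notin> range j1" "k \<notin> range j2" using that by auto
      then show ?thesis using d'_out[of k] d1_out[of k] by simp
    qed
  qed
  ultimately show ?thesis using d' that[of d' "s - (t + u')"] by blast
qed

section \<open>Cutting into blocks\<close>

text \<open>At the cuts \<open>k n\<close> and \<open>l n\<close> the two excesses are to be lowered to the common value \<open>X n\<close>.
  As both have limit inferior \<open>\<sigma>\<close>, taking \<open>X n\<close> slightly below \<open>\<sigma>\<close> keeps the amounts to be moved
  positive, smaller than the later slack, and smaller than the entries they are taken from.\<close>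

lemma cut_points:
  fixes a b s t :: "nat \<Rightarrow> real"
  assumes a: "\<And>n. a n > 0" "a \<longlonglongrightarrow> 0" and b: "\<And>n. b n > 0" "b \<longlonglongrightarrow> 0"
    and s: "\<And>\<epsilon>. \<epsilon> > 0 \<Longrightarrow> \<forall>\<^sub>F k in sequentially. s k > \<sigma> - \<epsilon>"
      "\<And>\<epsilon>. \<epsilon> > 0 \<Longrightarrow> \<exists>\<^sub>F k in sequentially. s k < \<sigma> + \<epsilon>"
    and t: "\<And>\<epsilon>. \<epsilon> > 0 \<Longrightarrow> \<forall>\<^sub>F k in sequentially. t k > \<sigma> - \<epsilon>"
      "\<And>\<epsilon>. \<epsilon> > 0 \<Longrightarrow> \<exists>\<^sub>F k in sequentially. t k < \<sigma> + \<epsilon>"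
    and \<sigma>: "\<sigma> > 0"
  obtains k l :: "nat \<Rightarrow> nat" and X :: "nat \<Rightarrow> real" where
    "X 0 = 0" "\<forall>n. X n \<le> X (Suc n)"
    "\<forall>n. Suc (Suc (k n)) \<le> k (Suc n)" "\<forall>n. Suc (Suc (l n)) \<le> l (Suc n)"
    "\<forall>n. X (Suc n) \<le> s (k (Suc n))" "\<forall>n. X (Suc n) \<le> t (l (Suc n))"
    "\<forall>n. s (k (Suc n)) - X (Suc n) \<le> a (Suc (k n)) - a (k (Suc n))"
    "\<forall>n. t (l (Suc n)) - X (Suc n) \<le> b (Suc (l n)) - b (l (Suc n))"
    "\<forall>n m. k n \<le> m \<longrightarrow> s (k (Suc n)) - X (Suc n) + X n \<le> s m"
    "\<forall>n m. l n \<le> m \<longrightarrow> t (l (Suc n)) - X (Suc n) + X n \<le> t m"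
proof -
  \<comment> \<open>Invariant: from the cuts on, both sums exceed \<open>X\<close> by at least a
    fixed slack \<open>r\<close>.\<close>
  define ok where "ok = (\<lambda>(k, l, X). \<exists>r>0. (\<forall>m\<ge>k. X + r \<le> s m) \<and> (\<forall>m\<ge>l. X + r \<le> t m))"
  define next_ok where "next_ok = (\<lambda>(k, l, X) (k', l', X').
    X \<le> X' \<and> Suc (Suc k) \<le> k' \<and> Suc (Suc l) \<le> l' \<and> X' \<le> s k' \<and> X' \<le> t l' \<and>
    s k' - X' \<le> a (Suc k) - a k' \<and> t l' - X' \<le> b (Suc l) - b l' \<and>
    (\<forall>m\<ge>k. s k' - X' + X \<le> s m) \<and> (\<forall>m\<ge>l. t l' - X' + X \<le> t m))"
  have tail: "\<exists>k'\<ge>Suc (Suc k). (\<forall>m\<ge>k'. u m > \<sigma> - \<eta> / 3) \<and> u k' < \<sigma> + \<eta> / 3 \<and> c k' \<le> \<eta>"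
    if u: "\<And>\<epsilon>. \<epsilon> > 0 \<Longrightarrow> \<forall>\<^sub>F k in sequentially. u k > \<sigma> - \<epsilon>"
      "\<And>\<epsilon>. \<epsilon> > 0 \<Longrightarrow> \<exists>\<^sub>F k in sequentially. u k < \<sigma> + \<epsilon>"
      and c: "c \<longlonglongrightarrow> 0" and \<eta>: "\<eta> > 0"
    for u c :: "nat \<Rightarrow> real" and \<eta> k
  proof -
    have "\<forall>\<^sub>F k in sequentially. \<forall>m\<ge>k. u m > \<sigma> - \<eta> / 3"
      using eventually_all_ge_at_top[OF u(1)[of "\<eta> / 3"]] \<eta> by simp
    moreover have "\<forall>\<^sub>F k in sequentially. c k < \<eta>" using c \<eta> by (rule order_tendstoD(2))
    moreover have "\<forall>\<^sub>F k' in sequentially. Suc (Suc k) \<le> k'" by (rule eventually_ge_at_top)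
    ultimately have ev: "\<forall>\<^sub>F k' in sequentially. (\<forall>m\<ge>k'. u m > \<sigma> - \<eta> / 3) \<and> c k' \<le> \<eta> \<and> Suc (Suc k) \<le> k'"
      by eventually_elim auto
    have "\<exists>\<^sub>F k in sequentially. u k < \<sigma> + \<eta> / 3" using u(2)[of "\<eta> / 3"] \<eta> by simp
    from frequently_ex[OF frequently_eventually_conj[OF this ev]] show ?thesis by blast
  qed
  obtain f where f: "\<forall>n. ok (f n) \<and> next_ok (f n) (f (Suc n)) \<and> (n = 0 \<longrightarrow> snd (snd (f n)) = 0)"
  proof -
    have init: "\<exists>x. ok x \<and> (0 = (0::nat) \<longrightarrow> snd (snd x) = 0)"
    proof -
      obtain K where K: "\<forall>m\<ge>K. s m > \<sigma> - \<sigma> / 2"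
        using s(1)[of "\<sigma> / 2"] \<sigma> unfolding eventually_sequentially by auto
      obtain L where L: "\<forall>m\<ge>L. t m > \<sigma> - \<sigma> / 2"
        using t(1)[of "\<sigma> / 2"] \<sigma> unfolding eventually_sequentially by auto
      have "\<sigma> / 2 \<le> s m" if "m \<ge> K" for m using K that by force
      moreover have "\<sigma> / 2 \<le> t m" if "m \<ge> L" for m using L that by force
      ultimately have "ok (K, L, 0)"
        unfolding ok_def using \<sigma> by (auto intro!: exI[of _ "\<sigma> / 2"])
      then show ?thesis by (intro exI[of _ "(K, L, 0)"]) simp
    qed
    have step: "\<exists>y. (ok y \<and> (Suc n = 0 \<longrightarrow> snd (snd y) = 0)) \<and> next_ok x y"
      if okx: "ok x \<and> (n = 0 \<longrightarrow> snd (snd x) = 0)" for x n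
    proof -
      obtain k l X where x: "x = (k, l, X)" by (cases x) auto
      obtain r where r: "r > 0" "\<forall>m\<ge>k. X + r \<le> s m" "\<forall>m\<ge>l. X + r \<le> t m"
        using okx unfolding x ok_def by auto
      \<comment> \<open>The amounts to be moved will be less than \<eta>. The bound by
        \<open>r\<close> fits them into the slack; the halves ensure
        \<open>a (Suc k) - a k' \<ge> \<eta>\<close> once \<open>a k' \<le> \<eta>\<close>, and
        likewise for \<open>b\<close>.\<close>
      define \<eta> where "\<eta> = min r (min (a (Suc k) / 2) (b (Suc l) / 2))"
      have "\<eta> > 0" "\<eta> \<le> r" "\<eta> \<le> a (Suc k) / 2" "\<eta> \<le> b (Suc l) / 2"
        using r(1) a(1) b(1) by (auto simp: \<eta>_def)
      then have \<eta>: "\<eta> > 0" "\<eta> \<le> r" "2 * \<eta> \<le> a (Suc k)" "2 * \<eta> \<le> b (Suc l)" by auto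
      obtain k' where k': "k' \<ge> Suc (Suc k)" "\<forall>m\<ge>k'. s m > \<sigma> - \<eta> / 3" "s k' < \<sigma> + \<eta> / 3" "a k' \<le> \<eta>"
        using tail[OF s a(2) \<eta>(1), of k] by blast
      obtain l' where l': "l' \<ge> Suc (Suc l)" "\<forall>m\<ge>l'. t m > \<sigma> - \<eta> / 3" "t l' < \<sigma> + \<eta> / 3" "b l' \<le> \<eta>"
        using tail[OF t b(2) \<eta>(1), of l] by blast
      \<comment> \<open>From the new cuts on the sums exceed
        \<open>\<sigma> - \<eta> / 3 = X' + \<eta> / 3\<close>, which is the slack for the next
        step; at the cuts they are below \<open>\<sigma> + \<eta> / 3 = X' + \<eta>\<close>.\<close>
      define X' where "X' = \<sigma> - 2 * (\<eta> / 3)"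
      have mX: "X + \<eta> \<le> s m" if "m \<ge> k" for m using r(2)[rule_format, OF that] \<eta>(2) by linarith
      have mX': "X + \<eta> \<le> t m" if "m \<ge> l" for m using r(3)[rule_format, OF that] \<eta>(2) by linarith
      have s1: "s m \<ge> X' + \<eta> / 3" if "m \<ge> k'" for m using k'(2)[rule_format, OF that] by (simp add: X'_def)
      have t1: "t m \<ge> X' + \<eta> / 3" if "m \<ge> l'" for m using l'(2)[rule_format, OF that] by (simp add: X'_def)
      have y: "s k' - X' < \<eta>" "t l' - X' < \<eta>" using k'(3) l'(3) by (simp_all add: X'_def)
      have "X \<le> X'" using mX[of k'] k'(1) y(1) by simp
      moreover have "X' \<le> s k'" "X' \<le> t l'" using s1[of k'] t1[of l'] \<eta>(1) by auto
      moreover have "s k' - X' \<le> a (Suc k) - a k'" "t l' - X' \<le> b (Suc l) - b l'"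
        using y \<eta>(3,4) k'(4) l'(4) by linarith+
      moreover have "s k' - X' + X \<le> s m" if "m \<ge> k" for m using mX[OF that] y(1) by linarith
      moreover have "t l' - X' + X \<le> t m" if "m \<ge> l" for m using mX'[OF that] y(2) by linarith
      ultimately have "next_ok x (k', l', X')" unfolding x next_ok_def using k'(1) l'(1) by auto
      moreover have "ok (k', l', X')"
        unfolding ok_def using s1 t1 \<eta>(1) by (auto intro!: exI[of _ "\<eta> / 3"])
      ultimately show ?thesis by blast
    qed
    have "\<exists>f. \<forall>n. (ok (f n) \<and> (n = 0 \<longrightarrow> snd (snd (f n)) = 0)) \<and> next_ok (f n) (f (Suc n))"
      by (rule dependent_nat_choice[OF init step])
    then show ?thesis using that by blast
  qed
  have nx: "next_ok (f n) (f (Suc n))" "snd (snd (f 0)) = 0" for n using f by auto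
  show ?thesis
    by (rule that[of "\<lambda>n. snd (snd (f n))" "\<lambda>n. fst (f n)" "\<lambda>n. fst (snd (f n))"])
      (use nx[unfolded next_ok_def case_prod_unfold] in auto)
qed

lemma interval_partition:
  fixes K :: "nat \<Rightarrow> nat"
  assumes "strict_mono K" "K 0 \<le> m"
  shows "\<exists>n. K n \<le> m \<and> m < K (Suc n)"
proof -
  have ex: "\<exists>n. m < K (Suc n)"
    using strict_mono_imp_increasing[OF assms(1), of "Suc m"] by (auto intro!: exI[of _ m])
  define n where "n = (LEAST n. m < K (Suc n))"
  have n: "m < K (Suc n)" "\<And>i. m < K (Suc i) \<Longrightarrow> n \<le> i"
    unfolding n_def by (rule LeastI_ex[OF ex], rule Least_le)
  have "K n \<le> m"
  proof (cases n)
    case 0 then show ?thesis using assms(2) by simp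
  next
    case (Suc i) then show ?thesis using n(2)[of i] by fastforce
  qed
  then show ?thesis using n(1) by blast
qed

text \<open>The amount that the partial sums up to \<open>m\<close> lose when, for every \<open>n\<close>, the mass \<open>y n\<close> is moved
  from the entry \<open>Suc (k n)\<close> to the entry \<open>k (Suc n)\<close>.\<close>

definition bump :: "(nat \<Rightarrow> nat) \<Rightarrow> (nat \<Rightarrow> real) \<Rightarrow> nat \<Rightarrow> real" where
  "bump k y m = (if \<exists>n. Suc (k n) < m \<and> m \<le> k (Suc n)
     then y (THE n. Suc (k n) < m \<and> m \<le> k (Suc n)) else 0)"

section \<open>Moving mass between consecutive cuts\<close>

context
  fixes k :: "nat \<Rightarrow> nat"
  assumes k_step: "\<And>n. Suc (Suc (k n)) \<le> k (Suc n)"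
begin

lemma cuts_mono: "m \<le> n \<Longrightarrow> k m \<le> k n"
  by (rule lift_Suc_mono_le[of k]) (use k_step le_trans le_SucI in \<open>meson Suc_leD\<close>)

lemma cuts_less: "m < n \<Longrightarrow> Suc (k m) < k n"
  using cuts_mono[of "Suc m" n] k_step[of m] by simp

lemma cuts_strict_mono: "strict_mono k"
  using cuts_less by (intro strict_monoI) (meson Suc_lessD)

text \<open>A partial sum up to \<open>m\<close> runs over \<open>i < m\<close>: it contains the
  source \<open>Suc (k n)\<close> from \<open>m = Suc (Suc (k n))\<close> on and the target
  \<open>k (Suc n)\<close> from \<open>m = Suc (k (Suc n))\<close> on. In between the moved mass is
  missing.\<close>

lemma bump_inside: "Suc (k n) < m \<Longrightarrow> m \<le> k (Suc n) \<Longrightarrow> bump k y m = y n"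
proof -
  assume m: "Suc (k n) < m" "m \<le> k (Suc n)"
  have "(THE n. Suc (k n) < m \<and> m \<le> k (Suc n)) = n"
  proof (rule the_equality)
    fix n' assume "Suc (k n') < m \<and> m \<le> k (Suc n')"
    then show "n' = n"
      using m cuts_mono[of "Suc n" n'] cuts_mono[of "Suc n'" n] by (cases n' n rule: linorder_cases) auto
  qed (use m in auto)
  then show ?thesis using m by (auto simp: bump_def)
qed

lemma bump_before: "m \<le> Suc (k 0) \<Longrightarrow> bump k y m = 0"
proof -
  assume m: "m \<le> Suc (k 0)"
  have "\<not> Suc (k n) < m" for n using m cuts_mono[of 0 n] by simp
  then show ?thesis by (simp add: bump_def)
qed

lemma bump_after_cut: "bump k y (Suc (k n)) = 0"
proof -
  have "\<not> (Suc (k n') < Suc (k n) \<and> Suc (k n) \<le> k (Suc n'))" for n'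
    using cuts_mono[of "Suc n'" n] cuts_mono[of n n'] by (cases "n' < n") auto
  then show ?thesis by (auto simp: bump_def)
qed

lemma bump_cut: "bump k y (k (Suc n)) = y n"
  using bump_inside[of n "k (Suc n)" y] k_step[of n] by simp

lemma bump_cases:
  obtains "m \<le> Suc (k 0)" | n where "m = Suc (k n)" | n where "Suc (k n) < m" "m \<le> k (Suc n)"
proof (cases "m \<le> k 0")
  case False
  then obtain m' where m': "m = Suc m'" "k 0 \<le> m'" by (cases m) auto
  obtain n where "k n \<le> m'" "m' < k (Suc n)"
    using interval_partition[OF cuts_strict_mono m'(2)] by blast
  then show ?thesis using that(2)[of n] that(3)[of n] m'(1) by (cases "k n = m'") auto
qed (use that in auto)


text \<open>Subtracting the increments of \<open>bump\<close> takes \<open>y n\<close> from the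
  source, gives it to the target and changes nothing else. The spacing of the cuts makes these pairs
  disjoint, and the upper bound on \<open>y n\<close> makes each of them a single rotation.\<close>

lemma diagonal_bump:
  fixes lam mu :: "'i \<Rightarrow> real" and f :: "nat \<Rightarrow> 'i"
  assumes E: "self_adjoint E" and diag: "is_diagonal E lam" and f: "inj f"
    and y: "\<And>n. 0 \<le> y n" "\<And>n. y n \<le> lam (f (Suc (k n))) - lam (f (k (Suc n)))"
    and mu: "\<And>m. mu (f m) = lam (f m) - (bump k y (Suc m) - bump k y m)"
    and out: "\<And>i. i \<notin> range f \<Longrightarrow> mu i = lam i"
  shows "is_diagonal E mu"
proof (rule diagonal_blocks[OF diag, of "\<lambda>n. {f (Suc (k n)), f (k (Suc n))}"])
  have val1: "mu (f (Suc (k n))) = lam (f (Suc (k n))) - y n" for n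
    using bump_after_cut[of y n] bump_inside[of n "Suc (Suc (k n))" y] k_step[of n] by (simp add: mu)
  have val2: "mu (f (k (Suc n))) = lam (f (k (Suc n))) + y n" for n
    using bump_after_cut[of y "Suc n"] bump_cut[of y n] by (simp add: mu)
  show "movable E {f (Suc (k n)), f (k (Suc n))} lam mu" for n
  proof (rule movable_pair[OF E])
    show "f (Suc (k n)) \<noteq> f (k (Suc n))" using k_step[of n] f by (auto simp: inj_eq)
  qed (use val1[of n] val2[of n] y[of n] in auto)
  show "{f (Suc (k m)), f (k (Suc m))} \<inter> {f (Suc (k n)), f (k (Suc n))} = {}" if "m \<noteq> n" for m n
  proof -
    have *: "{f (Suc (k m)), f (k (Suc m))} \<inter> {f (Suc (k n)), f (k (Suc n))} = {}" if "m < n" for m n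
      using cuts_mono[of "Suc m" n] k_step[of n] k_step[of m] that f by (auto simp: inj_eq)
    show ?thesis using *[of m n] *[of n m] that by (cases m n rule: linorder_cases) auto
  qed
  fix i assume i: "i \<notin> (\<Union>n. {f (Suc (k n)), f (k (Suc n))})"
  show "mu i = lam i"
  proof (cases "i \<in> range f")
    case True
    then obtain m where m: "i = f m" by blast
    have m1: "m \<noteq> Suc (k n)" "m \<noteq> k (Suc n)" for n using i m by auto
    have "bump k y (Suc m) = bump k y m"
    proof (cases rule: bump_cases[of m])
      case 1
      then have "m \<le> k 0" using m1(1)[of 0] by simp
      then show ?thesis using bump_before[of m y] bump_before[of "Suc m" y] by simp
    next
      case (2 n)
      then show ?thesis using m1 by blast
    next
      case (3 n)
      then have "Suc m \<le> k (Suc n)" using m1(2)[of n] by simp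
      then show ?thesis using 3 bump_inside[of n m y] bump_inside[of n "Suc m" y] by simp
    qed
    then show ?thesis by (simp add: m mu)
  qed (use out in auto)
qed

end

section \<open>Balanced blocks with entries of both signs\<close>

text \<open>Since \<open>c\<close> decreases, its entries above \<alpha> form an initial segment of
  the interval, and the comparison of the sums over that segment suffices.\<close>

lemma sum_positive_part_le:
  fixes a c :: "nat \<Rightarrow> real"
  assumes "decseq c" and "\<And>m. p \<le> m \<Longrightarrow> m \<le> q \<Longrightarrow> sum c {p..<m} \<le> sum a {p..<m}"
  shows "(\<Sum>i\<in>{p..<q}. max 0 (c i - \<alpha>)) \<le> (\<Sum>i\<in>{p..<q}. max 0 (a i - \<alpha>))"
proof (cases "p \<le> q")
  case True
  define A where "A = {i \<in> {p..<q}. \<alpha> < c i}"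
  have fin: "finite A" by (simp add: A_def)
  have down: "j \<in> A" if "i \<in> A" "p \<le> j" "j \<le> i" for i j
    using that decseqD[OF assms(1), of j i] by (auto simp: A_def)
  obtain m where m: "p \<le> m" "m \<le> q" "A = {p..<m}"
  proof (cases "A = {}")
    case t: True then show ?thesis using that[of p] True by simp
  next
    case False
    then have M: "Max A \<in> A" "\<And>i. i \<in> A \<Longrightarrow> i \<le> Max A" using fin by auto
    have sub: "p \<le> x" "x < q" if "x \<in> A" for x using that by (auto simp: A_def)
    have "x \<in> A \<longleftrightarrow> x \<in> {p..<Suc (Max A)}" for x
      using down[OF M(1), of x] M(2)[of x] sub(1)[of x] by auto
    then have "A = {p..<Suc (Max A)}" by blast
    moreover have "p \<le> Suc (Max A)" "Suc (Max A) \<le> q" using sub[OF M(1)] by auto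
    ultimately show ?thesis using that by blast
  qed
  have "(\<Sum>i\<in>{p..<q}. max 0 (c i - \<alpha>)) = (\<Sum>i\<in>{p..<m}. c i - \<alpha>)"
    unfolding m(3)[symmetric] by (rule sum.mono_neutral_cong_right) (auto simp: A_def)
  also have "\<dots> \<le> (\<Sum>i\<in>{p..<m}. a i - \<alpha>)"
    using assms(2)[OF m(1,2)] by (simp add: sum_subtractf)
  also have "\<dots> \<le> (\<Sum>i\<in>{p..<m}. max 0 (a i - \<alpha>))" by (intro sum_mono) auto
  also have "\<dots> \<le> (\<Sum>i\<in>{p..<q}. max 0 (a i - \<alpha>))"
    using m(2) by (intro sum_mono2) auto
  finally show ?thesis .
qed simp

text \<open>For \<open>\<alpha> \<ge> 0\<close> the target contributes only through
  \<open>c\<close>, which is compared with \<open>a\<close>. For \<open>\<alpha> < 0\<close>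
  negation reduces the claim to comparing \<open>e\<close> with \<open>b\<close>; this uses equal
  totals, which is what \<open>bal\<close> expresses.\<close>

lemma movable_two_sided:
  fixes a b c e :: "nat \<Rightarrow> real"
  assumes E: "self_adjoint E" and c: "decseq c" "\<And>n. 0 \<le> c n" and e: "decseq e" "\<And>n. 0 \<le> e n"
    and ac: "\<And>m. p \<le> m \<Longrightarrow> m \<le> q \<Longrightarrow> sum c {p..<m} \<le> sum a {p..<m}"
    and be: "\<And>m. r \<le> m \<Longrightarrow> m \<le> t \<Longrightarrow> sum e {r..<m} \<le> sum b {r..<m}"
    and bal: "sum a {p..<q} - sum c {p..<q} = sum b {r..<t} - sum e {r..<t}"
  shows "movable E (Inl ` {p..<q} \<union> Inr ` {r..<t}) (case_sum a (\<lambda>n. - b n)) (case_sum c (\<lambda>n. - e n))"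
    (is "movable E ?S ?lam ?d")
proof (rule movable_majorized[OF E])
  have split: "(\<Sum>i\<in>?S. g (case_sum u v i)) = (\<Sum>i\<in>{p..<q}. g (u i)) + (\<Sum>i\<in>{r..<t}. g (v i))"
    for g :: "real \<Rightarrow> real" and u v :: "nat \<Rightarrow> real"
    by (subst sum.union_disjoint) (auto simp: sum.reindex)
  have ac': "(\<Sum>i\<in>{p..<q}. max 0 (c i - \<alpha>)) \<le> (\<Sum>i\<in>{p..<q}. max 0 (a i - \<alpha>))" for \<alpha>
    using c(1) ac by (rule sum_positive_part_le)
  have be': "(\<Sum>i\<in>{r..<t}. max 0 (e i - \<alpha>)) \<le> (\<Sum>i\<in>{r..<t}. max 0 (b i - \<alpha>))" for \<alpha>
    using e(1) be by (rule sum_positive_part_le)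
  show eq: "sum ?d ?S = sum ?lam ?S"
    using split[of "\<lambda>x. x"] bal by (simp add: sum_negf)
  show "finite ?S" by simp
  fix \<alpha> :: real
  show "(\<Sum>i\<in>?S. max 0 (?d i - \<alpha>)) \<le> (\<Sum>i\<in>?S. max 0 (?lam i - \<alpha>))"
  proof (cases "\<alpha> \<ge> 0")
    case True
    have "max 0 (- e i - \<alpha>) = 0" for i using e(2)[of i] True by simp
    then have "(\<Sum>i\<in>{r..<t}. max 0 (- e i - \<alpha>)) = 0" by simp
    moreover have "0 \<le> (\<Sum>i\<in>{r..<t}. max 0 (- b i - \<alpha>))" by (rule sum_nonneg) auto
    ultimately show ?thesis
      using ac'[of \<alpha>] unfolding split[of "\<lambda>x. max 0 (x - \<alpha>)"] by linarith
  next
    case False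
    \<comment> \<open>Because \<open>max 0 v = max 0 (- v) + v\<close>, equal totals turn the
      inequality at \<alpha> into that for the negated entries at \<open>- \<alpha>\<close>.\<close>
    have swap: "(\<Sum>i\<in>?S. max 0 (u i - \<alpha>)) = (\<Sum>i\<in>?S. max 0 (- u i - (- \<alpha>))) + sum u ?S - real (card ?S) * \<alpha>"
      for u :: "nat + nat \<Rightarrow> real"
    proof -
      have "max 0 (u i - \<alpha>) = max 0 (- u i - (- \<alpha>)) + (u i - \<alpha>)" for i by (simp add: max_def)
      then have "(\<Sum>i\<in>?S. max 0 (u i - \<alpha>)) = (\<Sum>i\<in>?S. max 0 (- u i - (- \<alpha>)) + (u i - \<alpha>))"
        by (intro sum.cong) auto
      also have "\<dots> = (\<Sum>i\<in>?S. max 0 (- u i - (- \<alpha>))) + (\<Sum>i\<in>?S. u i - \<alpha>)"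
        by (rule sum.distrib)
      also have "(\<Sum>i\<in>?S. u i - \<alpha>) = sum u ?S - real (card ?S) * \<alpha>"
        by (simp only: sum_subtractf sum_constant)
      finally show ?thesis by simp
    qed
    have "max 0 (- c i - (- \<alpha>)) = 0" for i using c(2)[of i] False by simp
    then have "(\<Sum>i\<in>{p..<q}. max 0 (- c i - (- \<alpha>))) = 0" by (simp only: sum.neutral_const)
    moreover have "0 \<le> (\<Sum>i\<in>{p..<q}. max 0 (- a i - (- \<alpha>)))" by (rule sum_nonneg) auto
    moreover have "(\<Sum>i\<in>{r..<t}. max 0 (- (- e i) - (- \<alpha>))) \<le> (\<Sum>i\<in>{r..<t}. max 0 (- (- b i) - (- \<alpha>)))"
      using be'[of "- \<alpha>"] by simp
    ultimately have "(\<Sum>i\<in>?S. max 0 (- ?d i - (- \<alpha>))) \<le> (\<Sum>i\<in>?S. max 0 (- ?lam i - (- \<alpha>)))"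
      unfolding split[of "\<lambda>x. max 0 (- x - (- \<alpha>))"] by linarith
    then show ?thesis unfolding swap using eq by linarith
  qed
qed

text \<open>By telescoping, \<open>bump\<close> is the loss of the partial sums. At a cut it lowers
  them exactly to \<open>X\<close>, and between cuts \<open>low\<close> keeps them above the value
  at the preceding cut. \<open>K\<close> moves the first cut to \<open>0\<close>, where the empty
  sum equals \<open>X 0\<close>.\<close>

lemma bumped_partial_sums:
  fixes a c :: "nat \<Rightarrow> real"
  assumes k: "\<And>n. Suc (Suc (k n)) \<le> k (Suc n)"
    and nonneg: "\<And>m. 0 \<le> (\<Sum>i<m. a i - c i)"
    and X0: "X 0 = 0"
    and y: "\<And>n. 0 \<le> y n" "\<And>n. y n = (\<Sum>i<k (Suc n). a i - c i) - X (Suc n)"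
    and low: "\<And>n m. k n \<le> m \<Longrightarrow> y n + X n \<le> (\<Sum>i<m. a i - c i)"
  defines "K \<equiv> \<lambda>n. if n = 0 then 0 else k n"
    and "a' \<equiv> \<lambda>m. a m - (bump k y (Suc m) - bump k y m)"
  shows "sum a' {K n..<K (Suc n)} - sum c {K n..<K (Suc n)} = X (Suc n) - X n"
    and "K n \<le> m \<Longrightarrow> m \<le> K (Suc n) \<Longrightarrow> sum c {K n..<m} \<le> sum a' {K n..<m}"
proof -
  have S: "(\<Sum>i<m. a' i - c i) = (\<Sum>i<m. a i - c i) - bump k y m" for m
  proof -
    have "(\<Sum>i<m. a' i - c i) = (\<Sum>i<m. a i - c i) - (\<Sum>i<m. bump k y (Suc i) - bump k y i)"
      by (simp add: a'_def sum_subtractf)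
    also have "(\<Sum>i<m. bump k y (Suc i) - bump k y i) = bump k y m - bump k y 0"
      by (rule sum_lessThan_telescope)
    finally show ?thesis using bump_before[where k = k, OF k, of 0 y] by simp
  qed
  have SK: "(\<Sum>i<K n. a' i - c i) = X n" for n
  proof (cases n)
    case (Suc n')
    have "(\<Sum>i<k (Suc n'). a' i - c i) = (\<Sum>i<k (Suc n'). a i - c i) - y n'"
      unfolding S bump_cut[where k = k, OF k] ..
    then show ?thesis using y(2)[of n'] Suc by (simp add: K_def)
  qed (simp add: K_def X0)
  have diff: "sum a' {p..<m} - sum c {p..<m} = (\<Sum>i<m. a' i - c i) - (\<Sum>i<p. a' i - c i)"
    if "p \<le> m" for p m
  proof -
    have "(\<Sum>i<m. a' i - c i) = (\<Sum>i<p. a' i - c i) + (\<Sum>i\<in>{p..<m}. a' i - c i)"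
      using sum.atLeastLessThan_concat[of 0 p m "\<lambda>i. a' i - c i"] that by (simp add: lessThan_atLeast0)
    then show ?thesis by (simp add: sum_subtractf)
  qed
  have KK: "K n \<le> K (Suc n)" using k[of n] by (auto simp: K_def)
  show "sum a' {K n..<K (Suc n)} - sum c {K n..<K (Suc n)} = X (Suc n) - X n"
    using diff[OF KK] SK by simp
  assume m: "K n \<le> m" "m \<le> K (Suc n)"
  have "X n \<le> (\<Sum>i<m. a' i - c i)"
  proof (cases "k n \<le> m")
    case True
    \<comment> \<open>At \<open>m = Suc (k n)\<close> nothing has been taken yet. At
      \<open>m = k n\<close> the sum is \<open>X n\<close> itself, except for \<open>n = 0\<close>,
      where the block started at \<open>0\<close> and \<open>nonneg\<close> is used.\<close>
    consider "Suc (k n) < m" | "m = Suc (k n)" | "m = k n" using True by linarith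
    then show ?thesis
    proof cases
      case 1
      have "bump k y m = y n" using bump_inside[where k = k, OF k 1] m(2) by (simp add: K_def)
      then show ?thesis using low[OF True] by (simp add: S)
    next
      case 2
      then have "bump k y m = 0" using bump_after_cut[where k = k, OF k] by simp
      then show ?thesis using low[OF True] y(1)[of n] by (simp add: S)
    next
      case 3
      show ?thesis
      proof (cases n)
        case 0
        then show ?thesis using 3 bump_before[where k = k, OF k, of m y] nonneg[of m] by (simp add: S X0)
      next
        case (Suc n')
        then show ?thesis using SK[of n] 3 by (simp add: K_def)
      qed
    qed
  next
    case False
    then have "n = 0" using m(1) by (auto simp: K_def split: if_splits)
    then show ?thesis using False bump_before[where k = k, OF k, of m y] nonneg[of m] by (simp add: S X0)
  qed
  then show "sum c {K n..<m} \<le> sum a' {K n..<m}" using diff[OF m(1)] SK[of n] by simp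
qed

text \<open>The cuts \<open>k\<close> and \<open>l\<close> are unrelated; the two sides are tied
  together by the common surplus \<open>X (Suc n) - X n\<close>, which balances the trace of each
  block. \<open>Inl\<close> indexes the positive entries and \<open>Inr\<close> the negative
  ones.\<close>

lemma diagonal_regular:
  fixes a b c e :: "nat \<Rightarrow> real"
  assumes E: "self_adjoint E" and diag: "is_diagonal E (case_sum a (\<lambda>n. - b n))"
    and a: "\<And>n. a n > 0" "a \<longlonglongrightarrow> 0" and b: "\<And>n. b n > 0" "b \<longlonglongrightarrow> 0"
    and c: "decseq c" "\<And>n. 0 \<le> c n" and e: "decseq e" "\<And>n. 0 \<le> e n"
    and s0: "\<And>m. 0 \<le> (\<Sum>i<m. a i - c i)" and t0: "\<And>m. 0 \<le> (\<Sum>i<m. b i - e i)"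
    and s: "\<And>\<epsilon>. \<epsilon> > 0 \<Longrightarrow> \<forall>\<^sub>F k in sequentially. (\<Sum>i<k. a i - c i) > \<sigma> - \<epsilon>"
      "\<And>\<epsilon>. \<epsilon> > 0 \<Longrightarrow> \<exists>\<^sub>F k in sequentially. (\<Sum>i<k. a i - c i) < \<sigma> + \<epsilon>"
    and t: "\<And>\<epsilon>. \<epsilon> > 0 \<Longrightarrow> \<forall>\<^sub>F k in sequentially. (\<Sum>i<k. b i - e i) > \<sigma> - \<epsilon>"
      "\<And>\<epsilon>. \<epsilon> > 0 \<Longrightarrow> \<exists>\<^sub>F k in sequentially. (\<Sum>i<k. b i - e i) < \<sigma> + \<epsilon>"
    and \<sigma>: "\<sigma> > 0"
  shows "is_diagonal E (case_sum c (\<lambda>n. - e n))"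
proof -
  define S T where "S k = (\<Sum>i<k. a i - c i)" and "T k = (\<Sum>i<k. b i - e i)" for k
  obtain k l :: "nat \<Rightarrow> nat" and X :: "nat \<Rightarrow> real" where kl:
    "X 0 = 0" "\<forall>n. X n \<le> X (Suc n)"
    "\<forall>n. Suc (Suc (k n)) \<le> k (Suc n)" "\<forall>n. Suc (Suc (l n)) \<le> l (Suc n)"
    "\<forall>n. X (Suc n) \<le> S (k (Suc n))" "\<forall>n. X (Suc n) \<le> T (l (Suc n))"
    "\<forall>n. S (k (Suc n)) - X (Suc n) \<le> a (Suc (k n)) - a (k (Suc n))"
    "\<forall>n. T (l (Suc n)) - X (Suc n) \<le> b (Suc (l n)) - b (l (Suc n))"
    "\<forall>n m. k n \<le> m \<longrightarrow> S (k (Suc n)) - X (Suc n) + X n \<le> S m"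
    "\<forall>n m. l n \<le> m \<longrightarrow> T (l (Suc n)) - X (Suc n) + X n \<le> T m"
    by (rule cut_points[OF a b s t \<sigma>, folded S_def T_def])
  define y z where "y n = S (k (Suc n)) - X (Suc n)" and "z n = T (l (Suc n)) - X (Suc n)" for n
  define a' b' where "a' m = a m - (bump k y (Suc m) - bump k y m)"
    and "b' m = b m - (bump l z (Suc m) - bump l z m)" for m
  have k_step: "Suc (Suc (k n)) \<le> k (Suc n)" and l_step: "Suc (Suc (l n)) \<le> l (Suc n)" for n
    using kl(3,4) by auto
  have y0: "0 \<le> y n" and z0: "0 \<le> z n" for n using kl(5,6) by (auto simp: y_def z_def)
  have y_le: "y n \<le> a (Suc (k n)) - a (k (Suc n))" and z_le: "z n \<le> b (Suc (l n)) - b (l (Suc n))" for n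
    using kl(7,8) by (auto simp: y_def z_def)
  have diag_a: "is_diagonal E (case_sum a' (\<lambda>n. - b n))"
    by (rule diagonal_bump[where k = k and f = Inl and y = y, OF k_step E diag])
      (use y0 y_le in \<open>auto simp: a'_def split: sum.split intro: injI\<close>)
  \<comment> \<open>Moving modulus from a larger to a smaller negative entry is, for
    \<open>- E\<close>, the same move as on the positive side.\<close>
  have "is_diagonal (\<lambda>x. - E x) (\<lambda>i. - case_sum a' (\<lambda>n. - b' n) i)"
    by (rule diagonal_bump[where k = l and f = Inr and y = z, OF l_step self_adjoint_uminus[OF E] is_diagonal_uminus[OF diag_a]])
      (use z0 z_le in \<open>auto simp: b'_def split: sum.split intro: injI\<close>)
  then have diag': "is_diagonal E (case_sum a' (\<lambda>n. - b' n))"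
    using is_diagonal_uminus by force
  define K L where "K n = (if n = 0 then 0 else k n)" and "L n = (if n = 0 then 0 else l n)" for n
  have lowk: "k n \<le> m \<Longrightarrow> y n + X n \<le> (\<Sum>i<m. a i - c i)" for n m
    using kl(9) by (simp add: y_def S_def)
  have lowl: "l n \<le> m \<Longrightarrow> z n + X n \<le> (\<Sum>i<m. b i - e i)" for n m
    using kl(10) by (simp add: z_def T_def)
  note A = bumped_partial_sums[of k a c X y, OF k_step s0 kl(1) y0 y_def[unfolded S_def] lowk,
      folded K_def a'_def]
  note B = bumped_partial_sums[of l b e X z, OF l_step t0 kl(1) z0 z_def[unfolded T_def] lowl,
      folded L_def b'_def]
  have mono: "strict_mono K" "strict_mono L"
  proof -
    have "0 < k (Suc n)" "k n < k (Suc n)" "0 < l (Suc n)" "l n < l (Suc n)" for n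
      using k_step[of n] l_step[of n] by linarith+
    then show "strict_mono K" "strict_mono L" by (simp_all add: strict_mono_Suc_iff K_def L_def)
  qed
  let ?B = "\<lambda>n. Inl ` {K n..<K (Suc n)} \<union> Inr ` {L n..<L (Suc n)}"
  show ?thesis
  proof (rule diagonal_blocks[OF diag', of ?B])
    show "movable E (?B n) (case_sum a' (\<lambda>n. - b' n)) (case_sum c (\<lambda>n. - e n))" for n
      using A(1)[of n] B(1)[of n] by (intro movable_two_sided[OF E c e A(2) B(2)]) auto
    show "?B m \<inter> ?B n = {}" if "m \<noteq> n" for m n
    proof -
      have *: "{K m..<K (Suc m)} \<inter> {K n..<K (Suc n)} = {}" if "m \<noteq> n" "strict_mono K" for m n and K :: "nat \<Rightarrow> nat"
      proof -
        have "{K m..<K (Suc m)} \<inter> {K n..<K (Suc n)} = {}" if "m < n" for m n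
          using that \<open>strict_mono K\<close> strict_mono_less_eq[of K "Suc m" n] by auto
        then show ?thesis using that(1) by (cases m n rule: linorder_cases) blast+
      qed
      show ?thesis using *[OF that mono(1)] *[OF that mono(2)] by auto
    qed
    fix i :: "nat + nat" assume i: "i \<notin> (\<Union>n. ?B n)"
    have "i \<in> (\<Union>n. ?B n)"
    proof (cases i)
      case (Inl m)
      obtain n where "K n \<le> m" "m < K (Suc n)" using interval_partition[OF mono(1), of m] by (auto simp: K_def)
      then have "Inl m \<in> ?B n" by simp
      then show ?thesis unfolding Inl by blast
    next
      case (Inr m)
      obtain n where "L n \<le> m" "m < L (Suc n)" using interval_partition[OF mono(2), of m] by (auto simp: L_def)
      then have "Inr m \<in> ?B n" by simp
      then show ?thesis unfolding Inr by blast
    qed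
    then show "case_sum c (\<lambda>n. - e n) i = case_sum a' (\<lambda>n. - b' n) i" using i by blast
  qed
qed

section \<open>From excess functions to partial sums\<close>

lemma null_sequence_compose_inj:
  fixes x :: "nat \<Rightarrow> real"
  assumes x: "x \<longlonglongrightarrow> 0" and A: "inj A" and nonneg: "\<And>n. 0 \<le> x (A n)"
  shows "(\<lambda>n. x (A n)) \<longlonglongrightarrow> 0"
proof (rule LIMSEQ_I)
  fix r :: real assume "r > 0"
  then have "finite (A -` {i. x i \<ge> r})"
    using finite_ge_null_sequence[OF x] A by (intro finite_vimageI) auto
  then obtain N where N: "\<forall>n\<in>A -` {i. x i \<ge> r}. n < N"
    using finite_nat_set_iff_bounded by auto
  have "norm (x (A n) - 0) < r" if "n \<ge> N" for n
    using N that nonneg[of n] by (cases "x (A n) \<ge> r") auto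
  then show "\<exists>no. \<forall>n\<ge>no. norm (x (A n) - 0) < r" by blast
qed

text \<open>Entries equal to \<alpha> contribute \<open>0\<close> and may lie inside or outside the
  counted segment, so \<alpha> may itself be an entry.\<close>

lemma excess_enumeration:
  fixes A :: "nat \<Rightarrow> nat"
  assumes x: "x \<longlonglongrightarrow> 0" and A: "inj A" and \<alpha>: "\<alpha> > 0"
    and cover: "{i. x i > \<alpha>} \<subseteq> A ` {..<m}" and big: "\<And>i. i < m \<Longrightarrow> \<alpha> \<le> x (A i)"
  shows "excess x \<alpha> = (\<Sum>i<m. x (A i) - \<alpha>)"
proof -
  have "excess x \<alpha> = (\<Sum>k\<in>A ` {..<m}. max 0 (x k - \<alpha>))"
    by (rule excess_finite[OF x \<alpha> _ cover]) simp
  also have "\<dots> = (\<Sum>i<m. max 0 (x (A i) - \<alpha>))"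
    using A by (subst sum.reindex) (auto intro: inj_on_subset)
  also have "\<dots> = (\<Sum>i<m. x (A i) - \<alpha>)" using big by (intro sum.cong) auto
  finally show ?thesis .
qed

lemma excess_ge_enumeration:
  fixes A :: "nat \<Rightarrow> nat"
  assumes x: "x \<longlonglongrightarrow> 0" and A: "inj A" and \<alpha>: "\<alpha> > 0"
  shows "(\<Sum>i<m. x (A i) - \<alpha>) \<le> excess x \<alpha>"
proof -
  have "(\<Sum>i<m. x (A i) - \<alpha>) = (\<Sum>k\<in>A ` {..<m}. x k - \<alpha>)"
    using A by (subst sum.reindex) (auto intro: inj_on_subset)
  also have "\<dots> \<le> excess x \<alpha>" by (rule excess_ge_sum[OF x \<alpha>]) simp
  finally show ?thesis .
qed

text \<open>At the level of an entry of \<open>x\<close> the excess of \<open>x\<close> is its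
  partial sum minus a multiple of the level, and the excess of \<open>z\<close> is at least the
  corresponding expression, so the partial sum of differences is at least the gap. Counting the
  entries of \<open>z\<close> instead reverses the estimate; together they identify the limits
  inferior.\<close>

lemma dominates_partial_sums:
  assumes x: "x \<longlonglongrightarrow> 0" and z: "z \<longlonglongrightarrow> 0" and dom: "dominates x z s"
    and A: "inj A" "range A = {i. x i > 0}" "decseq (x \<circ> A)"
    and C: "inj C" "range C = {i. z i > 0}" "decseq (z \<circ> C)"
  shows "\<And>m. 0 \<le> (\<Sum>i<m. x (A i) - z (C i))"
    and "\<And>\<epsilon>. \<epsilon> > 0 \<Longrightarrow> \<forall>\<^sub>F m in sequentially. (\<Sum>i<m. x (A i) - z (C i)) > s - \<epsilon>"
    and "\<And>\<epsilon>. \<epsilon> > 0 \<Longrightarrow> \<exists>\<^sub>F m in sequentially. (\<Sum>i<m. x (A i) - z (C i)) < s + \<epsilon>"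
proof -
  have xA: "x (A n) > 0" and zC: "z (C n) > 0" for n using A(2) C(2) by blast+
  have decA: "x (A j) \<le> x (A i)" and decC: "z (C j) \<le> z (C i)" if "i \<le> j" for i j
    using decseqD[OF A(3) that] decseqD[OF C(3) that] by simp_all
  have xA0: "(\<lambda>n. x (A n)) \<longlonglongrightarrow> 0" and zC0: "(\<lambda>n. z (C n)) \<longlonglongrightarrow> 0"
    using null_sequence_compose_inj[OF x A(1)] null_sequence_compose_inj[OF z C(1)] xA zC
    by (simp_all add: less_imp_le)
  have low: "excess x (x (A m)) - excess z (x (A m)) \<le> (\<Sum>i<Suc m. x (A i) - z (C i))" for m
  proof -
    let ?\<alpha> = "x (A m)"
    have "{i. x i > ?\<alpha>} \<subseteq> A ` {..<Suc m}"
    proof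
      fix k assume k: "k \<in> {i. x i > ?\<alpha>}"
      then have "k \<in> range A" using A(2) xA[of m] by auto
      then obtain n where n: "k = A n" by blast
      then have "n < m" using k decA[of m n] by (cases "n < m") auto
      then show "k \<in> A ` {..<Suc m}" using n by auto
    qed
    then have "excess x ?\<alpha> = (\<Sum>i<Suc m. x (A i) - ?\<alpha>)"
      using decA by (intro excess_enumeration[OF x A(1) xA]) auto
    moreover have "(\<Sum>i<Suc m. z (C i) - ?\<alpha>) \<le> excess z ?\<alpha>" by (rule excess_ge_enumeration[OF z C(1) xA])
    moreover have "(\<Sum>i<Suc m. x (A i) - ?\<alpha>) - (\<Sum>i<Suc m. z (C i) - ?\<alpha>) = (\<Sum>i<Suc m. x (A i) - z (C i))"
      by (simp only: sum_subtractf[symmetric]) simp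
    ultimately show ?thesis by linarith
  qed
  show "0 \<le> (\<Sum>i<m. x (A i) - z (C i))" for m
  proof (cases m)
    case (Suc n)
    have "excess z (x (A n)) \<le> excess x (x (A n))" using dom xA[of n] by (simp add: dominates_def)
    then show ?thesis using low[of n] Suc by simp
  qed simp
  fix \<epsilon> :: real assume \<epsilon>: "\<epsilon> > 0"
  have "\<forall>\<^sub>F \<alpha> in at_right 0. excess x \<alpha> - excess z \<alpha> > s - \<epsilon>"
    using dom \<epsilon> by (simp add: dominates_def liminf_eq_def)
  then obtain r where r: "r > 0" "\<forall>\<alpha>>0. \<alpha> < r \<longrightarrow> excess x \<alpha> - excess z \<alpha> > s - \<epsilon>"
    unfolding eventually_at_right_field by blast
  have "\<forall>\<^sub>F m in sequentially. x (A m) < r" using order_tendstoD(2)[OF xA0 r(1)] .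
  then have "\<forall>\<^sub>F m in sequentially. (\<Sum>i<Suc m. x (A i) - z (C i)) > s - \<epsilon>"
    by eventually_elim (use r(2) xA low in \<open>meson less_le_trans\<close>)
  then show "\<forall>\<^sub>F m in sequentially. (\<Sum>i<m. x (A i) - z (C i)) > s - \<epsilon>"
    by (rule eventually_sequentially_Suc[THEN iffD1])
  show "\<exists>\<^sub>F m in sequentially. (\<Sum>i<m. x (A i) - z (C i)) < s + \<epsilon>"
    unfolding frequently_sequentially
  proof
    fix M
    have "\<exists>\<^sub>F \<alpha> in at_right 0. excess x \<alpha> - excess z \<alpha> < s + \<epsilon>"
      using dom \<epsilon> by (simp add: dominates_def liminf_eq_def)
    moreover have "\<forall>\<^sub>F \<alpha> in at_right 0. 0 < \<alpha> \<and> \<alpha> < z (C M)"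
      using zC[of M] unfolding eventually_at_right_field by blast
    ultimately obtain \<alpha> where \<alpha>: "0 < \<alpha>" "\<alpha> < z (C M)" "excess x \<alpha> - excess z \<alpha> < s + \<epsilon>"
      using frequently_ex[OF frequently_eventually_conj] by blast
    have ex: "\<exists>m. z (C m) < \<alpha>"
      using eventually_happens[OF order_tendstoD(2)[OF zC0 \<alpha>(1)]] by simp
    \<comment> \<open>The first \<open>m\<close> entries of \<open>z\<close> are those reaching
      \<alpha>, so the excess of \<open>z\<close> is computed exactly;
      \<open>\<alpha> < z (C M)\<close> forces \<open>M \<le> m\<close>.\<close>
    define m where "m = (LEAST m. z (C m) < \<alpha>)"
    have m: "z (C m) < \<alpha>" "\<And>i. i < m \<Longrightarrow> \<alpha> \<le> z (C i)"
      unfolding m_def using LeastI_ex[OF ex] not_less_Least by (blast, metis not_le_imp_less)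
    have "M \<le> m" using m(1) \<alpha>(2) decC[of m M] by (cases "M \<le> m") auto
    have "{i. z i > \<alpha>} \<subseteq> C ` {..<m}"
    proof
      fix k assume k: "k \<in> {i. z i > \<alpha>}"
      then have "k \<in> range C" using C(2) \<alpha>(1) by auto
      then obtain n where n: "k = C n" by blast
      then have "n < m" using k m(1) decC[of m n] by (cases "n < m") auto
      then show "k \<in> C ` {..<m}" using n by auto
    qed
    then have "excess z \<alpha> = (\<Sum>i<m. z (C i) - \<alpha>)"
      by (rule excess_enumeration[OF z C(1) \<alpha>(1) _ m(2)])
    moreover have "(\<Sum>i<m. x (A i) - \<alpha>) \<le> excess x \<alpha>" by (rule excess_ge_enumeration[OF x A(1) \<alpha>(1)])
    moreover have "(\<Sum>i<m. x (A i) - \<alpha>) - (\<Sum>i<m. z (C i) - \<alpha>) = (\<Sum>i<m. x (A i) - z (C i))"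
      by (simp only: sum_subtractf[symmetric]) simp
    ultimately have "(\<Sum>i<m. x (A i) - z (C i)) < s + \<epsilon>" using \<alpha>(3) by linarith
    then show "\<exists>m\<ge>M. (\<Sum>i<m. x (A i) - z (C i)) < s + \<epsilon>" using \<open>M \<le> m\<close> by blast
  qed
qed

lemma bij_case_sum:
  assumes "inj A" "range A = {k. x k > 0}" "inj B" "range B = {k. - x k > 0}" "\<And>k. x k \<noteq> (0::real)"
  shows "bij (case_sum A B)"
proof -
  have "A m \<noteq> B n" for m n
    using assms(2,4) by (metis (mono_tags, lifting) less_asym mem_Collect_eq neg_0_less_iff_less rangeI)
  then have "inj (case_sum A B)"
    using assms(1,3) by (auto intro!: injI split: sum.splits simp: inj_eq) metis
  moreover have "k \<in> range (case_sum A B)" for k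
  proof (cases "x k > 0")
    case True
    then obtain n where "k = A n" using assms(2) by blast
    then show ?thesis by (intro image_eqI[of _ _ "Inl n"]) auto
  next
    case False
    then have "- x k > 0" using assms(5)[of k] by simp
    then obtain n where "k = B n" using assms(4) by blast
    then show ?thesis by (intro image_eqI[of _ _ "Inr n"]) auto
  qed
  ultimately show ?thesis unfolding bij_def by blast
qed

section \<open>Combining the reductions\<close>

lemma diagonal_nonzero:
  fixes lam d :: "nat \<Rightarrow> real"
  assumes E: "self_adjoint E" and diag: "is_diagonal E lam"
    and lam: "lam \<longlonglongrightarrow> 0" and d: "d \<longlonglongrightarrow> 0"
    and pos: "dominates lam d s" and neg: "dominates (\<lambda>k. - lam k) (\<lambda>k. - d k) s" and s: "s > 0"
    and inf: "infinite {k. lam k > 0}" "infinite {k. - lam k > 0}" "infinite {k. d k > 0}" "infinite {k. - d k > 0}"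
    and nz: "\<And>k. lam k \<noteq> 0" "\<And>k. d k \<noteq> 0"
  shows "is_diagonal E d"
proof -
  have nlam: "(\<lambda>k. - lam k) \<longlonglongrightarrow> 0" and nd: "(\<lambda>k. - d k) \<longlonglongrightarrow> 0"
    using tendsto_minus[OF lam] tendsto_minus[OF d] by simp_all
  obtain A where A: "inj A" "range A = {i. lam i > 0}" "decseq (lam \<circ> A)"
    by (rule decreasing_enumeration[OF lam inf(1)])
  obtain B where B: "inj B" "range B = {i. - lam i > 0}" "decseq ((\<lambda>k. - lam k) \<circ> B)"
    by (rule decreasing_enumeration[OF nlam inf(2)])
  obtain C where C: "inj C" "range C = {i. d i > 0}" "decseq (d \<circ> C)"
    by (rule decreasing_enumeration[OF d inf(3)])
  obtain F where F: "inj F" "range F = {i. - d i > 0}" "decseq ((\<lambda>k. - d k) \<circ> F)"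
    by (rule decreasing_enumeration[OF nd inf(4)])
  have gt: "lam (A n) > 0" "- lam (B n) > 0" "d (C n) > 0" "- d (F n) > 0" for n
    using A(2) B(2) C(2) F(2) by blast+
  note P = dominates_partial_sums[OF lam d pos A C] and N = dominates_partial_sums[OF nlam nd neg B F]
  have bij: "bij (case_sum A B)" "bij (case_sum C F)"
    using bij_case_sum[OF A(1,2) B(1,2) nz(1)] bij_case_sum[OF C(1,2) F(1,2) nz(2)] by blast+
  \<comment> \<open>The double minus matches the form \<open>- b n\<close> in
    \<open>diagonal_regular\<close>, with \<open>b n = - lam (B n)\<close> positive.\<close>
  have "lam \<circ> case_sum A B = case_sum (\<lambda>n. lam (A n)) (\<lambda>n. - (- lam (B n)))"
    by (auto split: sum.split)
  then have "is_diagonal E (case_sum (\<lambda>n. lam (A n)) (\<lambda>n. - (- lam (B n))))"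
    using is_diagonal_reindex[OF bij(1) diag] by simp
  then have "is_diagonal E (case_sum (\<lambda>n. d (C n)) (\<lambda>n. - (- d (F n))))"
  proof (rule diagonal_regular[OF E _ _ _ _ _ _ _ _ _ P(1) N(1) P(2,3) N(2,3) s])
    show "(\<lambda>n. lam (A n)) \<longlonglongrightarrow> 0"
      by (rule null_sequence_compose_inj[OF lam A(1)]) (use gt in \<open>simp add: less_imp_le\<close>)
    show "(\<lambda>n. - lam (B n)) \<longlonglongrightarrow> 0"
      by (rule null_sequence_compose_inj[OF nlam B(1)]) (use gt(2) less_imp_le in blast)
  qed (use gt C(3) F(3) in \<open>auto simp: o_def less_imp_le\<close>)
  moreover have "d \<circ> case_sum C F = case_sum (\<lambda>n. d (C n)) (\<lambda>n. - (- d (F n)))"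
    by (auto split: sum.split)
  ultimately have "is_diagonal E (d \<circ> case_sum C F)" by simp
  then have "is_diagonal E (d \<circ> case_sum C F \<circ> inv (case_sum C F))"
    by (rule is_diagonal_reindex[OF bij_imp_bij_inv[OF bij(2)]])
  moreover have "d \<circ> case_sum C F \<circ> inv (case_sum C F) = d"
    using bij(2) by (simp add: comp_assoc surj_iff[THEN iffD1] bij_is_surj)
  ultimately show ?thesis by simp
qed

text \<open>After \<open>d\<close> is pulled apart, \<open>lam\<close> gets infinitely many positive
  entries at even indices, and then, through \<open>- E\<close>, infinitely many negative ones at
  odd indices. Together the parities catch all zeros of \<open>lam\<close>, and they protect the
  first step: the second one leaves positive entries at even indices unchanged.\<close>

lemma diagonal_dominates:
  fixes lam d :: "nat \<Rightarrow> real" and E :: "'a::complex_inner \<Rightarrow> 'a"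
  assumes E: "self_adjoint E" and diag: "is_diagonal E lam"
    and lam: "lam \<longlonglongrightarrow> 0" and d: "d \<longlonglongrightarrow> 0"
    and pos: "dominates lam d s" and neg: "dominates (\<lambda>k. - lam k) (\<lambda>k. - d k) s" and s: "s > 0"
  shows "is_diagonal E d"
proof -
  obtain d' s' where d': "d' \<longlonglongrightarrow> 0" "dominates lam d' s'" "dominates (\<lambda>k. - lam k) (\<lambda>k. - d' k) s'"
    "s' > 0" "infinite {k. d' k > 0}" "infinite {k. d' k < 0}" "\<forall>k. d' k \<noteq> 0"
    "\<forall>E :: 'a \<Rightarrow> 'a. self_adjoint E \<longrightarrow> is_diagonal E d' \<longrightarrow> is_diagonal E d"
    by (rule spread_target[OF lam d pos neg s])
  have nd': "(\<lambda>k. - d' k) \<longlonglongrightarrow> 0" using tendsto_minus[OF d'(1)] by simp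
  obtain l1 s1 where l1: "is_diagonal E l1" "l1 \<longlonglongrightarrow> 0"
    "dominates l1 d' s1" "dominates (\<lambda>k. - l1 k) (\<lambda>k. - d' k) s1" "s1 > 0"
    "infinite {k \<in> {k. even k}. l1 k > 0}"
    "\<forall>k. l1 k > 0 \<or> l1 k = lam k \<and> (k \<in> {k. even k} \<longrightarrow> lam k \<noteq> 0)"
    "\<forall>k. k \<notin> {k. even k} \<longrightarrow> lam k \<le> 0 \<longrightarrow> l1 k = lam k"
    by (rule spread_positive[OF E diag lam d'(1-4) infinite_even])
  have nl1: "(\<lambda>k. - l1 k) \<longlonglongrightarrow> 0" using tendsto_minus[OF l1(2)] by simp
  have neg1: "dominates (\<lambda>k. - (- l1 k)) (\<lambda>k. - (- d' k)) s1" using l1(3) by simp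
  obtain l2 s2 where l2: "is_diagonal (\<lambda>x. - E x) l2" "l2 \<longlonglongrightarrow> 0"
    "dominates l2 (\<lambda>k. - d' k) s2" "dominates (\<lambda>k. - l2 k) (\<lambda>k. - (- d' k)) s2" "s2 > 0"
    "infinite {k \<in> {k. odd k}. l2 k > 0}"
    "\<forall>k. l2 k > 0 \<or> l2 k = - l1 k \<and> (k \<in> {k. odd k} \<longrightarrow> - l1 k \<noteq> 0)"
    "\<forall>k. k \<notin> {k. odd k} \<longrightarrow> - l1 k \<le> 0 \<longrightarrow> l2 k = - l1 k"
    by (rule spread_positive[OF self_adjoint_uminus[OF E] is_diagonal_uminus[OF l1(1)] nl1 nd'
          l1(4) neg1 l1(5) infinite_odd])
  have "is_diagonal E (\<lambda>k. - l2 k)" using is_diagonal_uminus[OF l2(1)] by simp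
  then have "is_diagonal E d'"
  proof (rule diagonal_nonzero[OF E])
    show "(\<lambda>k. - l2 k) \<longlonglongrightarrow> 0" using tendsto_minus[OF l2(2)] by simp
    have "{k \<in> {k. even k}. l1 k > 0} \<subseteq> {k. - l2 k > 0}" using l2(8) by auto
    then show "infinite {k. - l2 k > 0}" using l1(6) finite_subset by blast
    have "{k \<in> {k. odd k}. l2 k > 0} \<subseteq> {k. - (- l2 k) > 0}" by auto
    then show "infinite {k. - (- l2 k) > 0}" using l2(6) finite_subset by blast
    \<comment> \<open>A zero of \<open>l2\<close> would be an unchanged zero of \<open>l1\<close> at
      an even index, where the first spreading left none.\<close>
    show "- l2 k \<noteq> 0" for k
    proof
      assume "- l2 k = 0"
      then have "l1 k = 0" "even k" using l2(7)[rule_format, of k] by auto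
      then show False using l1(7)[rule_format, of k] by auto
    qed
    show "dominates (\<lambda>k. - l2 k) d' s2" "dominates (\<lambda>k. - (- l2 k)) (\<lambda>k. - d' k) s2"
      using l2(3,4) by simp_all
  qed (use d' l2(5) in auto)
  then show ?thesis using d'(8) E by blast
qed

lemma delta_pos: "\<alpha> > 0 \<Longrightarrow> delta \<alpha> lam d = excess lam \<alpha> - excess d \<alpha>"
  by (simp add: delta_def excess_def)

lemma delta_uminus:
  assumes "\<alpha> > 0" shows "delta (- \<alpha>) lam d = excess (\<lambda>k. - lam k) \<alpha> - excess (\<lambda>k. - d k) \<alpha>"
proof -
  have "{i. x i \<le> - \<alpha>} = {i. \<alpha> \<le> - x i}" for x :: "nat \<Rightarrow> real" by auto
  then show ?thesis using assms by (simp add: delta_def excess_def minus_diff_commute)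
qed

lemma liminf_eq_cong:
  assumes "liminf_eq f s F" "\<forall>\<^sub>F a in F. f a = g a" shows "liminf_eq g s F"
  unfolding liminf_eq_def
proof (intro allI impI conjI)
  fix \<epsilon> :: real assume "\<epsilon> > 0"
  then have f: "\<forall>\<^sub>F a in F. f a > s - \<epsilon>" "\<exists>\<^sub>F a in F. f a < s + \<epsilon>"
    using assms(1) by (simp_all add: liminf_eq_def)
  show "\<forall>\<^sub>F a in F. g a > s - \<epsilon>" using f(1) assms(2) by eventually_elim simp
  show "\<exists>\<^sub>F a in F. g a < s + \<epsilon>"
    using frequently_eventually_conj[OF f(2) assms(2)] by (rule frequently_elim1) simp
qed

theorem theorem7p1:
  fixes lam d :: "nat \<Rightarrow> real"
    and E :: "'a::{complex_inner, polish_space} \<Rightarrow> 'a"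
  assumes "lam \<longlonglongrightarrow> 0"
    and "d \<longlonglongrightarrow> 0"
    and "self_adjoint E"
    and "is_diagonal E lam"
    and "\<And>\<alpha>. \<alpha> \<noteq> 0 \<Longrightarrow> delta \<alpha> lam d \<ge> 0"
    and "Liminf (at_right 0) (\<lambda>\<alpha>. ereal (delta \<alpha> lam d)) =
         Liminf (at_left 0) (\<lambda>\<alpha>. ereal (delta \<alpha> lam d))"
    and "0 < Liminf (at_right 0) (\<lambda>\<alpha>. ereal (delta \<alpha> lam d))"
    and "Liminf (at_right 0) (\<lambda>\<alpha>. ereal (delta \<alpha> lam d)) < \<infinity>"
  shows "is_diagonal E d"
proof -
  define s where "s = real_of_ereal (Liminf (at_right 0) (\<lambda>\<alpha>. ereal (delta \<alpha> lam d)))"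
  have s: "s > 0" unfolding s_def using assms(7,8) by (cases "Liminf (at_right 0) (\<lambda>\<alpha>. ereal (delta \<alpha> lam d))") auto
  have right: "liminf_eq (\<lambda>\<alpha>. delta \<alpha> lam d) s (at_right 0)"
    unfolding s_def by (rule liminf_eq_ereal[OF _ assms(7,8)]) simp
  have left: "liminf_eq (\<lambda>\<alpha>. delta \<alpha> lam d) s (at_left 0)"
    unfolding s_def assms(6) by (rule liminf_eq_ereal) (use assms(6-8) in simp_all)
  have at_pos: "\<forall>\<^sub>F \<alpha> in at_right 0. \<alpha> > (0::real)" by (rule eventually_at_right_less)
  have "dominates lam d s"
    unfolding dominates_def
  proof (intro conjI allI impI)
    show "excess d \<alpha> \<le> excess lam \<alpha>" if "\<alpha> > 0" for \<alpha>
      using assms(5)[of \<alpha>] that by (simp add: delta_pos)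
    show "liminf_eq (\<lambda>\<alpha>. excess lam \<alpha> - excess d \<alpha>) s (at_right 0)"
      by (rule liminf_eq_cong[OF right]) (use at_pos in \<open>eventually_elim, simp add: delta_pos\<close>)
  qed
  moreover have "dominates (\<lambda>k. - lam k) (\<lambda>k. - d k) s"
    unfolding dominates_def
  proof (intro conjI allI impI)
    show "excess (\<lambda>k. - d k) \<alpha> \<le> excess (\<lambda>k. - lam k) \<alpha>" if "\<alpha> > 0" for \<alpha>
      using assms(5)[of "- \<alpha>"] that by (simp add: delta_uminus)
    \<comment> \<open>The left neighbourhoods of \<open>0\<close> are the images of the right ones
      under negation.\<close>
    have "liminf_eq (\<lambda>\<alpha>. delta (- \<alpha>) lam d) s (at_right 0)"
      using left unfolding liminf_eq_def at_left_minus[of "0::real"] eventually_filtermap frequently_def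
      by simp
    then show "liminf_eq (\<lambda>\<alpha>. excess (\<lambda>k. - lam k) \<alpha> - excess (\<lambda>k. - d k) \<alpha>) s (at_right 0)"
      by (rule liminf_eq_cong) (use at_pos in \<open>eventually_elim, simp add: delta_uminus\<close>)
  qed
  ultimately show ?thesis
    by (intro diagonal_dominates[OF assms(3,4,1,2) _ _ s])
qed

end
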